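(* Let $\bm\phi:\mathfrak{g}\to\operatorname{Der}(\hat S(\mathfrak{g}^* ))$ be a Lie algebra homomorphism such that the matrix $\phi=(\phi^j_i)$, $\phi^j_i:=\bm\phi(-\hat x_i)(\partial^j)$, is close to the identity (so invertible). Then: (a) there is a unique Lie algebra homomorphism $\tilde{\bm\phi}:\mathfrak{g}\to\operatorname{Der}(\Lambda^*(\mathfrak{g})\otimes\hat S(\mathfrak{g}^* ))$ such that for each $i$ the derivation $\tilde{\bm\phi}(\hat x_i)$ restricts to $\bm\phi(\hat x_i)$ on $1\otimes\hat S(\mathfrak{g}^* )$ and $$\tilde{\bm\phi}(\hat x_i)(d\hat x_l)=-\sum_{k,r,s=1}^n d\hat x_k\,(\phi^{-1})^k_s\,\frac{\partial \phi^s_l}{\partial(\partial^r)}\,\phi^r_i\qquad(l=1,\dots,n);$$ (b) $\tilde{\bm\phi}$ extends to a Hopf action $\tilde{\bm\phi}:U(\mathfrak{g})\to\operatorname{End}_{\bm k}(\Lambda^*(\mathfrak{g})\otimes\hat S(\mathfrak{g}^* ))$, making $A:=\Lambda^*(\mathfrak{g})\otimes\hat S(\mathfrak{g}^* )$ a left $U(\mathfrak{g})$-module algebra, so that the smash product $U(\mathfrak{g})\sharp_{\gamma\circ\tilde{\bm\phi}}A$ is well defined; (c) in $U(\mathfrak{g})\sharp_{\gamma\circ\tilde{\bm\phi}}A$, for every $\omega\in A$ and every $i_1,\dots,i_k\in\{1,\dots,n\}$, $$\tilde{\bm\phi}(\gamma(\hat x_{i_1}\cdots\hat x_{i_k}))(\omega)=[\ldots[[\omega,\hat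 x_{i_1}],\hat x_{i_2}],\ldots,\hat x_{i_k}].$$
   Context: $\mathfrak{g}$ is an $n$-dimensional Lie algebra over a field $\bm k$ of characteristic zero with basis $\hat x_1,\dots,\hat x_n$ and structure constants $[\hat x_i,\hat x_j]=\sum_s C^s_{ij}\hat x_s$; $U(\mathfrak{g})$ is its universal enveloping algebra with antipode $\gamma$. $\partial^1,\dots,\partial^n$ is the dual basis of $\mathfrak{g}^*$, and $\hat S(\mathfrak{g}^* )=\bm k[[\partial^1,\dots,\partial^n]]$ is the completed symmetric algebra (formal power series); $\partial P/\partial(\partial^r)$ denotes the formal partial derivative of $P\in\hat S(\mathfrak{g}^* )$ in the variable $\partial^r$. "Close to the identity" means that the matrix obtained by setting all $\partial^j=0$ in the entries $\phi^j_i$ is the identity matrix. $\Lambda^*(\mathfrak{g})$ is the exterior algebra on $\mathfrak{g}$, whose generators corresponding to $\hat x_1,\dots,\hat x_n$ are written $d\hat x_1,\dots,d\hat x_n$; $\Lambda^*(\mathfrak{g})\otimes\hat S(\mathfrak{g}^* )$ is the tensor product algebra (the $d\hat x_i$ commute with elements of $\hat S(\mathfrak{g}^* )$), and $\operatorname{Der}$ means (ordinary, even) derivations. For a right $U(\mathfrak{g})$-module algebra $A$ with action $a\cdot h$ (here $a\cdot h:=\tilde{\bm\phi}(\gamma(h))(a)$), the smash product $U(\mathfrak{g})\sharp A$ is $U(\mathfrak{g})\otimes A$ with multiplication $(h\otimes a)(h'\otimes a')=\sum hh'_{(1)}\otimes(a\cdot h'_{(2)})a'$ (Sweedler notation for the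 coproduct of $U(\mathfrak{g})$). *)

theory Defs
  imports Main
begin

text \<open>Concrete coordinate model.  The Lie algebra g has basis x_0,...,x_(n-1) and
structure constants C s i j = C^s_{ij}.  Formal power series in the variables
d^0,...,d^(n-1) are coefficient functions on multi-indices.  Elements of
Lambda*(g) (x) S^(g^* ) are coefficient functions on pairs (S, alpha), where S is a
finite set of indices (the wedge monomial dx_S in increasing order) and alpha is a
multi-index.\<close>

type_synonym 'k ser = "(nat \<Rightarrow> nat) \<Rightarrow> 'k"
type_synonym 'k ext = "nat set \<Rightarrow> (nat \<Rightarrow> nat) \<Rightarrow> 'k"
type_synonym 'k nc = "nat list \<Rightarrow> 'k"
type_synonym 'k sm = "nat list \<Rightarrow> 'k ext"

definition is_lie_alg :: "nat \<Rightarrow> (nat \<Rightarrow> nat \<Rightarrow> nat \<Rightarrow> 'k::field) \<Rightarrow> bool" where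
  "is_lie_alg n C \<longleftrightarrow>
     (\<forall>s<n. \<forall>i<n. \<forall>j<n. C s i i = 0 \<and> C s i j = - C s j i) \<and>
     (\<forall>i<n. \<forall>j<n. \<forall>k<n. \<forall>t<n.
        (\<Sum>s<n. C s i j * C t s k + C s j k * C t s i + C s k i * C t s j) = 0)"

definition mi :: "nat \<Rightarrow> (nat \<Rightarrow> nat) \<Rightarrow> bool" where
  "mi n \<alpha> \<longleftrightarrow> (\<forall>j\<ge>n. \<alpha> j = 0)"

definition ser_carrier :: "nat \<Rightarrow> 'k::field ser set" where
  "ser_carrier n = {f. \<forall>\<alpha>. \<not> mi n \<alpha> \<longrightarrow> f \<alpha> = 0}"

definition ser_zero :: "'k::field ser" where "ser_zero = (\<lambda>_. 0)"
definition ser_one :: "'k::field ser" where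
  "ser_one = (\<lambda>\<alpha>. if \<alpha> = (\<lambda>_. 0) then 1 else 0)"
definition ser_add :: "'k::field ser \<Rightarrow> 'k ser \<Rightarrow> 'k ser" where
  "ser_add f g = (\<lambda>\<alpha>. f \<alpha> + g \<alpha>)"
definition ser_smul :: "'k::field \<Rightarrow> 'k ser \<Rightarrow> 'k ser" where
  "ser_smul c f = (\<lambda>\<alpha>. c * f \<alpha>)"
definition ser_neg :: "'k::field ser \<Rightarrow> 'k ser" where
  "ser_neg f = (\<lambda>\<alpha>. - f \<alpha>)"
definition ser_mul :: "'k::field ser \<Rightarrow> 'k ser \<Rightarrow> 'k ser" where
  "ser_mul f g = (\<lambda>\<alpha>. \<Sum>\<beta>\<in>{\<beta>. \<beta> \<le> \<alpha>}. f \<beta> * g (\<lambda>j. \<alpha> j - \<beta> j))"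

definition ser_var :: "nat \<Rightarrow> 'k::field ser" where
  "ser_var j = (\<lambda>\<alpha>. if \<alpha> = (\<lambda>m. if m = j then 1 else 0) then 1 else 0)"

definition ser_pd :: "nat \<Rightarrow> 'k::field ser \<Rightarrow> 'k ser" where
  "ser_pd r P = (\<lambda>\<alpha>. of_nat (Suc (\<alpha> r)) * P (\<alpha>(r := Suc (\<alpha> r))))"

definition ser_der :: "nat \<Rightarrow> ('k::field ser \<Rightarrow> 'k ser) \<Rightarrow> bool" where
  "ser_der n D \<longleftrightarrow>
     (\<forall>f\<in>ser_carrier n. D f \<in> ser_carrier n) \<and>
     (\<forall>f\<in>ser_carrier n. \<forall>g\<in>ser_carrier n. D (ser_add f g) = ser_add (D f) (D g)) \<and>
     (\<forall>c. \<forall>f\<in>ser_carrier n. D (ser_smul c f) = ser_smul c (D f)) \<and>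
     (\<forall>f\<in>ser_carrier n. \<forall>g\<in>ser_carrier n.
        D (ser_mul f g) = ser_add (ser_mul (D f) g) (ser_mul f (D g)))"

text \<open>A Lie algebra homomorphism g \<rightarrow> Der(S^(g^* )), given by the images phi i of the
basis vectors x_i (extended linearly).\<close>
definition lie_hom_ser :: "nat \<Rightarrow> (nat \<Rightarrow> nat \<Rightarrow> nat \<Rightarrow> 'k::field) \<Rightarrow> (nat \<Rightarrow> 'k ser \<Rightarrow> 'k ser) \<Rightarrow> bool" where
  "lie_hom_ser n C phi \<longleftrightarrow>
     (\<forall>i<n. ser_der n (phi i)) \<and>
     (\<forall>i<n. \<forall>j<n. \<forall>f\<in>ser_carrier n. \<forall>\<alpha>.
        phi i (phi j f) \<alpha> - phi j (phi i f) \<alpha> = (\<Sum>s<n. C s i j * phi s f \<alpha>))"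

definition phimat :: "(nat \<Rightarrow> 'k::field ser \<Rightarrow> 'k ser) \<Rightarrow> nat \<Rightarrow> nat \<Rightarrow> 'k ser" where
  "phimat phi j i = ser_neg (phi i (ser_var j))"

definition close_to_id :: "nat \<Rightarrow> (nat \<Rightarrow> nat \<Rightarrow> 'k::field ser) \<Rightarrow> bool" where
  "close_to_id n M \<longleftrightarrow> (\<forall>i<n. \<forall>j<n. M j i (\<lambda>_. 0) = (if i = j then 1 else 0))"

text \<open>Inverse matrix over the power series ring (M j i is the entry in row j, column i).\<close>
definition ser_mat_inv :: "nat \<Rightarrow> (nat \<Rightarrow> nat \<Rightarrow> 'k::field ser) \<Rightarrow> nat \<Rightarrow> nat \<Rightarrow> 'k ser" where
  "ser_mat_inv n M = (THE N.
     (\<forall>k s. (n \<le> k \<or> n \<le> s) \<longrightarrow> N k s = ser_zero) \<and>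
     (\<forall>k<n. \<forall>s<n. N k s \<in> ser_carrier n) \<and>
     (\<forall>k<n. \<forall>l<n. (\<lambda>\<alpha>. \<Sum>s<n. ser_mul (N k s) (M s l) \<alpha>) = (if k = l then ser_one else ser_zero)) \<and>
     (\<forall>k<n. \<forall>l<n. (\<lambda>\<alpha>. \<Sum>s<n. ser_mul (M k s) (N s l) \<alpha>) = (if k = l then ser_one else ser_zero)))"

definition ext_carrier :: "nat \<Rightarrow> 'k::field ext set" where
  "ext_carrier n = {a. \<forall>S \<alpha>. (\<not> S \<subseteq> {..<n} \<or> \<not> mi n \<alpha>) \<longrightarrow> a S \<alpha> = 0}"

definition ext_zero :: "'k::field ext" where "ext_zero = (\<lambda>_ _. 0)"
definition ext_add :: "'k::field ext \<Rightarrow> 'k ext \<Rightarrow> 'k ext" where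
  "ext_add a b = (\<lambda>S \<alpha>. a S \<alpha> + b S \<alpha>)"
definition ext_smul :: "'k::field \<Rightarrow> 'k ext \<Rightarrow> 'k ext" where
  "ext_smul c a = (\<lambda>S \<alpha>. c * a S \<alpha>)"
definition ext_neg :: "'k::field ext \<Rightarrow> 'k ext" where
  "ext_neg a = (\<lambda>S \<alpha>. - a S \<alpha>)"

text \<open>Sign of dx_T \<and> dx_U = sign * dx_(T \<union> U) for disjoint T, U.\<close>
definition ext_sign :: "nat set \<Rightarrow> nat set \<Rightarrow> 'k::field" where
  "ext_sign T U = (-1) ^ card {(t, u). t \<in> T \<and> u \<in> U \<and> u < t}"

definition ext_mul :: "'k::field ext \<Rightarrow> 'k ext \<Rightarrow> 'k ext" where
  "ext_mul a b = (\<lambda>S \<alpha>. \<Sum>T\<in>Pow S. \<Sum>\<beta>\<in>{\<beta>. \<beta> \<le> \<alpha>}.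
      ext_sign T (S - T) * a T \<beta> * b (S - T) (\<lambda>j. \<alpha> j - \<beta> j))"

definition sca :: "'k::field ser \<Rightarrow> 'k ext" where
  "sca P = (\<lambda>S \<alpha>. if S = {} then P \<alpha> else 0)"

definition ext_one :: "'k::field ext" where "ext_one = sca ser_one"

definition dx :: "nat \<Rightarrow> 'k::field ext" where
  "dx l = (\<lambda>S \<alpha>. if S = {l} \<and> \<alpha> = (\<lambda>_. 0) then 1 else 0)"

definition ext_der :: "nat \<Rightarrow> ('k::field ext \<Rightarrow> 'k ext) \<Rightarrow> bool" where
  "ext_der n D \<longleftrightarrow>
     (\<forall>a\<in>ext_carrier n. D a \<in> ext_carrier n) \<and>
     (\<forall>a\<in>ext_carrier n. \<forall>b\<in>ext_carrier n. D (ext_add a b) = ext_add (D a) (D b)) \<and>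
     (\<forall>c. \<forall>a\<in>ext_carrier n. D (ext_smul c a) = ext_smul c (D a)) \<and>
     (\<forall>a\<in>ext_carrier n. \<forall>b\<in>ext_carrier n.
        D (ext_mul a b) = ext_add (ext_mul (D a) b) (ext_mul a (D b)))"

definition lie_hom_ext :: "nat \<Rightarrow> (nat \<Rightarrow> nat \<Rightarrow> nat \<Rightarrow> 'k::field) \<Rightarrow> (nat \<Rightarrow> 'k ext \<Rightarrow> 'k ext) \<Rightarrow> bool" where
  "lie_hom_ext n C psi \<longleftrightarrow>
     (\<forall>i<n. ext_der n (psi i)) \<and>
     (\<forall>i<n. \<forall>j<n. \<forall>a\<in>ext_carrier n. \<forall>S \<alpha>.
        psi i (psi j a) S \<alpha> - psi j (psi i a) S \<alpha> = (\<Sum>s<n. C s i j * psi s a S \<alpha>))"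

definition tilde_ok :: "nat \<Rightarrow> (nat \<Rightarrow> nat \<Rightarrow> nat \<Rightarrow> 'k::field) \<Rightarrow> (nat \<Rightarrow> 'k ser \<Rightarrow> 'k ser)
     \<Rightarrow> (nat \<Rightarrow> 'k ext \<Rightarrow> 'k ext) \<Rightarrow> bool" where
  "tilde_ok n C phi phit \<longleftrightarrow>
     lie_hom_ext n C phit \<and>
     (\<forall>i<n. \<forall>P\<in>ser_carrier n. phit i (sca P) = sca (phi i P)) \<and>
     (\<forall>i<n. \<forall>l<n. phit i (dx l) = ext_neg (\<lambda>S \<alpha>.
        \<Sum>k<n. \<Sum>r<n. \<Sum>s<n. ext_mul (dx k)
          (sca (ser_mul (ser_mul (ser_mat_inv n (phimat phi) k s) (ser_pd r (phimat phi s l)))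
                        (phimat phi r i))) S \<alpha>))"

subsection \<open>U(g): noncommutative polynomials modulo the ideal I\<close>

definition nc_carrier :: "nat \<Rightarrow> 'k::field nc set" where
  "nc_carrier n = {h. finite {w. h w \<noteq> 0} \<and> (\<forall>w. h w \<noteq> 0 \<longrightarrow> set w \<subseteq> {..<n})}"

definition nc_sandwich :: "nat list \<Rightarrow> 'k::field nc \<Rightarrow> nat list \<Rightarrow> 'k nc" where
  "nc_sandwich u p v = (\<lambda>w.
     if length u + length v \<le> length w \<and> take (length u) w = u \<and> drop (length w - length v) w = v
     then p (take (length w - length u - length v) (drop (length u) w)) else 0)"

definition ug_rel :: "nat \<Rightarrow> (nat \<Rightarrow> nat \<Rightarrow> nat \<Rightarrow> 'k::field) \<Rightarrow> nat \<Rightarrow> nat \<Rightarrow> 'k nc" where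
  "ug_rel n C i j = (\<lambda>w. (if w = [i, j] then 1 else 0) - (if w = [j, i] then 1 else 0)
      - (if length w = 1 \<and> hd w < n then C (hd w) i j else 0))"

inductive_set ug_ideal :: "nat \<Rightarrow> (nat \<Rightarrow> nat \<Rightarrow> nat \<Rightarrow> 'k::field) \<Rightarrow> 'k nc set"
  for n C where
  zero: "(\<lambda>_. 0) \<in> ug_ideal n C"
| step: "h \<in> ug_ideal n C \<Longrightarrow> i < n \<Longrightarrow> j < n \<Longrightarrow> set u \<subseteq> {..<n} \<Longrightarrow> set v \<subseteq> {..<n}
         \<Longrightarrow> (\<lambda>w. h w + c * nc_sandwich u (ug_rel n C i j) v w) \<in> ug_ideal n C"

definition ug_act :: "(nat \<Rightarrow> 'k::field ext \<Rightarrow> 'k ext) \<Rightarrow> nat list \<Rightarrow> 'k ext \<Rightarrow> 'k ext" where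
  "ug_act phit w = foldr (\<lambda>i f. phit i \<circ> f) w id"

definition ug_act_lin :: "(nat \<Rightarrow> 'k::field ext \<Rightarrow> 'k ext) \<Rightarrow> 'k nc \<Rightarrow> 'k ext \<Rightarrow> 'k ext" where
  "ug_act_lin phit h a = (\<lambda>S \<alpha>. \<Sum>w\<in>{w. h w \<noteq> 0}. h w * ug_act phit w a S \<alpha>)"

text \<open>Part (b): the extension is well defined on U(g) = T(g)/I, acts by k-linear
endomorphisms of A, and A is a left U(g)-module algebra (coproduct of words:
Delta(w) = sum over position subsets T of w|_T \<otimes> w|_(complement), counit eps(w) = [w = []]).\<close>
definition hopf_action :: "nat \<Rightarrow> (nat \<Rightarrow> nat \<Rightarrow> nat \<Rightarrow> 'k::field) \<Rightarrow> (nat \<Rightarrow> 'k ext \<Rightarrow> 'k ext) \<Rightarrow> bool" where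
  "hopf_action n C phit \<longleftrightarrow>
     (\<forall>h\<in>ug_ideal n C. \<forall>a\<in>ext_carrier n. ug_act_lin phit h a = ext_zero) \<and>
     (\<forall>w. set w \<subseteq> {..<n} \<longrightarrow>
        (\<forall>a\<in>ext_carrier n. ug_act phit w a \<in> ext_carrier n) \<and>
        (\<forall>a\<in>ext_carrier n. \<forall>b\<in>ext_carrier n. ug_act phit w (ext_add a b) = ext_add (ug_act phit w a) (ug_act phit w b)) \<and>
        (\<forall>c. \<forall>a\<in>ext_carrier n. ug_act phit w (ext_smul c a) = ext_smul c (ug_act phit w a)) \<and>
        (\<forall>a\<in>ext_carrier n. \<forall>b\<in>ext_carrier n.
           ug_act phit w (ext_mul a b) = (\<lambda>S \<alpha>. \<Sum>T\<in>Pow {..<length w}.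
              ext_mul (ug_act phit (nths w T) a) (ug_act phit (nths w ({..<length w} - T)) b) S \<alpha>)) \<and>
        ug_act phit w ext_one = (if w = [] then ext_one else ext_zero))"

text \<open>Elements of T(g) (x) A as finitely supported maps word \<mapsto> A.\<close>
definition sm_carrier :: "nat \<Rightarrow> 'k::field sm set" where
  "sm_carrier n = {X. finite {w. X w \<noteq> ext_zero} \<and>
     (\<forall>w. X w \<in> ext_carrier n \<and> (X w \<noteq> ext_zero \<longrightarrow> set w \<subseteq> {..<n}))}"

text \<open>Right action a . u := tilde-phi(gamma(u))(a), gamma(x_i1...x_ik) = (-1)^k x_ik...x_i1.\<close>
definition ract :: "(nat \<Rightarrow> 'k::field ext \<Rightarrow> 'k ext) \<Rightarrow> 'k ext \<Rightarrow> nat list \<Rightarrow> 'k ext" where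
  "ract phit a u = ext_smul ((-1) ^ length u) (ug_act phit (rev u) a)"

definition sm_mul :: "(nat \<Rightarrow> 'k::field ext \<Rightarrow> 'k ext) \<Rightarrow> 'k sm \<Rightarrow> 'k sm \<Rightarrow> 'k sm" where
  "sm_mul phit X Y = (\<lambda>v S \<alpha>.
     \<Sum>w\<in>{w. X w \<noteq> ext_zero}. \<Sum>w'\<in>{w'. Y w' \<noteq> ext_zero}.
       \<Sum>T\<in>{T. T \<subseteq> {..<length w'} \<and> w @ nths w' T = v}.
         ext_mul (ract phit (X w) (nths w' ({..<length w'} - T))) (Y w') S \<alpha>)"

definition sm_single :: "nat list \<Rightarrow> 'k::field ext \<Rightarrow> 'k sm" where
  "sm_single w a = (\<lambda>v. if v = w then a else ext_zero)"

definition sm_sub :: "'k::field sm \<Rightarrow> 'k sm \<Rightarrow> 'k sm" where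
  "sm_sub X Y = (\<lambda>v. ext_add (X v) (ext_neg (Y v)))"

definition sm_bracket :: "(nat \<Rightarrow> 'k::field ext \<Rightarrow> 'k ext) \<Rightarrow> 'k sm \<Rightarrow> 'k sm \<Rightarrow> 'k sm" where
  "sm_bracket phit X Y = sm_sub (sm_mul phit X Y) (sm_mul phit Y X)"

fun sm_iter_br :: "(nat \<Rightarrow> 'k::field ext \<Rightarrow> 'k ext) \<Rightarrow> 'k sm \<Rightarrow> nat list \<Rightarrow> 'k sm" where
  "sm_iter_br phit X [] = X"
| "sm_iter_br phit X (i # is) = sm_iter_br phit (sm_bracket phit X (sm_single [i] ext_one)) is"

text \<open>The two-sided ideal I (x) A; the smash product is (T(g) (x) A)/(I (x) A).\<close>
inductive_set sm_ideal :: "nat \<Rightarrow> (nat \<Rightarrow> nat \<Rightarrow> nat \<Rightarrow> 'k::field) \<Rightarrow> 'k sm set"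
  for n C where
  zero: "(\<lambda>_. ext_zero) \<in> sm_ideal n C"
| step: "X \<in> sm_ideal n C \<Longrightarrow> h \<in> ug_ideal n C \<Longrightarrow> a \<in> ext_carrier n
         \<Longrightarrow> (\<lambda>v. ext_add (X v) (ext_smul (h v) a)) \<in> sm_ideal n C"

definition smash_well_defined :: "nat \<Rightarrow> (nat \<Rightarrow> nat \<Rightarrow> nat \<Rightarrow> 'k::field) \<Rightarrow> (nat \<Rightarrow> 'k ext \<Rightarrow> 'k ext) \<Rightarrow> bool" where
  "smash_well_defined n C phit \<longleftrightarrow>
     (\<forall>X\<in>sm_carrier n. \<forall>Y\<in>sm_carrier n. \<forall>Z\<in>sm_carrier n.
        sm_mul phit (sm_mul phit X Y) Z = sm_mul phit X (sm_mul phit Y Z)) \<and>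
     (\<forall>X\<in>sm_ideal n C. \<forall>Y\<in>sm_carrier n.
        sm_mul phit X Y \<in> sm_ideal n C \<and> sm_mul phit Y X \<in> sm_ideal n C)"

end

theory Submission
  imports Defs "HOL-Library.Function_Algebras"
begin

text \<open>Put \<open>y\<^sub>s = \<Sum>\<^sub>k dx\<^sub>k (\<phi>\<^sup>-\<^sup>1)\<^sup>k\<^sub>s\<close>. A derivation of the power series ring obeys the chain rule,
  so the prescribed value on \<open>dx\<^sub>l\<close> is \<open>\<Sum>\<^sub>k\<^sub>,\<^sub>s dx\<^sub>k (\<phi>\<^sup>-\<^sup>1)\<^sup>k\<^sub>s \<phi>\<^sub>i(\<phi>\<^sup>s\<^sub>l)\<close>, which says precisely that the
  extended derivations annihilate every \<open>y\<^sub>s\<close>. Since the \<open>y\<^sub>s\<close> generate the exterior algebra over the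
  power series, the extended derivations satisfy the same commutation relations as the given ones.
  The module algebra and smash product axioms then follow because the generators act by derivations
  and the relators of the enveloping algebra are primitive, and the bracket of \<open>\<omega>\<close> with a generator
  equals \<open>\<omega>\<close> acted on by its antipode.\<close>

section \<open>Formal power series\<close>

text \<open>Since \<open>dx l\<close> is the sum over s of y_s times \<open>M s l\<close>, constant
  y_s force its image to be the sum of y_s times \<open>phi i (M s l)\<close>. This explains the
  prescribed formula but does not yet give a map on the whole algebra: elements are coefficient
  functions with respect to the dx, and a definition through the y_s would need a change of basis in
  every wedge power. The extension is therefore written with contractions, as the coefficientwise
  action plus a combination of operators dx_k \<and> \<iota>_l, and the y_s serve to verify the
  commutation relations. Differences, commutators and linear combinations of derivations are
  derivations, so uniqueness and the bracket relations both become vanishing on generators. The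
  smash product is represented by T(g) \<otimes> A together with I \<otimes> A. The product is
  associative already on T(g) \<otimes> A, where the letters are free; the relations enter only in
  showing that I \<otimes> A is two-sided. The iterated bracket formula is also an identity in T(g)
  \<otimes> A and descends to the quotient.\<close>

lemma sum_fun_apply: "sum f A x = (\<Sum>a\<in>A. f a x)"
  by (induction A rule: infinite_finite_induct) auto

lemma ser_ops [simp]:
  "ser_zero = 0" "ser_add f g = f + g" "ser_neg f = - f"
  by (simp_all add: ser_zero_def ser_add_def ser_neg_def fun_eq_iff)

lemma ext_ops [simp]:
  "ext_zero = 0" "ext_add a b = a + b" "ext_neg a = - a"
  by (simp_all add: ext_zero_def ext_add_def ext_neg_def fun_eq_iff)

lemma sm_sub_eq [simp]: "sm_sub X Y = X - Y"
  by (simp add: sm_sub_def fun_eq_iff)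

lemma ser_smul_apply [simp]: "ser_smul c f \<alpha> = c * f \<alpha>"
  by (simp add: ser_smul_def)

lemma ext_smul_apply [simp]: "ext_smul c a S \<alpha> = c * a S \<alpha>"
  by (simp add: ext_smul_def)

lemma ext_smul_component: "ext_smul c a S = ser_smul c (a S)"
  by (simp add: fun_eq_iff)

text \<open>Both sides run over the decompositions of \<alpha> into three summands. Truncated
  subtraction does no harm, since every subtracted multi-index lies below the one it is taken
  from.\<close>

lemma conv_assoc:
  fixes F :: "(nat \<Rightarrow> nat) \<Rightarrow> (nat \<Rightarrow> nat) \<Rightarrow> (nat \<Rightarrow> nat) \<Rightarrow> 'a::comm_monoid_add"
  assumes fin: "finite {\<beta>. \<beta> \<le> \<alpha>}"
  shows "(\<Sum>\<beta>\<in>{\<beta>. \<beta> \<le> \<alpha>}. \<Sum>\<gamma>\<in>{\<gamma>. \<gamma> \<le> \<beta>}. F \<gamma> (\<lambda>j. \<beta> j - \<gamma> j) (\<lambda>j. \<alpha> j - \<beta> j))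
       = (\<Sum>\<gamma>\<in>{\<gamma>. \<gamma> \<le> \<alpha>}. \<Sum>\<delta>\<in>{\<delta>. \<delta> \<le> (\<lambda>j. \<alpha> j - \<gamma> j)}. F \<gamma> \<delta> (\<lambda>j. \<alpha> j - \<gamma> j - \<delta> j))"
proof -
  have f1: "finite {\<gamma>. \<gamma> \<le> \<beta>}" if "\<beta> \<le> \<alpha>" for \<beta>
    using that by (intro finite_subset[OF _ fin]) auto
  have f2: "finite {\<delta>. \<delta> \<le> (\<lambda>j. \<alpha> j - \<gamma> j)}" for \<gamma>
    by (rule f1) (simp add: le_fun_def)
  show ?thesis
    using fin f1 f2
    apply (simp add: sum.Sigma)
    apply (rule sum.reindex_bij_witness[where
        i = "\<lambda>(\<gamma>, \<delta>). (\<lambda>j. \<gamma> j + \<delta> j, \<gamma>)" and j = "\<lambda>(\<beta>, \<gamma>). (\<gamma>, \<lambda>j. \<beta> j - \<gamma> j)"])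
    apply (auto simp: le_fun_def fun_eq_iff)
    subgoal by (meson order_trans)
    subgoal by (simp add: diff_le_mono)
    subgoal by (metis add.commute le_diff_conv2)
    done
qed

lemma ser_mul_infinite: "infinite {\<beta>. \<beta> \<le> \<alpha>} \<Longrightarrow> ser_mul f g \<alpha> = 0"
  by (simp add: ser_mul_def)

text \<open>This holds for arbitrary coefficient functions: where \<alpha> has infinitely many
  predecessors, the convention for infinite sums makes every product have coefficient 0 there, so
  the two sides still agree.\<close>

lemma ser_mul_assoc: "ser_mul (ser_mul f g) h = ser_mul f (ser_mul g h)"
proof
  fix \<alpha>
  show "ser_mul (ser_mul f g) h \<alpha> = ser_mul f (ser_mul g h) \<alpha>"
  proof (cases "finite {\<beta>. \<beta> \<le> \<alpha>}")
    case True
    show ?thesis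
      using conv_assoc[OF True, of "\<lambda>\<beta> \<gamma> \<delta>. f \<beta> * g \<gamma> * h \<delta>"]
      by (simp add: ser_mul_def sum_distrib_left sum_distrib_right mult.assoc)
  qed (simp add: ser_mul_infinite)
qed

lemma ser_mul_commute: "ser_mul f g = ser_mul g f"
proof
  show "ser_mul f g \<alpha> = ser_mul g f \<alpha>" for \<alpha>
    unfolding ser_mul_def
    by (rule sum.reindex_bij_witness[where i = "\<lambda>\<beta> j. \<alpha> j - \<beta> j" and j = "\<lambda>\<beta> j. \<alpha> j - \<beta> j"])
       (auto simp: le_fun_def fun_eq_iff mult.commute)
qed

lemma ser_mul_left_commute: "ser_mul f (ser_mul g h) = ser_mul g (ser_mul f h)"
  by (metis ser_mul_assoc ser_mul_commute)

lemma ser_mul_add_left: "ser_mul (f + g) h = ser_mul f h + ser_mul g h"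
  by (simp add: ser_mul_def fun_eq_iff algebra_simps sum.distrib)

lemma ser_mul_add_right: "ser_mul f (g + h) = ser_mul f g + ser_mul f h"
  by (simp add: ser_mul_def fun_eq_iff algebra_simps sum.distrib)

lemma ser_mul_smul_left: "ser_mul (ser_smul c f) g = ser_smul c (ser_mul f g)"
  by (simp add: ser_mul_def fun_eq_iff sum_distrib_left mult.assoc)

lemma ser_mul_smul_right: "ser_mul f (ser_smul c g) = ser_smul c (ser_mul f g)"
  by (simp add: ser_mul_def fun_eq_iff sum_distrib_left mult_ac)

lemma ser_mul_zero [simp]: "ser_mul 0 f = 0" "ser_mul f 0 = 0"
  by (simp_all add: ser_mul_def fun_eq_iff)

lemma ser_mul_neg_right: "ser_mul f (- g) = - ser_mul f g"
  by (simp add: ser_mul_def fun_eq_iff sum_negf)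

lemma ser_mul_sum_left: "ser_mul (sum f A) g = (\<Sum>a\<in>A. ser_mul (f a) g)"
  using sum_comp_morphism[of "\<lambda>f. ser_mul f g" f A] by (simp add: ser_mul_add_left o_def)

lemma ser_mul_sum_right: "ser_mul g (sum f A) = (\<Sum>a\<in>A. ser_mul g (f a))"
  using sum_comp_morphism[of "ser_mul g" f A] by (simp add: ser_mul_add_right o_def)

lemma ser_smul_simps [simp]: "ser_smul 0 f = 0" "ser_smul c 0 = 0" "ser_smul 1 f = f"
  "ser_smul c (ser_smul d f) = ser_smul (c * d) f"
  by (simp_all add: fun_eq_iff)

lemma ser_smul_add: "ser_smul c (f + g) = ser_smul c f + ser_smul c g"
  by (simp add: fun_eq_iff algebra_simps)

lemma ser_smul_sum: "ser_smul c (sum f A) = (\<Sum>a\<in>A. ser_smul c (f a))"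
  by (simp add: fun_eq_iff sum_fun_apply sum_distrib_left)

section \<open>Multi-indices and power series in n variables\<close>

lemma mi_zero [simp]: "mi n (\<lambda>_. 0)"
  by (simp add: mi_def)

lemma mi_le: "mi n \<alpha> \<Longrightarrow> \<beta> \<le> \<alpha> \<Longrightarrow> mi n \<beta>"
  by (auto simp: mi_def le_fun_def) (metis bot_nat_0.extremum_unique)

lemma mi_upd: "mi n \<alpha> \<Longrightarrow> r < n \<Longrightarrow> mi n (\<alpha>(r := x))"
  by (auto simp: mi_def)

lemma finite_mi_le:
  assumes "mi n \<alpha>"
  shows "finite {\<beta>. \<beta> \<le> \<alpha>}"
proof (rule finite_subset)
  let ?B = "{..\<Sum>j<n. \<alpha> j}"
  show "finite {\<beta>. \<forall>j. (j \<in> {..<n} \<longrightarrow> \<beta> j \<in> ?B) \<and> (j \<notin> {..<n} \<longrightarrow> \<beta> j = 0)}"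
    by (rule finite_set_of_finite_funs) auto
  show "{\<beta>. \<beta> \<le> \<alpha>} \<subseteq> {\<beta>. \<forall>j. (j \<in> {..<n} \<longrightarrow> \<beta> j \<in> ?B) \<and> (j \<notin> {..<n} \<longrightarrow> \<beta> j = 0)}"
  proof (intro subsetI CollectI allI conjI impI)
    fix \<beta> j assume "\<beta> \<in> {\<beta>. \<beta> \<le> \<alpha>}" "j \<in> {..<n}"
    then have "\<beta> j \<le> \<alpha> j" by (simp add: le_fun_def)
    also have "\<dots> \<le> (\<Sum>j<n. \<alpha> j)" using \<open>j \<in> {..<n}\<close> by (intro member_le_sum) auto
    finally show "\<beta> j \<in> ?B" by simp
  next
    fix \<beta> j assume "\<beta> \<in> {\<beta>. \<beta> \<le> \<alpha>}" "j \<notin> {..<n}"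
    then show "\<beta> j = 0" using mi_le[OF assms] by (simp add: mi_def)
  qed
qed

lemma ser_carrierD: "f \<in> ser_carrier n \<Longrightarrow> \<not> mi n \<alpha> \<Longrightarrow> f \<alpha> = 0"
  by (simp add: ser_carrier_def)

lemma ser_carrier_eqI:
  "f \<in> ser_carrier n \<Longrightarrow> g \<in> ser_carrier n \<Longrightarrow> (\<And>\<alpha>. mi n \<alpha> \<Longrightarrow> f \<alpha> = g \<alpha>) \<Longrightarrow> f = g"
  by (metis ext ser_carrierD)

lemma ser_carrier_mul [simp]:
  assumes "f \<in> ser_carrier n" "g \<in> ser_carrier n"
  shows "ser_mul f g \<in> ser_carrier n"
proof -
  have "f \<beta> * g (\<lambda>j. \<alpha> j - \<beta> j) = 0" if "\<not> mi n \<alpha>" "\<beta> \<le> \<alpha>" for \<alpha> \<beta>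
  proof (cases "mi n \<beta>")
    case True
    then have "\<not> mi n (\<lambda>j. \<alpha> j - \<beta> j)"
      using that by (auto simp: mi_def)
    then show ?thesis by (simp add: ser_carrierD[OF assms(2)])
  qed (simp add: ser_carrierD[OF assms(1)])
  then show ?thesis
    by (auto simp: ser_carrier_def ser_mul_def intro!: sum.neutral)
qed

lemma ser_carrier_closed [simp]:
  "0 \<in> ser_carrier n"
  "f \<in> ser_carrier n \<Longrightarrow> g \<in> ser_carrier n \<Longrightarrow> f + g \<in> ser_carrier n"
  "f \<in> ser_carrier n \<Longrightarrow> g \<in> ser_carrier n \<Longrightarrow> f - g \<in> ser_carrier n"
  "f \<in> ser_carrier n \<Longrightarrow> - f \<in> ser_carrier n"
  "f \<in> ser_carrier n \<Longrightarrow> ser_smul c f \<in> ser_carrier n"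
  "ser_one \<in> ser_carrier n"
  by (auto simp: ser_carrier_def ser_one_def)

lemma ser_carrier_sum: "(\<And>a. a \<in> A \<Longrightarrow> f a \<in> ser_carrier n) \<Longrightarrow> sum f A \<in> ser_carrier n"
  by (induction A rule: infinite_finite_induct) auto

lemma ser_carrier_var [simp]: "r < n \<Longrightarrow> ser_var r \<in> ser_carrier n"
  by (auto simp: ser_carrier_def ser_var_def mi_def)

lemma ser_carrier_pd [simp]: "f \<in> ser_carrier n \<Longrightarrow> ser_pd r f \<in> ser_carrier n"
  by (auto simp: ser_carrier_def ser_pd_def mi_def) (metis fun_upd_apply zero_less_Suc)

lemma ser_one_mul_finite:
  assumes "finite {\<beta>. \<beta> \<le> \<alpha>}"
  shows "ser_mul ser_one f \<alpha> = f \<alpha>"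
proof -
  have "ser_mul ser_one f \<alpha> = (\<Sum>\<beta>\<in>{\<beta>. \<beta> \<le> \<alpha>}. if \<beta> = (\<lambda>_. 0) then f \<alpha> else 0)"
    unfolding ser_mul_def ser_one_def by (rule sum.cong) auto
  also have "\<dots> = f \<alpha>"
    using assms by (simp add: le_fun_def)
  finally show ?thesis .
qed

lemma ser_mul_one [simp]:
  assumes "f \<in> ser_carrier n"
  shows "ser_mul ser_one f = f" "ser_mul f ser_one = f"
proof -
  show "ser_mul ser_one f = f"
    by (rule ser_carrier_eqI) (use assms in \<open>auto simp: ser_one_mul_finite finite_mi_le\<close>)
  then show "ser_mul f ser_one = f"
    by (simp add: ser_mul_commute)
qed

lemma ser_var_mul:
  assumes "mi n \<alpha>"
  shows "ser_mul (ser_var r) f \<alpha> = (if 0 < \<alpha> r then f (\<alpha>(r := \<alpha> r - 1)) else 0)"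
proof -
  let ?e = "\<lambda>m. if m = r then 1 else (0::nat)"
  have "ser_mul (ser_var r) f \<alpha> = (\<Sum>\<beta>\<in>{\<beta>. \<beta> \<le> \<alpha>}. if \<beta> = ?e then f (\<lambda>j. \<alpha> j - ?e j) else 0)"
    unfolding ser_mul_def ser_var_def by (rule sum.cong) auto
  also have "\<dots> = (if ?e \<le> \<alpha> then f (\<lambda>j. \<alpha> j - ?e j) else 0)"
    using finite_mi_le[OF assms] by simp
  also have "(\<lambda>j. \<alpha> j - ?e j) = \<alpha>(r := \<alpha> r - 1)"
    by auto
  also have "?e \<le> \<alpha> \<longleftrightarrow> 0 < \<alpha> r"
    by (auto simp: le_fun_def Suc_le_eq dest: spec[of _ r])
  finally show ?thesis .
qed

text \<open>The one instance of the Leibniz rule for partial derivatives that is called for, because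
  series are taken apart by splitting off a single variable.\<close>

lemma ser_pd_var_mul:
  assumes "f \<in> ser_carrier n" "r < n" "s < n"
  shows "ser_pd s (ser_mul (ser_var r) f) = (if r = s then f else 0) + ser_mul (ser_var r) (ser_pd s f)"
proof (rule ser_carrier_eqI)
  fix \<alpha> assume mi: "mi n \<alpha>"
  have mi': "mi n (\<alpha>(s := Suc (\<alpha> s)))"
    using mi assms by (simp add: mi_upd)
  show "ser_pd s (ser_mul (ser_var r) f) \<alpha> =
    ((if r = s then f else 0) + ser_mul (ser_var r) (ser_pd s f)) \<alpha>"
    unfolding plus_fun_apply ser_pd_def ser_var_mul[OF mi] ser_var_mul[OF mi']
    by (auto simp: algebra_simps fun_upd_twist fun_upd_idem)
qed (use assms in auto)

text \<open>A finite decomposition of a series into a constant and multiples of the variables. A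
  derivation is additive over finitely many terms only, so this is what lets it be computed without
  assuming continuity.\<close>

lemma ser_expand:
  assumes f: "f \<in> ser_carrier n"
  obtains g where "\<And>r. r < n \<Longrightarrow> g r \<in> ser_carrier n"
    "f = ser_smul (f (\<lambda>_. 0)) ser_one + (\<Sum>r<n. ser_mul (ser_var r) (g r))"
proof
  \<comment> \<open>Each nonconstant monomial is charged to the first variable occurring in it:
    \<open>g r\<close> collects those charged to r, with one factor of that variable
    removed.\<close>
  define g where "g r = (\<lambda>\<alpha>. if \<forall>j<r. \<alpha> j = 0 then f (\<alpha>(r := Suc (\<alpha> r))) else 0)" for r
  show g: "g r \<in> ser_carrier n" if "r < n" for r
  proof -
    have "\<not> mi n (\<alpha>(r := Suc (\<alpha> r)))" if "\<not> mi n \<alpha>" for \<alpha>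
      using that \<open>r < n\<close> by (auto simp: mi_def)
    then show ?thesis using f by (simp add: g_def ser_carrier_def)
  qed
  show "f = ser_smul (f (\<lambda>_. 0)) ser_one + (\<Sum>r<n. ser_mul (ser_var r) (g r))"
  proof (rule ser_carrier_eqI[OF f])
    show "ser_smul (f (\<lambda>_. 0)) ser_one + (\<Sum>r<n. ser_mul (ser_var r) (g r)) \<in> ser_carrier n"
      using g by (intro ser_carrier_closed ser_carrier_sum ser_carrier_mul) auto
  next
    fix \<alpha> assume mi: "mi n \<alpha>"
    have *: "(\<Sum>r<n. ser_mul (ser_var r) (g r) \<alpha>) =
        (\<Sum>r<n. if 0 < \<alpha> r \<and> (\<forall>j<r. \<alpha> j = 0) then f \<alpha> else 0)"
      by (intro sum.cong) (auto simp: ser_var_mul[OF mi] g_def)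
    show "f \<alpha> = (ser_smul (f (\<lambda>_. 0)) ser_one + (\<Sum>r<n. ser_mul (ser_var r) (g r))) \<alpha>"
    proof (cases "\<alpha> = (\<lambda>_. 0)")
      case True
      then show ?thesis using * by (simp add: sum_fun_apply ser_one_def)
    next
      case False
      define m where "m = (LEAST j. 0 < \<alpha> j)"
      obtain j where "0 < \<alpha> j" using False by auto
      then have m: "0 < \<alpha> m" "\<And>j. j < m \<Longrightarrow> \<alpha> j = 0"
        unfolding m_def by (auto intro: LeastI dest: not_less_Least)
      then have "m < n" using mi by (auto simp: mi_def not_less[symmetric])
      have "0 < \<alpha> r \<and> (\<forall>j<r. \<alpha> j = 0) \<longleftrightarrow> r = m" for r
        using m by (metis linorder_neqE_nat less_irrefl)
      then show ?thesis
        using False \<open>m < n\<close> by (simp add: * sum_fun_apply ser_one_def)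
    qed
  qed
qed

section \<open>Derivations of the power series ring\<close>

lemma ser_derD:
  assumes "ser_der n D"
  shows "f \<in> ser_carrier n \<Longrightarrow> D f \<in> ser_carrier n"
    and "f \<in> ser_carrier n \<Longrightarrow> g \<in> ser_carrier n \<Longrightarrow> D (f + g) = D f + D g"
    and "f \<in> ser_carrier n \<Longrightarrow> D (ser_smul c f) = ser_smul c (D f)"
    and "f \<in> ser_carrier n \<Longrightarrow> g \<in> ser_carrier n \<Longrightarrow>
      D (ser_mul f g) = ser_mul (D f) g + ser_mul f (D g)"
  using assms by (auto simp: ser_der_def)

lemma ser_der_zero: "ser_der n D \<Longrightarrow> D 0 = 0"
  using ser_derD(3)[of n D 0 0] by simp

lemma ser_der_sum:
  assumes "ser_der n D" "\<And>a. a \<in> A \<Longrightarrow> f a \<in> ser_carrier n"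
  shows "D (sum f A) = (\<Sum>a\<in>A. D (f a))"
  using assms(2)
  by (induction A rule: infinite_finite_induct)
     (auto simp: ser_der_zero[OF assms(1)] ser_derD(2)[OF assms(1)] ser_carrier_sum)

lemma ser_der_one: "ser_der n D \<Longrightarrow> D ser_one = 0"
  using ser_derD(4)[of n D ser_one ser_one] ser_derD(1)[of n D ser_one] by simp

text \<open>Derivations of the power series ring are automatically continuous, hence determined by
  their values on the variables; the induction is on the total degree of the coefficient.\<close>

lemma ser_der_chain_rule:
  assumes D: "ser_der n D" and f: "f \<in> ser_carrier n"
  shows "D f = (\<Sum>r<n. ser_mul (D (ser_var r)) (ser_pd r f))"
proof -
  define E where "E f = (\<Sum>r<n. ser_mul (D (ser_var r)) (ser_pd r f))" for f
  have E_carrier: "E f \<in> ser_carrier n" if "f \<in> ser_carrier n" for f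
    unfolding E_def using that ser_derD(1)[OF D] by (intro ser_carrier_sum) auto
  \<comment> \<open>The series varies in the induction, since the hypothesis is applied to the
    cofactors \<open>g r\<close> and not to \<open>f\<close>.\<close>
  have "D f \<alpha> = E f \<alpha>" if "mi n \<alpha>" "(\<Sum>j<n. \<alpha> j) < k" "f \<in> ser_carrier n" for k f \<alpha>
    using that
  proof (induction k arbitrary: f \<alpha>)
    case (Suc k)
    obtain g where g: "\<And>r. r < n \<Longrightarrow> g r \<in> ser_carrier n"
      and f_eq: "f = ser_smul (f (\<lambda>_. 0)) ser_one + (\<Sum>r<n. ser_mul (ser_var r) (g r))" (is "_ = ?c + _")
      using ser_expand[OF Suc.prems(3)] by blast
    have c: "?c \<in> ser_carrier n" by simp
    have "D f = D ?c + D (\<Sum>r<n. ser_mul (ser_var r) (g r))"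
      by (subst f_eq, subst ser_derD(2)[OF D]) (use g in \<open>auto intro!: ser_carrier_sum\<close>)
    also have "D ?c = 0"
      by (simp add: ser_derD(3)[OF D] ser_der_one[OF D])
    also have "D (\<Sum>r<n. ser_mul (ser_var r) (g r)) =
        (\<Sum>r<n. ser_mul (D (ser_var r)) (g r) + ser_mul (ser_var r) (D (g r)))"
      using g by (subst ser_der_sum[OF D]) (auto simp: ser_derD(4)[OF D])
    finally have Df: "D f = (\<Sum>r<n. ser_mul (D (ser_var r)) (g r)) + (\<Sum>r<n. ser_mul (ser_var r) (D (g r)))"
      by (simp only: sum.distrib add_0)
    have pd: "ser_pd s f = g s + (\<Sum>r<n. ser_mul (ser_var r) (ser_pd s (g r)))" if "s < n" for s
    proof -
      have "ser_pd s f = ser_pd s ?c + (\<Sum>r<n. ser_pd s (ser_mul (ser_var r) (g r)))"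
        by (subst f_eq) (simp add: ser_pd_def fun_eq_iff sum_fun_apply algebra_simps sum_distrib_left)
      also have "ser_pd s ?c = 0"
        by (auto simp: ser_pd_def ser_one_def fun_eq_iff)
      also have "(\<Sum>r<n. ser_pd s (ser_mul (ser_var r) (g r))) =
          (\<Sum>r<n. (if r = s then g r else 0) + ser_mul (ser_var r) (ser_pd s (g r)))"
        using g that by (intro sum.cong) (auto simp: ser_pd_var_mul[of _ n])
      also have "\<dots> = (\<Sum>r<n. if r = s then g r else 0) + (\<Sum>r<n. ser_mul (ser_var r) (ser_pd s (g r)))"
        by (rule sum.distrib)
      also have "(\<Sum>r<n. if r = s then g r else 0) = g s"
        using that by (subst sum.delta) auto
      finally show ?thesis by (simp only: add_0)
    qed
    \<comment> \<open>\<open>E\<close> obeys the same recursion as \<open>D\<close> in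
      \<open>Df\<close>: the variables contribute equal terms, and the remaining terms carry a
      factor \<open>ser_var r\<close>.\<close>
    have "E f = (\<Sum>s<n. ser_mul (D (ser_var s)) (g s)) +
        (\<Sum>s<n. \<Sum>r<n. ser_mul (D (ser_var s)) (ser_mul (ser_var r) (ser_pd s (g r))))"
      by (simp add: E_def pd ser_mul_add_right ser_mul_sum_right sum.distrib)
    also have "(\<Sum>s<n. \<Sum>r<n. ser_mul (D (ser_var s)) (ser_mul (ser_var r) (ser_pd s (g r)))) =
        (\<Sum>r<n. ser_mul (ser_var r) (E (g r)))"
      by (subst sum.swap) (simp add: E_def ser_mul_sum_right ser_mul_left_commute)
    finally have Ef: "E f = (\<Sum>r<n. ser_mul (D (ser_var r)) (g r)) + (\<Sum>r<n. ser_mul (ser_var r) (E (g r)))" .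
    \<comment> \<open>Multiplication by a variable shifts degrees, so the coefficient at \<alpha>
      involves \<open>D (g r)\<close> only in total degree one lower.\<close>
    have "ser_mul (ser_var r) (D (g r)) \<alpha> = ser_mul (ser_var r) (E (g r)) \<alpha>" if "r < n" for r
    proof (cases "0 < \<alpha> r")
      case True
      have "(\<Sum>j<n. (\<alpha>(r := \<alpha> r - 1)) j) < (\<Sum>j<n. \<alpha> j)"
        using that True by (intro sum_strict_mono2[OF _ _ , THEN less_le_trans] sum_strict_mono_ex1) auto
      then have "(\<Sum>j<n. (\<alpha>(r := \<alpha> r - 1)) j) < k" using Suc.prems(2) by linarith
      then have "D (g r) (\<alpha>(r := \<alpha> r - 1)) = E (g r) (\<alpha>(r := \<alpha> r - 1))"
        by (rule Suc.IH[OF mi_upd[OF Suc.prems(1) that] _ g[OF that]])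
      then show ?thesis
        using True by (simp add: ser_var_mul[OF Suc.prems(1)])
    qed (simp add: ser_var_mul[OF Suc.prems(1)])
    then show ?case by (simp add: Df Ef sum_fun_apply)
  qed simp
  then have "D f = E f"
    using ser_derD(1)[OF D f] E_carrier[OF f] f by (intro ser_carrier_eqI) auto
  then show ?thesis by (simp add: E_def)
qed

section \<open>The exterior algebra with power series coefficients\<close>

lemmas pointwise = plus_fun_apply zero_fun_apply minus_apply uminus_apply sum_fun_apply
  ser_smul_apply ext_smul_apply

text \<open>Rule composition can leave eta-expanded terms of function type, which these rules would then
  unfold into lambda abstractions instead of leaving the ring operations intact.\<close>

declare pointwise [simp del]

text \<open>An element is viewed as a family of power series indexed by wedge monomials. The product
  becomes a signed convolution over subsets, to which the algebra of \<open>ser_mul\<close> applies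
  without touching multi-indices.\<close>

lemma ext_mul_component:
  "ext_mul a b S = (\<Sum>T\<in>Pow S. ser_smul (ext_sign T (S - T)) (ser_mul (a T) (b (S - T))))"
  by (simp add: ext_mul_def ser_mul_def fun_eq_iff pointwise sum_distrib_left mult.assoc)

lemma ext_mul_infinite: "infinite S \<Longrightarrow> ext_mul a b S = 0"
  by (simp add: ext_mul_component finite_Pow_iff)

lemma ext_mul_add_left: "ext_mul (a + b) c = ext_mul a c + ext_mul b c"
  by (rule ext)
     (simp add: pointwise(1) ext_mul_component ser_mul_add_left ser_smul_add sum.distrib)

lemma ext_mul_add_right: "ext_mul a (b + c) = ext_mul a b + ext_mul a c"
  by (rule ext)
     (simp add: pointwise(1) ext_mul_component ser_mul_add_right ser_smul_add sum.distrib)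

lemma ext_mul_smul_left: "ext_mul (ext_smul x a) b = ext_smul x (ext_mul a b)"
  by (rule ext)
     (simp add: ext_mul_component ext_smul_component ser_mul_smul_left ser_smul_sum mult.commute)

lemma ext_mul_smul_right: "ext_mul a (ext_smul x b) = ext_smul x (ext_mul a b)"
  by (rule ext)
     (simp add: ext_mul_component ext_smul_component ser_mul_smul_right ser_smul_sum mult.commute)

lemma ext_smul_simps [simp]: "ext_smul 0 a = 0" "ext_smul x 0 = 0" "ext_smul 1 a = a"
  "ext_smul x (ext_smul y a) = ext_smul (x * y) a"
  by (simp_all add: fun_eq_iff pointwise)

lemma ext_smul_minus_one: "ext_smul (- 1) a = - a"
  by (simp add: fun_eq_iff pointwise)

lemma ext_smul_add: "ext_smul x (a + b) = ext_smul x a + ext_smul x b"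
  by (simp add: fun_eq_iff pointwise algebra_simps)

lemma ext_smul_add_scalar: "ext_smul (x + y) a = ext_smul x a + ext_smul y a"
  by (simp add: fun_eq_iff pointwise algebra_simps)

lemma ext_smul_sum: "ext_smul x (sum f A) = (\<Sum>a\<in>A. ext_smul x (f a))"
  by (simp add: fun_eq_iff pointwise sum_distrib_left)

lemma ext_mul_zero [simp]: "ext_mul 0 a = 0" "ext_mul a 0 = 0"
  by (rule ext, simp add: ext_mul_component pointwise(2))+

lemma ext_mul_neg_left: "ext_mul (- a) b = - ext_mul a b"
  by (metis ext_mul_smul_left ext_smul_minus_one)

lemma ext_mul_neg_right: "ext_mul a (- b) = - ext_mul a b"
  by (metis ext_mul_smul_right ext_smul_minus_one)

lemma ext_mul_diff_left: "ext_mul (a - b) c = ext_mul a c - ext_mul b c"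
  by (metis ext_mul_add_left ext_mul_neg_left add_uminus_conv_diff)

lemma ext_mul_diff_right: "ext_mul a (b - c) = ext_mul a b - ext_mul a c"
  by (metis ext_mul_add_right ext_mul_neg_right add_uminus_conv_diff)

lemma ext_mul_sum_left: "ext_mul (sum f A) b = (\<Sum>a\<in>A. ext_mul (f a) b)"
  using sum_comp_morphism[of "\<lambda>f. ext_mul f b" f A] by (simp add: ext_mul_add_left o_def)

lemma ext_mul_sum_right: "ext_mul b (sum f A) = (\<Sum>a\<in>A. ext_mul b (f a))"
  using sum_comp_morphism[of "ext_mul b" f A] by (simp add: ext_mul_add_right o_def)

text \<open>The exponent counts inversions, and inversions are additive over disjoint unions in
  either argument; the sign is thus multiplicative in each slot.\<close>

lemma ext_sign_union_left:
  assumes "finite T" "finite U" "finite V" "T \<inter> U = {}"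
  shows "ext_sign (T \<union> U) V = ext_sign T V * (ext_sign U V :: 'k::field)"
proof -
  let ?X = "\<lambda>T. {(t, u). t \<in> T \<and> u \<in> V \<and> u < t}"
  have fin: "finite (?X W)" if "finite W" for W :: "nat set"
    by (rule finite_subset[of _ "W \<times> V"]) (use that assms in auto)
  have "?X (T \<union> U) = ?X T \<union> ?X U" by auto
  moreover have "?X T \<inter> ?X U = {}" using assms by auto
  ultimately have "card (?X (T \<union> U)) = card (?X T) + card (?X U)"
    using assms fin by (simp add: card_Un_disjoint)
  then show ?thesis by (simp add: ext_sign_def power_add)
qed

lemma ext_sign_union_right:
  assumes "finite T" "finite U" "finite V" "U \<inter> V = {}"
  shows "ext_sign T (U \<union> V) = ext_sign T U * (ext_sign T V :: 'k::field)"
proof -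
  let ?X = "\<lambda>V. {(t, u). t \<in> T \<and> u \<in> V \<and> u < t}"
  have fin: "finite (?X W)" if "finite W" for W :: "nat set"
    by (rule finite_subset[of _ "T \<times> W"]) (use that assms in auto)
  have "?X (U \<union> V) = ?X U \<union> ?X V" by auto
  moreover have "?X U \<inter> ?X V = {}" using assms by auto
  ultimately have "card (?X (U \<union> V)) = card (?X U) + card (?X V)"
    using assms fin by (simp add: card_Un_disjoint)
  then show ?thesis by (simp add: ext_sign_def power_add)
qed

lemma ext_sign_square: "ext_sign T U * ext_sign T U = (1 :: 'k::field)"
  by (simp add: ext_sign_def power_add[symmetric])

lemma ext_sign_empty [simp]: "ext_sign {} U = 1" "ext_sign T {} = 1"
  by (simp_all add: ext_sign_def)

lemma ext_sign_pair: "ext_sign {k} {m} = (if m < k then - 1 else (1 :: 'k::field))"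
proof -
  have "{(t, u). t \<in> {k} \<and> u \<in> {m} \<and> u < t} = (if m < k then {(k, m)} else {})" by auto
  then show ?thesis by (simp add: ext_sign_def)
qed

lemma ext_sign_min: "(\<And>u. u \<in> U \<Longrightarrow> m < u) \<Longrightarrow> ext_sign {m} U = 1"
proof -
  assume "\<And>u. u \<in> U \<Longrightarrow> m < u"
  then have "{(t, u). t \<in> {m} \<and> u \<in> U \<and> u < t} = {}" by fastforce
  then show ?thesis by (simp only: ext_sign_def) simp
qed

lemma ext_sign_insert:
  "finite U \<Longrightarrow> m \<notin> U \<Longrightarrow> ext_sign {k} (insert m U) = ext_sign {k} {m} * ext_sign {k} U"
  using ext_sign_union_right[of "{k}" "{m}" U] by simp

text \<open>The inversions against U agree on both sides, so only the relative order of k and m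
  matters, and exactly one of the two orders is an inversion. This is where anticommutativity of the
  generators originates.\<close>

lemma ext_sign_insert_swap:
  assumes "finite U" "k \<notin> U" "m \<notin> U" "k \<noteq> m"
  shows "ext_sign {k} (insert m U) * ext_sign {m} U = - (ext_sign {m} (insert k U) * ext_sign {k} U)"
  unfolding ext_sign_insert[OF assms(1,2)] ext_sign_insert[OF assms(1,3)]
  using assms(4) by (simp add: ext_sign_pair)

text \<open>Both sides enumerate the ordered partitions of S into three blocks; it is the analogue
  of \<open>conv_assoc\<close> for wedge monomials.\<close>

lemma subset_conv_assoc:
  fixes F :: "nat set \<Rightarrow> nat set \<Rightarrow> nat set \<Rightarrow> 'a::comm_monoid_add"
  assumes "finite S"
  shows "(\<Sum>T\<in>Pow S. \<Sum>U\<in>Pow T. F U (T - U) (S - T)) = (\<Sum>U\<in>Pow S. \<Sum>V\<in>Pow (S - U). F U V (S - U - V))"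
proof -
  have "finite T" if "T \<in> Pow S" for T
    using that assms finite_subset by auto
  then have "\<And>T. T \<in> Pow S \<Longrightarrow> finite (Pow T)" "\<And>U. finite (Pow (S - U))"
    using assms by auto
  then have "(\<Sum>T\<in>Pow S. \<Sum>U\<in>Pow T. F U (T - U) (S - T)) =
      (\<Sum>(T, U)\<in>Sigma (Pow S) Pow. F U (T - U) (S - T))"
    "(\<Sum>U\<in>Pow S. \<Sum>V\<in>Pow (S - U). F U V (S - U - V)) =
      (\<Sum>(U, V)\<in>Sigma (Pow S) (\<lambda>U. Pow (S - U)). F U V (S - U - V))"
    using assms by (auto intro!: sum.Sigma)
  moreover have "(\<Sum>(T, U)\<in>Sigma (Pow S) Pow. F U (T - U) (S - T)) =
      (\<Sum>(U, V)\<in>Sigma (Pow S) (\<lambda>U. Pow (S - U)). F U V (S - U - V))"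
    by (rule sum.reindex_bij_witness[where
        i = "\<lambda>(U, V). (U \<union> V, U)" and j = "\<lambda>(T, U). (U, T - U)"])
       (auto simp: Diff_eq Int_absorb1 inf_assoc intro!: arg_cong2[where f = "F b" for b])
  ultimately show ?thesis by simp
qed

lemma ext_mul_assoc: "ext_mul (ext_mul a b) c = ext_mul a (ext_mul b c)"
proof
  fix S
  show "ext_mul (ext_mul a b) c S = ext_mul a (ext_mul b c) S"
  proof (cases "finite S")
    case True
    define F where "F U V W = ser_smul (ext_sign (U \<union> V) W * ext_sign U V)
      (ser_mul (a U) (ser_mul (b V) (c W)))" for U V W
    have "ext_mul (ext_mul a b) c S = (\<Sum>T\<in>Pow S. \<Sum>U\<in>Pow T. F U (T - U) (S - T))"
      unfolding ext_mul_component
      by (auto simp: ser_mul_sum_left ser_smul_sum F_def ser_mul_smul_left ser_mul_assoc Un_absorb1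
          intro!: sum.cong)
    also have "\<dots> = (\<Sum>U\<in>Pow S. \<Sum>V\<in>Pow (S - U). F U V (S - U - V))"
      by (rule subset_conv_assoc[OF True])
    also have "\<dots> = ext_mul a (ext_mul b c) S"
    proof -
      \<comment> \<open>The cocycle identity for the sign: both sides are the product of the three
        signs belonging to the pairs among U, V and the rest of S.\<close>
      have sign: "ext_sign (U \<union> V) (S - U - V) * ext_sign U V =
          ext_sign U (S - U) * (ext_sign V (S - U - V) :: 'a)" if "U \<subseteq> S" "V \<subseteq> S - U" for U V
      proof -
        have fin: "finite U" "finite V" "finite (S - U - V)"
          using that True finite_subset by blast+
        have "S - U = V \<union> (S - U - V)" using that by auto
        then have "ext_sign U (S - U) = ext_sign U V * (ext_sign U (S - U - V) :: 'a)"
          using ext_sign_union_right[OF fin] by auto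
        moreover have "ext_sign (U \<union> V) (S - U - V) =
            ext_sign U (S - U - V) * (ext_sign V (S - U - V) :: 'a)"
          by (rule ext_sign_union_left) (use fin that in auto)
        ultimately show ?thesis by simp
      qed
      show ?thesis
        unfolding ext_mul_component
        by (auto simp: ser_mul_sum_right ser_smul_sum F_def ser_mul_smul_right sign
            intro!: sum.cong)
    qed
    finally show ?thesis .
  qed (simp add: ext_mul_infinite)
qed

lemma ext_carrier_iff:
  "a \<in> ext_carrier n \<longleftrightarrow> (\<forall>S. a S \<in> ser_carrier n) \<and> (\<forall>S. \<not> S \<subseteq> {..<n} \<longrightarrow> a S = 0)"
  unfolding ext_carrier_def ser_carrier_def mem_Collect_eq fun_eq_iff pointwise(2) by blast

lemma ext_carrier_component: "a \<in> ext_carrier n \<Longrightarrow> a S \<in> ser_carrier n"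
  by (simp add: ext_carrier_iff)

lemma ext_carrier_vanish: "a \<in> ext_carrier n \<Longrightarrow> \<not> S \<subseteq> {..<n} \<Longrightarrow> a S = 0"
  by (simp add: ext_carrier_iff)

lemma ext_carrier_vanish_infinite: "a \<in> ext_carrier n \<Longrightarrow> infinite S \<Longrightarrow> a S = 0"
  by (metis ext_carrier_vanish finite_lessThan finite_subset)

lemma ext_carrier_closed [simp]:
  "0 \<in> ext_carrier n"
  "a \<in> ext_carrier n \<Longrightarrow> b \<in> ext_carrier n \<Longrightarrow> a + b \<in> ext_carrier n"
  "a \<in> ext_carrier n \<Longrightarrow> b \<in> ext_carrier n \<Longrightarrow> a - b \<in> ext_carrier n"
  "a \<in> ext_carrier n \<Longrightarrow> - a \<in> ext_carrier n"
  "a \<in> ext_carrier n \<Longrightarrow> ext_smul c a \<in> ext_carrier n"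
  by (auto simp: ext_carrier_def pointwise)

lemma ext_carrier_sum: "(\<And>i. i \<in> A \<Longrightarrow> f i \<in> ext_carrier n) \<Longrightarrow> sum f A \<in> ext_carrier n"
  by (induction A rule: infinite_finite_induct) auto

lemma ext_carrier_mul [simp]:
  assumes "a \<in> ext_carrier n" "b \<in> ext_carrier n"
  shows "ext_mul a b \<in> ext_carrier n"
  unfolding ext_carrier_iff
proof (intro conjI allI impI)
  show "ext_mul a b S \<in> ser_carrier n" for S
    unfolding ext_mul_component by (intro ser_carrier_sum) (simp add: ext_carrier_component[OF assms(1)] ext_carrier_component[OF assms(2)])
  fix S assume "\<not> S \<subseteq> {..<n}"
  then have "\<not> T \<subseteq> {..<n} \<or> \<not> S - T \<subseteq> {..<n}" for T by auto
  then have "ser_mul (a T) (b (S - T)) = 0" for T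
    using ext_carrier_vanish[OF assms(1)] ext_carrier_vanish[OF assms(2)] by (metis ser_mul_zero)
  then show "ext_mul a b S = 0"
    by (simp add: ext_mul_component)
qed

lemma sca_apply: "sca P S = (if S = {} then P else 0)"
  by (auto simp: sca_def fun_eq_iff pointwise)

lemma ext_carrier_sca [simp]: "f \<in> ser_carrier n \<Longrightarrow> sca f \<in> ext_carrier n"
  by (auto simp: ext_carrier_iff sca_apply)

lemma ext_carrier_one [simp]: "ext_one \<in> ext_carrier n"
  by (simp add: ext_one_def)

lemma dx_apply: "dx l S = (if S = {l} then ser_one else 0)"
  by (auto simp: dx_def ser_one_def fun_eq_iff pointwise)

lemma ext_carrier_dx [simp]: "l < n \<Longrightarrow> dx l \<in> ext_carrier n"
  by (auto simp: ext_carrier_iff dx_apply)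

lemma sca_mul_apply: "finite S \<Longrightarrow> ext_mul (sca f) a S = ser_mul f (a S)"
proof -
  assume fin: "finite S"
  have "ext_mul (sca f) a S = (\<Sum>T\<in>Pow S. if T = {} then ser_mul f (a S) else 0)"
    unfolding ext_mul_component by (rule sum.cong) (auto simp: sca_apply)
  also have "\<dots> = ser_mul f (a S)"
    using fin by (subst sum.delta) auto
  finally show ?thesis .
qed

lemma mul_sca_apply: "finite S \<Longrightarrow> ext_mul a (sca f) S = ser_mul f (a S)"
proof -
  assume fin: "finite S"
  have "ext_mul a (sca f) S = (\<Sum>T\<in>Pow S. if T = S then ser_mul f (a S) else 0)"
    unfolding ext_mul_component by (rule sum.cong) (auto simp: sca_apply ser_mul_commute)
  also have "\<dots> = ser_mul f (a S)"
    using fin by (subst sum.delta) auto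
  finally show ?thesis .
qed

lemma sca_commute: "ext_mul (sca f) a = ext_mul a (sca f)"
proof
  show "ext_mul (sca f) a S = ext_mul a (sca f) S" for S
    by (cases "finite S") (simp_all add: sca_mul_apply mul_sca_apply ext_mul_infinite)
qed

lemma sca_mul: "ext_mul (sca f) (sca g) = sca (ser_mul f g)"
proof
  show "ext_mul (sca f) (sca g) S = sca (ser_mul f g) S" for S
    by (cases "finite S") (auto simp: sca_mul_apply ext_mul_infinite sca_apply)
qed

lemma sca_simps: "sca 0 = 0" "sca (f + g) = sca f + sca g" "sca (- f) = - sca f"
  "sca (ser_smul c f) = ext_smul c (sca f)"
  by (auto simp: sca_def fun_eq_iff pointwise)

lemma sca_sum: "sca (sum f A) = (\<Sum>a\<in>A. sca (f a))"
  using sum_comp_morphism[of sca f A] by (simp add: sca_simps o_def)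

lemma ext_one_mul [simp]:
  assumes "a \<in> ext_carrier n"
  shows "ext_mul ext_one a = a" "ext_mul a ext_one = a"
proof -
  show "ext_mul ext_one a = a"
  proof
    show "ext_mul ext_one a S = a S" for S
      using ser_mul_one(1)[OF ext_carrier_component[OF assms]] ext_carrier_vanish_infinite[OF assms]
      by (cases "finite S") (auto simp: ext_one_def sca_mul_apply ext_mul_infinite)
  qed
  then show "ext_mul a ext_one = a"
    by (simp add: ext_one_def sca_commute)
qed

lemma dx_mul_apply:
  assumes "b \<in> ext_carrier n"
  shows "ext_mul (dx m) b S = (if m \<in> S then ser_smul (ext_sign {m} (S - {m})) (b (S - {m})) else 0)"
proof (cases "finite S")
  case True
  have "ext_mul (dx m) b S =
      (\<Sum>T\<in>Pow S. if T = {m} then ser_smul (ext_sign {m} (S - {m})) (b (S - {m})) else 0)"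
    unfolding ext_mul_component
    by (intro sum.cong) (auto simp: dx_apply ser_mul_one(1)[OF ext_carrier_component[OF assms]])
  also have "\<dots> = (if m \<in> S then ser_smul (ext_sign {m} (S - {m})) (b (S - {m})) else 0)"
    using True by (subst sum.delta) auto
  finally show ?thesis .
next
  case False
  then show ?thesis
    using ext_carrier_vanish_infinite[OF assms, of "S - {m}"] by (simp add: ext_mul_infinite)
qed

text \<open>The case k = m is included. Both sides are then 0, because the inner factor would have
  to use an index that the outer factor has already removed.\<close>

lemma dx_anticommute:
  assumes b: "b \<in> ext_carrier n" and "k < n" "m < n"
  shows "ext_mul (dx k) (ext_mul (dx m) b) = - ext_mul (dx m) (ext_mul (dx k) b)"
proof
  fix S
  have c: "ext_mul (dx m) b \<in> ext_carrier n" "ext_mul (dx k) b \<in> ext_carrier n"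
    using assms by auto
  have *: "S - {m} - {k} = S - {k} - {m}" by auto
  show "ext_mul (dx k) (ext_mul (dx m) b) S = (- ext_mul (dx m) (ext_mul (dx k) b)) S"
  proof (cases "finite S \<and> k \<in> S \<and> m \<in> S \<and> k \<noteq> m")
    case True
    define W where "W = S - {k} - {m}"
    have W: "S - {k} = insert m W" "S - {m} = insert k W" "insert m W - {m} = W" "insert k W - {k} = W"
      "finite W" "k \<notin> W" "m \<notin> W"
      using True by (auto simp: W_def)
    show ?thesis
      using True ext_sign_insert_swap[OF W(5-7), THEN arg_cong[where f = "\<lambda>x. ser_smul x (b W)"]]
      by (simp add: dx_mul_apply[OF c(1)] dx_mul_apply[OF c(2)] dx_mul_apply[OF b] W(1-4) fun_eq_iff pointwise)
  next
    case False
    moreover have "b (S - {k} - {m}) = 0" if "infinite S"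
      using ext_carrier_vanish_infinite[OF b] that by simp
    ultimately show ?thesis
      by (auto simp: dx_mul_apply[OF c(1)] dx_mul_apply[OF c(2)] dx_mul_apply[OF b] * pointwise(4))
  qed
qed

text \<open>Interior multiplication by the vector dual to \<open>dx l\<close>. The sign is the cost
  of moving dx_l to the front of the wedge monomial before it is cancelled.\<close>

definition contraction :: "nat \<Rightarrow> 'k::field ext \<Rightarrow> 'k ext" where
  "contraction l a = (\<lambda>S. if l \<in> S then 0 else ser_smul (ext_sign {l} S) (a (insert l S)))"

lemma contraction_carrier [simp]: "a \<in> ext_carrier n \<Longrightarrow> contraction l a \<in> ext_carrier n"
  by (auto simp: ext_carrier_iff contraction_def)

lemma contraction_add: "contraction l (a + b) = contraction l a + contraction l b"
  by (simp add: contraction_def fun_eq_iff pointwise algebra_simps)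

lemma contraction_smul: "contraction l (ext_smul c a) = ext_smul c (contraction l a)"
  by (simp add: contraction_def fun_eq_iff pointwise algebra_simps)

lemma contraction_sca: "contraction l (sca f) = 0"
  by (simp add: contraction_def fun_eq_iff pointwise sca_apply)

lemma contraction_sca_mul:
  assumes "a \<in> ext_carrier n"
  shows "contraction l (ext_mul (sca f) a) = ext_mul (sca f) (contraction l a)"
proof
  show "contraction l (ext_mul (sca f) a) S = ext_mul (sca f) (contraction l a) S" for S
    by (cases "finite S")
       (auto simp: contraction_def sca_mul_apply ser_mul_smul_right ext_mul_infinite)
qed

text \<open>The Clifford relation; it lets the Leibniz rule for \<open>dx\<^sub>k \<and> \<iota>\<^sub>l\<close> be checked against a
  single generator instead of a general product.\<close>

lemma contraction_dx_mul:
  assumes b: "b \<in> ext_carrier n" and "m < n"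
  shows "contraction l (ext_mul (dx m) b) = (if l = m then b else 0) - ext_mul (dx m) (contraction l b)"
proof
  fix S
  note c = contraction_carrier[OF b, of l]
  show "contraction l (ext_mul (dx m) b) S = ((if l = m then b else 0) - ext_mul (dx m) (contraction l b)) S"
  proof (cases "finite S")
    case False
    then show ?thesis
      using ext_carrier_vanish_infinite[OF b, of S] ext_carrier_vanish_infinite[OF b, of "insert l S - {m}"]
        ext_carrier_vanish_infinite[OF b, of "insert l (S - {m})"]
      by (simp add: contraction_def ext_mul_infinite pointwise(2,3,4))
  next
    case fin: True
    \<comment> \<open>In the first case the two terms on the right cancel because a sign squares to
      1; in the second only b is left; in the third every term vanishes. In the fourth two distinct
      generators change places, which produces the minus sign.\<close>
    consider "l = m" "l \<in> S" | "l = m" "l \<notin> S" | "l \<noteq> m" "l \<in> S \<or> m \<notin> S" | "l \<noteq> m" "l \<notin> S" "m \<in> S"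
      by blast
    then show ?thesis
    proof cases
      case 1
      then show ?thesis
        using dx_mul_apply[OF c, of m S]
        by (simp add: contraction_def insert_absorb ext_sign_square pointwise(2,3,4))
    next
      case 2
      then show ?thesis
        using dx_mul_apply[OF b, of m "insert m S"] dx_mul_apply[OF c, of m S]
        by (simp add: contraction_def ext_sign_square pointwise(2,3,4))
    next
      case 3
      then show ?thesis
        using dx_mul_apply[OF b, of m "insert l S"] dx_mul_apply[OF c, of m S]
        by (auto simp: contraction_def pointwise(2,3,4))
    next
      case 4
      define W where "W = S - {m}"
      have W: "S = insert m W" "finite W" "l \<notin> W" "m \<notin> W" "m \<noteq> l"
        using 4 fin by (auto simp: W_def)
      have eq: "insert l (insert m W) - {m} = insert l W" "insert m W - {m} = W" "insert m W - {l} = insert m W"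
        using W by auto
      have "ext_sign {l} (insert m W) * ext_sign {m} (insert l W) =
          - (ext_sign {m} W * ext_sign {l} W :: 'a)"
        unfolding ext_sign_insert[OF W(2,3)] ext_sign_insert[OF W(2,4)]
        using W(5) by (simp add: ext_sign_pair)
      then show ?thesis
        using 4 W(3-5) unfolding W(1)
        using dx_mul_apply[OF b, of m "insert l (insert m W)"] dx_mul_apply[OF c, of m "insert m W"]
        by (simp add: contraction_def eq pointwise(2,3,4) insert_commute)
           (simp add: fun_eq_iff pointwise insert_commute)
    qed
  qed
qed

lemma contraction_dx: "contraction l (dx m) = (if l = m then ext_one else 0)"
  by (auto simp: contraction_def fun_eq_iff pointwise dx_apply ext_one_def sca_apply insert_eq_iff
      split: if_splits dest: singleton_insert_inj_eq[THEN iffD1])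

text \<open>There are only finitely many wedge monomials in n generators, and each keeps its whole
  power series as coefficient, so finite sums suffice and no convergence is involved.\<close>

lemma ext_carrier_induct [consumes 1, case_names sca add dx]:
  assumes a: "a \<in> ext_carrier n"
    and sca: "\<And>f. f \<in> ser_carrier n \<Longrightarrow> P (sca f)"
    and add: "\<And>a b. a \<in> ext_carrier n \<Longrightarrow> b \<in> ext_carrier n \<Longrightarrow> P a \<Longrightarrow> P b \<Longrightarrow> P (a + b)"
    and dx: "\<And>m a. m < n \<Longrightarrow> a \<in> ext_carrier n \<Longrightarrow> P a \<Longrightarrow> P (ext_mul (dx m) a)"
  shows "P a"
proof -
  define single :: "nat set \<Rightarrow> 'a ser \<Rightarrow> 'a ext" where "single S f = (\<lambda>U. if U = S then f else 0)" for S f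
  have single_carrier: "single S f \<in> ext_carrier n" if "S \<subseteq> {..<n}" "f \<in> ser_carrier n" for S f
    using that by (auto simp: ext_carrier_iff single_def)
  have P_single: "P (single S f)" if "finite S" "S \<subseteq> {..<n}" "f \<in> ser_carrier n" for S f
    using that(1,2)
  proof (induction S rule: finite_linorder_min_induct)
    case empty
    have "single {} f = sca f" by (simp add: single_def fun_eq_iff pointwise sca_apply)
    then show ?case using sca that(3) by simp
  next
    case (insert m S)
    have c: "single S f \<in> ext_carrier n" using single_carrier insert that(3) by simp
    have "m \<notin> S" using insert.hyps by blast
    \<comment> \<open>The induction on S prepends a new minimum, so multiplication by
      \<open>dx m\<close> creates no inversion and the sign is 1.\<close>
    have "single (insert m S) f = ext_mul (dx m) (single S f)"
    proof
      fix U
      have "U = insert m S \<longleftrightarrow> m \<in> U \<and> U - {m} = S"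
        using \<open>m \<notin> S\<close> by auto
      moreover have "ext_sign {m} S = (1 :: 'a)"
        by (rule ext_sign_min) (simp add: insert.hyps)
      moreover have "ext_mul (dx m) (single S f) U =
          (if m \<in> U then ser_smul (ext_sign {m} (U - {m})) (single S f (U - {m})) else 0)"
        by (rule dx_mul_apply[OF c])
      ultimately show "single (insert m S) f U = ext_mul (dx m) (single S f) U"
        by (cases "U = insert m S") (simp_all add: single_def)
    qed
    then show ?case using insert dx c by simp
  qed
  have "P (\<Sum>S\<in>A. single S (a S)) \<and> (\<Sum>S\<in>A. single S (a S)) \<in> ext_carrier n"
    if "finite A" "A \<subseteq> Pow {..<n}" for A
    using that
  proof (induction A rule: finite_induct)
    case empty
    show ?case using sca[of 0] by (simp add: sca_simps)
  next
    case (insert S A)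
    have S: "S \<subseteq> {..<n}" "finite S" using insert.prems finite_subset by auto
    have "P (single S (a S) + (\<Sum>S\<in>A. single S (a S)))"
      using insert.prems insert.IH S P_single[OF S(2,1) ext_carrier_component[OF a]]
        single_carrier[OF S(1) ext_carrier_component[OF a]] by (intro add) auto
    moreover have "(\<Sum>S\<in>insert S A. single S (a S)) = single S (a S) + (\<Sum>S\<in>A. single S (a S))"
      using insert.hyps by (rule sum.insert)
    ultimately show ?case
      using insert.prems insert.IH single_carrier[OF S(1) ext_carrier_component[OF a]] by simp
  qed
  then have "P (\<Sum>S\<in>Pow {..<n}. single S (a S))" by simp
  also have "(\<Sum>S\<in>Pow {..<n}. single S (a S)) = a"
  proof
    fix U
    have "(\<Sum>S\<in>Pow {..<n}. single S (a S)) U = (\<Sum>S\<in>Pow {..<n}. if S = U then a U else 0)"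
      by (subst sum_fun_apply, rule sum.cong) (auto simp: single_def)
    also have "\<dots> = a U"
      using ext_carrier_vanish[OF a, of U] by (subst sum.delta) auto
    finally show "(\<Sum>S\<in>Pow {..<n}. single S (a S)) U = a U" .
  qed
  finally show ?thesis .
qed

section \<open>Derivations of the exterior algebra\<close>

lemma ext_derD:
  assumes "ext_der n D"
  shows "a \<in> ext_carrier n \<Longrightarrow> D a \<in> ext_carrier n"
    and "a \<in> ext_carrier n \<Longrightarrow> b \<in> ext_carrier n \<Longrightarrow> D (a + b) = D a + D b"
    and "a \<in> ext_carrier n \<Longrightarrow> D (ext_smul c a) = ext_smul c (D a)"
    and "a \<in> ext_carrier n \<Longrightarrow> b \<in> ext_carrier n \<Longrightarrow>
      D (ext_mul a b) = ext_mul (D a) b + ext_mul a (D b)"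
  using assms by (auto simp: ext_der_def)

lemma ext_der_zero: "ext_der n D \<Longrightarrow> D 0 = 0"
  using ext_derD(3)[of n D 0 0] by simp

lemma ext_der_sum:
  assumes "ext_der n D" "\<And>i. i \<in> A \<Longrightarrow> f i \<in> ext_carrier n"
  shows "D (sum f A) = (\<Sum>i\<in>A. D (f i))"
  using assms(2)
  by (induction A rule: infinite_finite_induct)
     (auto simp: ext_der_zero[OF assms(1)] ext_derD(2)[OF assms(1)] ext_carrier_sum)

lemma ext_der_one: "ext_der n D \<Longrightarrow> D ext_one = 0"
  using ext_derD(4)[of n D ext_one ext_one] ext_derD(1)[of n D ext_one] by simp

text \<open>The left factors for which the Leibniz rule holds against every right factor are closed
  under sums and, by associativity, under multiplication by generators. It therefore has to be
  checked only for a series or a single dx on the left.\<close>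

lemma ext_derI:
  assumes closed: "\<And>a. a \<in> ext_carrier n \<Longrightarrow> D a \<in> ext_carrier n"
    and add: "\<And>a b. a \<in> ext_carrier n \<Longrightarrow> b \<in> ext_carrier n \<Longrightarrow> D (a + b) = D a + D b"
    and smul: "\<And>c a. a \<in> ext_carrier n \<Longrightarrow> D (ext_smul c a) = ext_smul c (D a)"
    and sca: "\<And>f a. f \<in> ser_carrier n \<Longrightarrow> a \<in> ext_carrier n \<Longrightarrow>
      D (ext_mul (sca f) a) = ext_mul (D (sca f)) a + ext_mul (sca f) (D a)"
    and dx: "\<And>m a. m < n \<Longrightarrow> a \<in> ext_carrier n \<Longrightarrow>
      D (ext_mul (dx m) a) = ext_mul (D (dx m)) a + ext_mul (dx m) (D a)"
  shows "ext_der n D"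
proof -
  have "D (ext_mul a b) = ext_mul (D a) b + ext_mul a (D b)"
    if "a \<in> ext_carrier n" "b \<in> ext_carrier n" for a b
    using that
  proof (induction a rule: ext_carrier_induct)
    case (add a a')
    then show ?case by (simp add: assms(2) ext_mul_add_left algebra_simps)
  next
    case (dx m a)
    then have "ext_mul a b \<in> ext_carrier n" by simp
    with dx show ?case by (simp add: assms(5) ext_mul_add_left ext_mul_add_right ext_mul_assoc algebra_simps)
  qed (simp add: sca)
  then show ?thesis
    using closed add smul by (simp add: ext_der_def)
qed

text \<open>It serves two ends: applied to the difference of two candidates it gives uniqueness, and
  applied to the defect of the bracket relation it gives the homomorphism property.\<close>

lemma ext_der_vanishI:
  assumes D: "ext_der n D"
    and "\<And>f. f \<in> ser_carrier n \<Longrightarrow> D (sca f) = 0" "\<And>m. m < n \<Longrightarrow> D (dx m) = 0"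
    and "a \<in> ext_carrier n"
  shows "D a = 0"
  using assms(4)
  by (induction a rule: ext_carrier_induct)
     (auto simp: assms(2,3) ext_derD(2,4)[OF D])

lemma ext_der_minus: "ext_der n D \<Longrightarrow> ext_der n E \<Longrightarrow> ext_der n (\<lambda>a. D a - E a)"
  unfolding ext_der_def
  by (simp add: ext_mul_diff_left ext_mul_diff_right) (simp add: fun_eq_iff pointwise algebra_simps)

lemma ext_der_smul_sum:
  fixes E :: "nat \<Rightarrow> 'a::field ext \<Rightarrow> 'a ext"
  assumes "\<And>s. s < n \<Longrightarrow> ext_der n (E s)"
  shows "ext_der n (\<lambda>a. \<Sum>s<n. ext_smul (c s) (E s a))"
proof -
  note E = ext_derD[OF assms]
  show ?thesis
    unfolding ext_der_def ext_ops
  proof (intro conjI ballI allI)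
    fix a b :: "'a ext" assume ab: "a \<in> ext_carrier n" "b \<in> ext_carrier n"
    show "(\<Sum>s<n. ext_smul (c s) (E s (a + b))) = (\<Sum>s<n. ext_smul (c s) (E s a)) + (\<Sum>s<n. ext_smul (c s) (E s b))"
      unfolding sum.distrib[symmetric] by (rule sum.cong) (auto simp: E ab ext_smul_add)
    show "(\<Sum>s<n. ext_smul (c s) (E s (ext_mul a b))) =
        ext_mul (\<Sum>s<n. ext_smul (c s) (E s a)) b + ext_mul a (\<Sum>s<n. ext_smul (c s) (E s b))"
      unfolding ext_mul_sum_left ext_mul_sum_right sum.distrib[symmetric]
      by (rule sum.cong) (auto simp: E ab ext_smul_add ext_mul_smul_left ext_mul_smul_right)
  next
    fix a :: "'a ext" and x assume ab: "a \<in> ext_carrier n"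
    show "(\<Sum>s<n. ext_smul (c s) (E s a)) \<in> ext_carrier n"
      using E ab by (intro ext_carrier_sum) auto
    show "(\<Sum>s<n. ext_smul (c s) (E s (ext_smul x a))) = ext_smul x (\<Sum>s<n. ext_smul (c s) (E s a))"
      unfolding ext_smul_sum by (rule sum.cong) (auto simp: E ab mult.commute)
  qed
qed

lemma ext_der_commutator:
  assumes D: "ext_der n D" and E: "ext_der n E"
  shows "ext_der n (\<lambda>a. D (E a) - E (D a))"
  unfolding ext_der_def
  by (simp add: ext_derD[OF D] ext_derD[OF E] ext_mul_diff_left ext_mul_diff_right)
     (simp add: fun_eq_iff pointwise algebra_simps)

section \<open>Extension of the action\<close>

text \<open>The coefficients of a matrix inverse, found by comparing coefficients at \<alpha> in M N
  = 1. The constant term of M is the identity, so the coefficient of N at \<alpha> appears alone and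
  all others involved have smaller total degree.\<close>

function mat_right_inverse ::
  "nat \<Rightarrow> (nat \<Rightarrow> nat \<Rightarrow> 'k::field ser) \<Rightarrow> (nat \<Rightarrow> nat) \<Rightarrow> nat \<Rightarrow> nat \<Rightarrow> 'k" where
  "mat_right_inverse n M \<alpha> k l = (if mi n \<alpha> then
     (if \<alpha> = (\<lambda>_. 0) \<and> k = l then 1 else 0) -
     (\<Sum>\<beta>\<in>{\<beta>. \<beta> \<le> \<alpha> \<and> \<beta> \<noteq> (\<lambda>_. 0)}. \<Sum>s<n. M k s \<beta> * mat_right_inverse n M (\<lambda>j. \<alpha> j - \<beta> j) s l)
   else 0)"
  by pat_completeness auto
termination
proof (relation "measure (\<lambda>(n, M, \<alpha>, k, l). \<Sum>j<n. \<alpha> j)")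
  fix n :: nat and M :: "nat \<Rightarrow> nat \<Rightarrow> 'k ser" and \<alpha> \<beta> :: "nat \<Rightarrow> nat" and k l s :: nat
  assume mi: "mi n \<alpha>" and \<beta>: "\<beta> \<in> {\<beta>. \<beta> \<le> \<alpha> \<and> \<beta> \<noteq> (\<lambda>_. 0)}"
  \<comment> \<open>A positive coordinate of \<beta> must lie below n, where it counts towards the
    total degree; hence the measure drops strictly.\<close>
  then obtain j where "0 < \<beta> j" by auto
  moreover have "\<beta> j \<le> \<alpha> j" using \<beta> by (simp add: le_fun_def)
  moreover from calculation have "j < n" using mi by (auto simp: mi_def not_less[symmetric])
  ultimately have "(\<Sum>j<n. \<alpha> j - \<beta> j) < (\<Sum>j<n. \<alpha> j)"
    by (intro sum_strict_mono_ex1) (auto intro!: bexI[of _ j])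
  then show "((n, M, \<lambda>j. \<alpha> j - \<beta> j, s, l), n, M, \<alpha>, k, l) \<in> measure (\<lambda>(n, M, \<alpha>, k, l). \<Sum>j<n. \<alpha> j)"
    by simp
qed simp

declare mat_right_inverse.simps [simp del]

lemma ser_mat_right_inverse_exists:
  assumes M: "\<And>k s. k < n \<Longrightarrow> s < n \<Longrightarrow> M k s \<in> ser_carrier n"
    and close: "close_to_id n M"
  obtains N where "\<And>k s. N k s \<in> ser_carrier n"
    "\<And>k l. k < n \<Longrightarrow> l < n \<Longrightarrow> (\<Sum>s<n. ser_mul (M k s) (N s l)) = (if k = l then ser_one else 0)"
proof
  define N where "N k l = (\<lambda>\<alpha>. mat_right_inverse n M \<alpha> k l)" for k l
  show N: "N k s \<in> ser_carrier n" for k s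
    by (simp add: N_def ser_carrier_def mat_right_inverse.simps)
  fix k l assume kl: "k < n" "l < n"
  show "(\<Sum>s<n. ser_mul (M k s) (N s l)) = (if k = l then ser_one else 0)"
  proof (rule ser_carrier_eqI)
    show "(\<Sum>s<n. ser_mul (M k s) (N s l)) \<in> ser_carrier n"
      using M N kl by (intro ser_carrier_sum) simp
    fix \<alpha> assume mi: "mi n \<alpha>"
    define g where "g \<beta> = (\<Sum>s<n. M k s \<beta> * N s l (\<lambda>j. \<alpha> j - \<beta> j))" for \<beta>
    have split: "{\<beta>. \<beta> \<le> \<alpha>} = insert (\<lambda>_. 0) {\<beta>. \<beta> \<le> \<alpha> \<and> \<beta> \<noteq> (\<lambda>_. 0)}"
      by (auto simp: le_fun_def)
    have fin: "finite {\<beta>. \<beta> \<le> \<alpha> \<and> \<beta> \<noteq> (\<lambda>_. 0)}"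
      using finite_mi_le[OF mi] by (rule finite_subset[rotated]) auto
    have "(\<Sum>s<n. ser_mul (M k s) (N s l)) \<alpha> = (\<Sum>\<beta>\<in>{\<beta>. \<beta> \<le> \<alpha>}. g \<beta>)"
      unfolding g_def by (subst sum.swap) (simp add: sum_fun_apply ser_mul_def)
    also have "\<dots> = g (\<lambda>_. 0) + (\<Sum>\<beta>\<in>{\<beta>. \<beta> \<le> \<alpha> \<and> \<beta> \<noteq> (\<lambda>_. 0)}. g \<beta>)"
      unfolding split by (subst sum.insert[OF fin]) auto
    \<comment> \<open>Closeness to the identity is used here: the constant term of row k of M
      selects the single entry \<open>N k l\<close>.\<close>
    also have "g (\<lambda>_. 0) = (\<Sum>s<n. if s = k then N k l \<alpha> else 0)"
      unfolding g_def using close kl by (intro sum.cong) (auto simp: close_to_id_def)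
    also have "\<dots> = N k l \<alpha>"
      using kl by simp
    also have "N k l \<alpha> = (if \<alpha> = (\<lambda>_. 0) \<and> k = l then 1 else 0) - (\<Sum>\<beta>\<in>{\<beta>. \<beta> \<le> \<alpha> \<and> \<beta> \<noteq> (\<lambda>_. 0)}. g \<beta>)"
      unfolding g_def N_def by (subst mat_right_inverse.simps) (use mi in simp)
    finally show "(\<Sum>s<n. ser_mul (M k s) (N s l)) \<alpha> = (if k = l then ser_one else 0) \<alpha>"
      by (simp add: ser_one_def pointwise)
  qed auto
qed

text \<open>Associativity for a row, a matrix and a column. It yields both the uniqueness of
  inverses and the formula for the derivative of the inverse matrix.\<close>

lemma ser_mat_cancel:
  assumes inv: "\<And>l. l < n \<Longrightarrow> (\<Sum>s<n. ser_mul (N k s) (M s l)) = (if k = l then ser_one else 0)"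
    and X: "\<And>j. j < n \<Longrightarrow> X j \<in> ser_carrier n" and "k < n"
  shows "(\<Sum>t<n. ser_mul (N k t) (\<Sum>j<n. ser_mul (M t j) (X j))) = X k"
proof -
  have "(\<Sum>t<n. ser_mul (N k t) (\<Sum>j<n. ser_mul (M t j) (X j))) =
      (\<Sum>j<n. ser_mul (\<Sum>t<n. ser_mul (N k t) (M t j)) (X j))"
    unfolding ser_mul_sum_left ser_mul_sum_right by (subst sum.swap) (simp only: ser_mul_assoc)
  also have "\<dots> = (\<Sum>j<n. if j = k then X k else 0)"
    by (rule sum.cong) (auto simp: inv ser_mul_one(1)[OF X])
  also have "\<dots> = X k"
    using assms by (subst sum.delta) auto
  finally show ?thesis .
qed

lemma ser_mat_inverse_unique:
  assumes left: "\<And>k l. k < n \<Longrightarrow> l < n \<Longrightarrow> (\<Sum>s<n. ser_mul (N k s) (M s l)) = (if k = l then ser_one else 0)"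
    and right: "\<And>k l. k < n \<Longrightarrow> l < n \<Longrightarrow> (\<Sum>s<n. ser_mul (M k s) (N' s l)) = (if k = l then ser_one else 0)"
    and N: "\<And>k l. k < n \<Longrightarrow> l < n \<Longrightarrow> N k l \<in> ser_carrier n"
    and N': "\<And>k l. k < n \<Longrightarrow> l < n \<Longrightarrow> N' k l \<in> ser_carrier n"
    and "k < n" "l < n"
  shows "N k l = N' k l"
proof -
  have "N' k l = (\<Sum>t<n. ser_mul (N k t) (\<Sum>j<n. ser_mul (M t j) (N' j l)))"
    by (rule ser_mat_cancel[symmetric]) (use assms in auto)
  also have "\<dots> = (\<Sum>t<n. if t = l then N k l else 0)"
    using assms by (intro sum.cong) (auto simp: right ser_mul_one(2)[OF N])
  also have "\<dots> = N k l"
    using assms by (subst sum.delta) auto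
  finally show ?thesis by simp
qed

text \<open>\<open>ser_mat_inv\<close> is a definite description of a two-sided inverse, so nothing
  is known of it until existence and uniqueness are established. Requiring zeros outside the n by n
  block makes the inverse unique as a function.\<close>

lemma ser_mat_inv_props:
  assumes M: "\<And>k s. k < n \<Longrightarrow> s < n \<Longrightarrow> M k s \<in> ser_carrier n"
    and close: "close_to_id n M"
  shows "k < n \<Longrightarrow> s < n \<Longrightarrow> ser_mat_inv n M k s \<in> ser_carrier n"
    and "k < n \<Longrightarrow> l < n \<Longrightarrow>
      (\<Sum>s<n. ser_mul (ser_mat_inv n M k s) (M s l)) = (if k = l then ser_one else 0)"
    and "k < n \<Longrightarrow> l < n \<Longrightarrow>
      (\<Sum>s<n. ser_mul (M k s) (ser_mat_inv n M s l)) = (if k = l then ser_one else 0)"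
proof -
  define is_inv where "is_inv N \<longleftrightarrow>
     (\<forall>k s. (n \<le> k \<or> n \<le> s) \<longrightarrow> N k s = ser_zero) \<and>
     (\<forall>k<n. \<forall>s<n. N k s \<in> ser_carrier n) \<and>
     (\<forall>k<n. \<forall>l<n. (\<lambda>\<alpha>. \<Sum>s<n. ser_mul (N k s) (M s l) \<alpha>) = (if k = l then ser_one else ser_zero)) \<and>
     (\<forall>k<n. \<forall>l<n. (\<lambda>\<alpha>. \<Sum>s<n. ser_mul (M k s) (N s l) \<alpha>) = (if k = l then ser_one else ser_zero))" for N
  have sum_eq: "(\<lambda>\<alpha>. \<Sum>s<n. F s \<alpha>) = (\<Sum>s<n. F s)" for F :: "nat \<Rightarrow> 'a ser"
    by (simp add: fun_eq_iff pointwise)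
  obtain R where R: "\<And>k s. R k s \<in> ser_carrier n"
    "\<And>k l. k < n \<Longrightarrow> l < n \<Longrightarrow> (\<Sum>s<n. ser_mul (M k s) (R s l)) = (if k = l then ser_one else 0)"
    using ser_mat_right_inverse_exists[OF M close] by blast
  \<comment> \<open>A left inverse comes from a right inverse of the transposed matrix, because the
    entries commute.\<close>
  have "close_to_id n (\<lambda>k s. M s k)"
    using close by (auto simp: close_to_id_def)
  from ser_mat_right_inverse_exists[OF M this]
  obtain L where L: "\<And>k s. L k s \<in> ser_carrier n"
    "\<And>k l. k < n \<Longrightarrow> l < n \<Longrightarrow> (\<Sum>s<n. ser_mul (M s k) (L s l)) = (if k = l then ser_one else 0)"
    by blast
  have L': "(\<Sum>s<n. ser_mul (L s k) (M s l)) = (if k = l then ser_one else 0)" if "k < n" "l < n" for k l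
    using L(2)[OF that(2,1)] by (simp add: ser_mul_commute)
  have LR: "L l k = R k l" if "k < n" "l < n" for k l
    by (rule ser_mat_inverse_unique[where N = "\<lambda>k l. L l k" and N' = R, OF L' R(2) L(1) R(1) that])
  define N where "N k s = (if k < n \<and> s < n then R k s else 0)" for k s
  have "(\<Sum>s<n. ser_mul (N k s) (M s l)) = (\<Sum>s<n. ser_mul (L s k) (M s l))"
    "(\<Sum>s<n. ser_mul (M k s) (N s l)) = (\<Sum>s<n. ser_mul (M k s) (R s l))" if "k < n" "l < n" for k l
    using that by (auto intro!: sum.cong simp: N_def LR)
  then have N_inv: "is_inv N"
    using R L' by (simp add: is_inv_def sum_eq N_def)
  moreover have "N' = N" if N': "is_inv N'" for N'
  proof (rule ext, rule ext)
    fix k l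
    show "N' k l = N k l"
    proof (cases "k < n \<and> l < n")
      case True
      show ?thesis
        by (rule ser_mat_inverse_unique[where M = M and n = n])
           (use True N_inv N' in \<open>simp_all add: is_inv_def sum_eq\<close>)
    next
      case False
      then show ?thesis using N_inv N' by (auto simp: is_inv_def not_less)
    qed
  qed
  ultimately have "ser_mat_inv n M = N"
    unfolding ser_mat_inv_def is_inv_def by (rule the_equality)
  with N_inv have inv: "is_inv (ser_mat_inv n M)" by simp
  show "ser_mat_inv n M k s \<in> ser_carrier n" if "k < n" "s < n"
    using inv that by (simp add: is_inv_def)
  show "(\<Sum>s<n. ser_mul (ser_mat_inv n M k s) (M s l)) = (if k = l then ser_one else 0)"
    "(\<Sum>s<n. ser_mul (M k s) (ser_mat_inv n M s l)) = (if k = l then ser_one else 0)"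
    if "k < n" "l < n"
    using inv that by (simp_all add: is_inv_def sum_eq)
qed

text \<open>The extension of a derivation of the series ring that treats every dx as a
  constant.\<close>

definition coeffwise :: "('k::field ser \<Rightarrow> 'k ser) \<Rightarrow> 'k ext \<Rightarrow> 'k ext" where
  "coeffwise D a = (\<lambda>S. D (a S))"

lemma coeffwise_sca_mul:
  assumes D: "ser_der n D" and f: "f \<in> ser_carrier n" and a: "a \<in> ext_carrier n"
  shows "coeffwise D (ext_mul (sca f) a) = ext_mul (sca (D f)) a + ext_mul (sca f) (coeffwise D a)"
proof
  show "coeffwise D (ext_mul (sca f) a) S = (ext_mul (sca (D f)) a + ext_mul (sca f) (coeffwise D a)) S" for S
    using ser_derD(4)[OF D f ext_carrier_component[OF a, of S]]
    by (cases "finite S")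
       (simp_all add: coeffwise_def sca_mul_apply ext_mul_infinite ser_der_zero[OF D] pointwise(1))
qed

lemma coeffwise_carrier:
  assumes D: "ser_der n D" and a: "a \<in> ext_carrier n"
  shows "coeffwise D a \<in> ext_carrier n"
  using ser_derD(1)[OF D ext_carrier_component[OF a]] ext_carrier_vanish[OF a] ser_der_zero[OF D]
  by (simp add: ext_carrier_iff coeffwise_def)

lemma coeffwise_dx_mul:
  assumes D: "ser_der n D" and a: "a \<in> ext_carrier n"
  shows "coeffwise D (ext_mul (dx m) a) = ext_mul (dx m) (coeffwise D a)"
proof
  show "coeffwise D (ext_mul (dx m) a) S = ext_mul (dx m) (coeffwise D a) S" for S
    using dx_mul_apply[OF a, of m S] dx_mul_apply[OF coeffwise_carrier[OF D a], of m S]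
      ser_derD(3)[OF D ext_carrier_component[OF a]]
    by (simp add: coeffwise_def ser_der_zero[OF D])
qed

section \<open>Construction of the extended derivations\<close>

locale lie_series_action =
  fixes n :: nat and C :: "nat \<Rightarrow> nat \<Rightarrow> nat \<Rightarrow> 'k::field" and phi :: "nat \<Rightarrow> 'k ser \<Rightarrow> 'k ser"
  assumes hom: "lie_hom_ser n C phi"
    and close: "close_to_id n (phimat phi)"
begin

abbreviation "M \<equiv> phimat phi"
abbreviation "N \<equiv> ser_mat_inv n (phimat phi)"

lemma phi_der: "i < n \<Longrightarrow> ser_der n (phi i)"
  using hom by (simp add: lie_hom_ser_def)

lemma phi_commutator:
  assumes "i < n" "j < n" "f \<in> ser_carrier n"
  shows "phi i (phi j f) - phi j (phi i f) = (\<Sum>s<n. ser_smul (C s i j) (phi s f))"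
  using hom assms by (simp add: lie_hom_ser_def fun_eq_iff pointwise)

lemma M_carrier [simp]: "j < n \<Longrightarrow> i < n \<Longrightarrow> M j i \<in> ser_carrier n"
  using ser_derD(1)[OF phi_der] by (simp add: phimat_def)

lemma N_carrier [simp]: "k < n \<Longrightarrow> s < n \<Longrightarrow> N k s \<in> ser_carrier n"
  by (rule ser_mat_inv_props(1)[OF M_carrier close])

lemma N_mult_M: "k < n \<Longrightarrow> l < n \<Longrightarrow> (\<Sum>s<n. ser_mul (N k s) (M s l)) = (if k = l then ser_one else 0)"
  by (rule ser_mat_inv_props(2)[OF M_carrier close])

lemma M_mult_N: "k < n \<Longrightarrow> l < n \<Longrightarrow> (\<Sum>s<n. ser_mul (M k s) (N s l)) = (if k = l then ser_one else 0)"
  by (rule ser_mat_inv_props(3)[OF M_carrier close])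

text \<open>The minus sign undoes the one in \<open>phimat\<close>, whose entries are values of the
  action of -x_i.\<close>

lemma phi_chain_rule:
  assumes "i < n" "f \<in> ser_carrier n"
  shows "phi i f = - (\<Sum>r<n. ser_mul (ser_pd r f) (M r i))"
proof -
  have "phi i f = (\<Sum>r<n. ser_mul (phi i (ser_var r)) (ser_pd r f))"
    using ser_der_chain_rule[OF phi_der] assms by blast
  also have "\<dots> = (\<Sum>r<n. - ser_mul (ser_pd r f) (M r i))"
    by (simp add: phimat_def ser_mul_neg_right ser_mul_commute)
  finally show ?thesis by (simp only: sum_negf)
qed

text \<open>The logarithmic derivative of the matrix M along \<open>phi i\<close>. It is the matrix
  by which the extended derivation acts on the generators dx.\<close>

definition logder :: "nat \<Rightarrow> nat \<Rightarrow> nat \<Rightarrow> 'k ser" where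
  "logder i k l = (\<Sum>s<n. ser_mul (N k s) (phi i (M s l)))"

lemma logder_carrier [simp]: "i < n \<Longrightarrow> k < n \<Longrightarrow> l < n \<Longrightarrow> logder i k l \<in> ser_carrier n"
  unfolding logder_def using ser_derD(1)[OF phi_der] by (intro ser_carrier_sum) simp

text \<open>Differentiating M N = 1 gives \<open>phi i\<close> (M) N = - M \<open>phi i\<close> (N);
  multiplying by N from the left then cancels M.\<close>

lemma logder_mult_N:
  assumes "i < n" "k < n" "s < n"
  shows "(\<Sum>l<n. ser_mul (logder i k l) (N l s)) = - phi i (N k s)"
proof -
  note D = phi_der[OF \<open>i < n\<close>]
  have *: "(\<Sum>l<n. ser_mul (phi i (M t l)) (N l s)) = - (\<Sum>l<n. ser_mul (M t l) (phi i (N l s)))"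
    if t: "t < n" for t
  proof -
    have "0 = phi i (\<Sum>l<n. ser_mul (M t l) (N l s))"
      using t assms by (simp add: M_mult_N ser_der_zero[OF D] ser_der_one[OF D])
    also have "\<dots> = (\<Sum>l<n. ser_mul (phi i (M t l)) (N l s) + ser_mul (M t l) (phi i (N l s)))"
      using t assms by (subst ser_der_sum[OF D]) (auto simp: ser_derD(4)[OF D])
    finally show ?thesis
      by (simp only: sum.distrib eq_neg_iff_add_eq_0)
  qed
  have "(\<Sum>l<n. ser_mul (logder i k l) (N l s)) =
      (\<Sum>t<n. ser_mul (N k t) (\<Sum>l<n. ser_mul (phi i (M t l)) (N l s)))"
    unfolding logder_def ser_mul_sum_left ser_mul_sum_right
    by (subst sum.swap) (simp only: ser_mul_assoc)
  also have "\<dots> = - (\<Sum>t<n. ser_mul (N k t) (\<Sum>l<n. ser_mul (M t l) (phi i (N l s))))"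
    by (simp add: * ser_mul_neg_right sum_negf)
  also have "(\<Sum>t<n. ser_mul (N k t) (\<Sum>l<n. ser_mul (M t l) (phi i (N l s)))) = phi i (N k s)"
    using assms ser_derD(1)[OF D] by (intro ser_mat_cancel) (auto simp: N_mult_M)
  finally show ?thesis .
qed

text \<open>The second summand is linear over the series and sends \<open>dx l\<close> to the sum of
  the \<open>dx k\<close> weighted by \<open>logder i k l\<close>. As an explicit operator it is
  defined on every element at once, and consistency with products becomes a property to be
  proved.\<close>

definition ext_phi :: "nat \<Rightarrow> 'k ext \<Rightarrow> 'k ext" where
  "ext_phi i a = coeffwise (phi i) a +
     (\<Sum>k<n. \<Sum>l<n. ext_mul (sca (logder i k l)) (ext_mul (dx k) (contraction l a)))"

lemma ext_phi_sca: "i < n \<Longrightarrow> ext_phi i (sca f) = sca (phi i f)"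
  using ser_der_zero[OF phi_der]
  by (simp add: ext_phi_def contraction_sca) (simp add: coeffwise_def fun_eq_iff sca_apply)

lemma ext_phi_dx:
  assumes "i < n" "m < n"
  shows "ext_phi i (dx m) = (\<Sum>k<n. ext_mul (dx k) (sca (logder i k m)))"
proof -
  have "coeffwise (phi i) (dx m) = 0"
    using ser_der_zero[OF phi_der] ser_der_one[OF phi_der] assms
    by (simp add: coeffwise_def fun_eq_iff dx_apply pointwise)
  moreover have "(\<Sum>l<n. ext_mul (sca (logder i k l)) (ext_mul (dx k) (contraction l (dx m)))) =
      ext_mul (dx k) (sca (logder i k m))" if "k < n" for k
  proof -
    have "(\<Sum>l<n. ext_mul (sca (logder i k l)) (ext_mul (dx k) (contraction l (dx m)))) =
        (\<Sum>l<n. if l = m then ext_mul (dx k) (sca (logder i k m)) else 0)"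
      using that by (intro sum.cong) (auto simp: contraction_dx sca_commute ext_one_mul(2)[OF ext_carrier_dx])
    also have "\<dots> = ext_mul (dx k) (sca (logder i k m))"
      using assms by (subst sum.delta) auto
    finally show ?thesis .
  qed
  ultimately show ?thesis by (simp add: ext_phi_def)
qed

lemma ext_phi_der:
  assumes i: "i < n"
  shows "ext_der n (ext_phi i)"
proof (rule ext_derI)
  note D = phi_der[OF i]
  fix a :: "'k ext" assume a: "a \<in> ext_carrier n"
  show "ext_phi i a \<in> ext_carrier n"
    unfolding ext_phi_def using a i coeffwise_carrier[OF D a]
    by (intro ext_carrier_closed ext_carrier_sum) auto
  show "ext_phi i (ext_smul c a) = ext_smul c (ext_phi i a)" for c
  proof -
    have "coeffwise (phi i) (ext_smul c a) = ext_smul c (coeffwise (phi i) a)"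
      using ser_derD(3)[OF D ext_carrier_component[OF a]]
      by (simp add: coeffwise_def ext_smul_component fun_eq_iff pointwise)
    then show ?thesis
      by (simp add: ext_phi_def contraction_smul ext_mul_smul_right ext_smul_add ext_smul_sum)
  qed
  show "ext_phi i (a + b) = ext_phi i a + ext_phi i b" if b: "b \<in> ext_carrier n" for b
  proof -
    have "coeffwise (phi i) (a + b) = coeffwise (phi i) a + coeffwise (phi i) b"
      using ser_derD(2)[OF D ext_carrier_component[OF a] ext_carrier_component[OF b]]
      by (simp add: coeffwise_def fun_eq_iff pointwise(1))
    then show ?thesis
      by (simp add: ext_phi_def contraction_add ext_mul_add_right sum.distrib)
  qed
  show "ext_phi i (ext_mul (sca f) a) = ext_mul (ext_phi i (sca f)) a + ext_mul (sca f) (ext_phi i a)"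
    if f: "f \<in> ser_carrier n" for f
  proof -
    have "ext_mul (sca (logder i k l)) (ext_mul (dx k) (ext_mul (sca f) (contraction l a))) =
        ext_mul (sca f) (ext_mul (sca (logder i k l)) (ext_mul (dx k) (contraction l a)))" for k l
      by (metis ext_mul_assoc sca_commute)
    then show ?thesis
      unfolding ext_phi_sca[OF i]
      by (simp add: ext_phi_def coeffwise_sca_mul[OF D f a] contraction_sca_mul[OF a]
          ext_mul_add_right ext_mul_sum_right add.assoc)
  qed
  show "ext_phi i (ext_mul (dx m) a) = ext_mul (ext_phi i (dx m)) a + ext_mul (dx m) (ext_phi i a)"
    if m: "m < n" for m
  proof -
    \<comment> \<open>Two signs cancel: moving the contraction past \<open>dx m\<close> costs one
      and moving \<open>dx k\<close> past \<open>dx m\<close> costs the other. This makes dx_k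
      \<and> \<iota>_l an ordinary, even derivation.\<close>
    have *: "ext_mul (sca (logder i k l)) (ext_mul (dx k) (contraction l (ext_mul (dx m) a))) =
        (if l = m then ext_mul (ext_mul (dx k) (sca (logder i k m))) a else 0) +
        ext_mul (dx m) (ext_mul (sca (logder i k l)) (ext_mul (dx k) (contraction l a)))"
      (is "?L k l = ?A k l + ?B k l") if "k < n" "l < n" for k l
    proof -
      have c: "contraction l a \<in> ext_carrier n" using a by simp
      have "?L k l = ext_mul (sca (logder i k l)) (ext_mul (dx k) (if l = m then a else 0)) -
          ext_mul (sca (logder i k l)) (ext_mul (dx k) (ext_mul (dx m) (contraction l a)))"
        by (simp only: contraction_dx_mul[OF a m] ext_mul_diff_right)
      also have "ext_mul (sca (logder i k l)) (ext_mul (dx k) (if l = m then a else 0)) = ?A k l"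
        by (auto simp: sca_commute ext_mul_assoc[symmetric])
      also have "ext_mul (sca (logder i k l)) (ext_mul (dx k) (ext_mul (dx m) (contraction l a))) =
          - ext_mul (ext_mul (sca (logder i k l)) (dx m)) (ext_mul (dx k) (contraction l a))"
        by (simp only: dx_anticommute[OF c that(1) m] ext_mul_neg_right ext_mul_assoc)
      also have "ext_mul (ext_mul (sca (logder i k l)) (dx m)) (ext_mul (dx k) (contraction l a)) = ?B k l"
        by (simp only: sca_commute[of _ "dx m"] ext_mul_assoc)
      finally show ?thesis by (simp only: diff_minus_eq_add)
    qed
    have "(\<Sum>k<n. \<Sum>l<n. ext_mul (sca (logder i k l)) (ext_mul (dx k) (contraction l (ext_mul (dx m) a)))) =
        (\<Sum>k<n. \<Sum>l<n. (if l = m then ext_mul (ext_mul (dx k) (sca (logder i k m))) a else 0) +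
          ext_mul (dx m) (ext_mul (sca (logder i k l)) (ext_mul (dx k) (contraction l a))))"
      by (intro sum.cong refl) (simp only: * lessThan_iff)
    also have "\<dots> = (\<Sum>k<n. ext_mul (ext_mul (dx k) (sca (logder i k m))) a) +
          ext_mul (dx m) (\<Sum>k<n. \<Sum>l<n. ext_mul (sca (logder i k l)) (ext_mul (dx k) (contraction l a)))"
      using m by (simp only: sum.distrib ext_mul_sum_right) simp
    finally show ?thesis
      unfolding ext_phi_dx[OF i m] unfolding ext_phi_def
      by (simp add: coeffwise_dx_mul[OF D a] ext_mul_add_right ext_mul_sum_left ac_simps)
  qed
qed

text \<open>The elements \<open>y\<^sub>s = \<Sum>\<^sub>k dx\<^sub>k (\<phi>\<inverse>)\<^sup>k\<^sub>s\<close> form a basis of constants: in this basis the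
  extended derivations act on the coefficients only.\<close>

definition invariant_form :: "nat \<Rightarrow> 'k ext" where
  "invariant_form s = (\<Sum>k<n. ext_mul (dx k) (sca (N k s)))"

lemma invariant_form_carrier [simp]: "s < n \<Longrightarrow> invariant_form s \<in> ext_carrier n"
  unfolding invariant_form_def by (intro ext_carrier_sum) auto

text \<open>The Leibniz rule gives dx times (\<open>logder\<close> N plus the derivative of N), and
  the bracket vanishes by \<open>logder_mult_N\<close>.\<close>

lemma ext_phi_invariant_form:
  assumes i: "i < n" and s: "s < n"
  shows "ext_phi i (invariant_form s) = 0"
proof -
  note D = ext_phi_der[OF i]
  have "ext_phi i (invariant_form s) =
      (\<Sum>k<n. ext_mul (\<Sum>j<n. ext_mul (dx j) (sca (logder i j k))) (sca (N k s)) + ext_mul (dx k) (sca (phi i (N k s))))"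
    unfolding invariant_form_def using s
    by (subst ext_der_sum[OF D]) (auto simp: ext_derD(4)[OF D] ext_phi_dx[OF i] ext_phi_sca[OF i])
  also have "\<dots> = (\<Sum>k<n. \<Sum>j<n. ext_mul (dx j) (sca (ser_mul (logder i j k) (N k s)))) + (\<Sum>k<n. ext_mul (dx k) (sca (phi i (N k s))))"
    by (simp only: sum.distrib ext_mul_sum_left ext_mul_assoc sca_mul)
  also have "(\<Sum>k<n. \<Sum>j<n. ext_mul (dx j) (sca (ser_mul (logder i j k) (N k s)))) =
      (\<Sum>j<n. ext_mul (dx j) (sca (\<Sum>k<n. ser_mul (logder i j k) (N k s))))"
    by (subst sum.swap) (simp only: ext_mul_sum_right sca_sum)
  also have "\<dots> = (\<Sum>j<n. - ext_mul (dx j) (sca (phi i (N j s))))"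
    using i s by (intro sum.cong) (auto simp: logder_mult_N sca_simps ext_mul_neg_right)
  finally show ?thesis by (simp only: sum_negf) simp
qed

text \<open>The inverse change of generators. It allows a derivation to be tested on the constant
  forms in place of the dx.\<close>

lemma dx_invariant_form:
  assumes l: "l < n"
  shows "dx l = (\<Sum>s<n. ext_mul (invariant_form s) (sca (M s l)))"
proof -
  have "(\<Sum>s<n. ext_mul (invariant_form s) (sca (M s l))) =
      (\<Sum>k<n. ext_mul (dx k) (sca (\<Sum>s<n. ser_mul (N k s) (M s l))))"
    unfolding invariant_form_def ext_mul_sum_left ext_mul_sum_right sca_sum ext_mul_assoc sca_mul
    by (rule sum.swap)
  also have "\<dots> = (\<Sum>k<n. if k = l then dx l else 0)"
    using l by (intro sum.cong) (auto simp: N_mult_M sca_simps ext_one_def[symmetric] ext_one_mul(2)[OF ext_carrier_dx])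
  also have "\<dots> = dx l"
    using l by (subst sum.delta) auto
  finally show ?thesis by simp
qed

lemma lie_hom_ext_phi: "lie_hom_ext n C ext_phi"
proof -
  have "ext_phi i (ext_phi j a) - ext_phi j (ext_phi i a) - (\<Sum>s<n. ext_smul (C s i j) (ext_phi s a)) = 0"
    if ij: "i < n" "j < n" and a: "a \<in> ext_carrier n" for i j a
  proof -
    \<comment> \<open>\<open>L\<close> is the defect of the bracket relation. On series it vanishes
      by hypothesis, and on an invariant form each of its terms is zero by itself.\<close>
    define L where "L a = ext_phi i (ext_phi j a) - ext_phi j (ext_phi i a) -
      (\<Sum>s<n. ext_smul (C s i j) (ext_phi s a))" for a
    have L: "ext_der n L"
      unfolding L_def using ij by (intro ext_der_minus ext_der_commutator ext_der_smul_sum ext_phi_der) auto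
    have L_sca: "L (sca f) = 0" if "f \<in> ser_carrier n" for f
    proof -
      have "L (sca f) = sca (phi i (phi j f) - phi j (phi i f) - (\<Sum>s<n. ser_smul (C s i j) (phi s f)))"
        unfolding L_def using ij
        by (simp add: ext_phi_sca) (auto simp: fun_eq_iff sca_def pointwise)
      then show ?thesis
        using phi_commutator[OF ij that] by (simp add: sca_simps)
    qed
    have L_form: "L (invariant_form s) = 0" if "s < n" for s
      using ij that by (simp add: L_def ext_phi_invariant_form ext_der_zero[OF ext_phi_der])
    have "L (dx l) = 0" if "l < n" for l
      using that by (subst dx_invariant_form[OF that], subst ext_der_sum[OF L])
        (auto simp: ext_derD(4)[OF L] L_sca L_form)
    then have "L a = 0"
      by (intro ext_der_vanishI[OF L L_sca _ a])
    then show ?thesis by (simp add: L_def)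
  qed
  then show ?thesis
    using ext_phi_der by (simp add: lie_hom_ext_def fun_eq_iff pointwise)
qed

lemma ext_phi_dx_formula:
  assumes i: "i < n" and l: "l < n"
  shows "ext_phi i (dx l) = ext_neg (\<lambda>S \<alpha>. \<Sum>k<n. \<Sum>r<n. \<Sum>s<n. ext_mul (dx k)
    (sca (ser_mul (ser_mul (N k s) (ser_pd r (M s l))) (M r i))) S \<alpha>)"
proof -
  have "logder i k l = - (\<Sum>r<n. \<Sum>s<n. ser_mul (ser_mul (N k s) (ser_pd r (M s l))) (M r i))" for k
  proof -
    have "logder i k l = (\<Sum>s<n. \<Sum>r<n. - ser_mul (ser_mul (N k s) (ser_pd r (M s l))) (M r i))"
      unfolding logder_def using i l
      by (intro sum.cong refl)
         (simp add: phi_chain_rule ser_mul_neg_right ser_mul_sum_right sum_negf ser_mul_assoc)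
    then show ?thesis
      by (subst sum.swap) (simp only: sum_negf)
  qed
  then have "ext_phi i (dx l) = - (\<Sum>k<n. \<Sum>r<n. \<Sum>s<n. ext_mul (dx k)
    (sca (ser_mul (ser_mul (N k s) (ser_pd r (M s l))) (M r i))))"
    by (simp add: ext_phi_dx[OF i l] sca_simps sca_sum ext_mul_neg_right ext_mul_sum_right sum_negf)
  then show ?thesis
    by (simp add: fun_eq_iff pointwise)
qed

lemma tilde_ok_ext_phi: "tilde_ok n C phi ext_phi"
  unfolding tilde_ok_def using lie_hom_ext_phi ext_phi_sca ext_phi_dx_formula by blast

text \<open>Agreement is stated on the carrier and for indices below n, since
  \<open>tilde_ok\<close> leaves all other values free.\<close>

lemma tilde_ok_unique:
  assumes psi: "tilde_ok n C phi psi" and i: "i < n" and a: "a \<in> ext_carrier n"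
  shows "psi i a = ext_phi i a"
proof -
  have "ext_der n (psi i)"
    using psi i by (simp add: tilde_ok_def lie_hom_ext_def)
  then have "ext_der n (\<lambda>a. psi i a - ext_phi i a)"
    using ext_phi_der[OF i] by (rule ext_der_minus)
  then have "psi i a - ext_phi i a = 0"
  proof (rule ext_der_vanishI[OF _ _ _ a])
    show "psi i (sca f) - ext_phi i (sca f) = 0" if "f \<in> ser_carrier n" for f
      using psi i that by (simp add: tilde_ok_def ext_phi_sca)
    show "psi i (dx m) - ext_phi i (dx m) = 0" if "m < n" for m
    proof -
      have "psi i (dx m) = ext_neg (\<lambda>S \<alpha>. \<Sum>k<n. \<Sum>r<n. \<Sum>s<n. ext_mul (dx k)
        (sca (ser_mul (ser_mul (N k s) (ser_pd r (M s m))) (M r i))) S \<alpha>)"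
        using psi i that unfolding tilde_ok_def by blast
      then show ?thesis
        unfolding ext_phi_dx_formula[OF i that] by simp
    qed
  qed
  then show ?thesis by simp
qed

end

section \<open>Words, relators and the smash product ideal\<close>

text \<open>The sum over all ways to distribute the letters of a word to two subwords, i.e. over the
  terms of its coproduct.\<close>

fun split_sum :: "(nat list \<Rightarrow> nat list \<Rightarrow> 'b::comm_monoid_add) \<Rightarrow> nat list \<Rightarrow> 'b" where
  "split_sum F [] = F [] []"
| "split_sum F (x # w) = split_sum (\<lambda>p q. F (x # p) q) w + split_sum (\<lambda>p q. F p (x # q)) w"

text \<open>Subsets of positions are sorted by whether they contain position 0. This corresponds to
  sending the first letter of a word to one side or the other.\<close>

lemma sum_Pow_lessThan_Suc:
  fixes G :: "nat set \<Rightarrow> 'b::comm_monoid_add"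
  shows "(\<Sum>T\<in>Pow {..<Suc n}. G T) =
    (\<Sum>T\<in>Pow {..<n}. G (insert 0 (Suc ` T))) + (\<Sum>T\<in>Pow {..<n}. G (Suc ` T))"
proof -
  have inj: "inj_on ((`) Suc) (Pow {..<n})"
    by (intro inj_onI) (simp add: inj_image_eq_iff)
  have inj': "inj_on (insert 0) ((`) Suc ` Pow {..<n})"
    by (auto simp: inj_on_def insert_eq_iff)
  have "Pow {..<Suc n} = Pow (insert 0 (Suc ` {..<n}))"
    by (simp only: lessThan_Suc_eq_insert_0)
  also have "\<dots> = (`) Suc ` Pow {..<n} \<union> insert 0 ` ((`) Suc ` Pow {..<n})"
    by (simp only: Pow_insert image_Pow_surj[OF refl])
  finally have "(\<Sum>T\<in>Pow {..<Suc n}. G T) =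
      (\<Sum>T\<in>(`) Suc ` Pow {..<n}. G T) + (\<Sum>T\<in>insert 0 ` ((`) Suc ` Pow {..<n}). G T)"
    by (simp only:) (rule sum.union_disjoint, auto)
  also have "(\<Sum>T\<in>insert 0 ` ((`) Suc ` Pow {..<n}). G T) = (\<Sum>T\<in>Pow {..<n}. G (insert 0 (Suc ` T)))"
    using inj inj' by (simp add: sum.reindex)
  also have "(\<Sum>T\<in>(`) Suc ` Pow {..<n}. G T) = (\<Sum>T\<in>Pow {..<n}. G (Suc ` T))"
    using inj by (simp add: sum.reindex)
  finally show ?thesis by (simp only: add.commute)
qed

text \<open>Translates the coproduct from subsets of positions, as in the definitions of the Hopf
  action and of the smash product, to a recursion along the word, which suits induction.\<close>

lemma split_sum_eq_sum_Pow:
  "(\<Sum>T\<in>Pow {..<length w}. F (nths w T) (nths w ({..<length w} - T))) = split_sum F w"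
proof (induction w arbitrary: F)
  case (Cons x w)
  have 1: "nths (x # w) (insert 0 (Suc ` T)) = x # nths w T"
    "nths (x # w) ({..<Suc (length w)} - insert 0 (Suc ` T)) = nths w ({..<length w} - T)"
    "nths (x # w) (Suc ` T) = nths w T"
    "nths (x # w) ({..<Suc (length w)} - Suc ` T) = x # nths w ({..<length w} - T)" for T
  proof -
    have "{j. Suc j \<in> insert 0 (Suc ` T)} = T" "{j. Suc j \<in> Suc ` T} = T"
      "{j. Suc j \<in> {..<Suc (length w)} - insert 0 (Suc ` T)} = {..<length w} - T"
      "{j. Suc j \<in> {..<Suc (length w)} - Suc ` T} = {..<length w} - T"
      by auto
    then show "nths (x # w) (insert 0 (Suc ` T)) = x # nths w T"
      "nths (x # w) ({..<Suc (length w)} - insert 0 (Suc ` T)) = nths w ({..<length w} - T)"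
      "nths (x # w) (Suc ` T) = nths w T"
      "nths (x # w) ({..<Suc (length w)} - Suc ` T) = x # nths w ({..<length w} - T)"
      by (simp_all only: nths_Cons) auto
  qed
  show ?case
    unfolding list.size(4) add_Suc_right add_0_right sum_Pow_lessThan_Suc 1 split_sum.simps
    by (simp only: Cons.IH[symmetric])
qed simp

lemma split_sum_cong:
  "(\<And>p q. set p \<subseteq> set w \<Longrightarrow> set q \<subseteq> set w \<Longrightarrow> F p q = G p q) \<Longrightarrow> split_sum F w = split_sum G w"
proof (induction w arbitrary: F G)
  case (Cons x w)
  have "split_sum (\<lambda>p q. F (x # p) q) w = split_sum (\<lambda>p q. G (x # p) q) w"
    by (rule Cons.IH) (rule Cons.prems, auto)
  moreover have "split_sum (\<lambda>p q. F p (x # q)) w = split_sum (\<lambda>p q. G p (x # q)) w"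
    by (rule Cons.IH) (rule Cons.prems, auto)
  ultimately show ?case by simp
qed simp

lemma split_sum_add: "split_sum (\<lambda>p q. F p q + G p q) w = split_sum F w + split_sum G w"
  by (induction w arbitrary: F G) (simp_all add: ac_simps)

lemma split_sum_zero: "split_sum (\<lambda>p q. 0) w = 0"
  by (induction w) simp_all

text \<open>Multiplicativity of the coproduct of T(g): splitting a concatenation means splitting its
  two parts independently.\<close>

lemma split_sum_append:
  "split_sum F (u @ v) = split_sum (\<lambda>p q. split_sum (\<lambda>r s. F (p @ r) (q @ s)) v) u"
  by (induction u arbitrary: F) simp_all

lemma split_sum_swap:
  "split_sum (\<lambda>p q. split_sum (\<lambda>r s. F p q r s) v) u = split_sum (\<lambda>r s. split_sum (\<lambda>p q. F p q r s) u) v"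
proof (induction u arbitrary: F)
  case (Cons x u)
  show ?case by (simp only: split_sum.simps Cons.IH split_sum_add)
qed simp

lemma split_sum_coassoc:
  "split_sum (\<lambda>p q. split_sum (\<lambda>r s. F r s q) p) w = split_sum (\<lambda>p q. split_sum (\<lambda>r s. F p r s) q) w"
proof (induction w arbitrary: F)
  case (Cons x w)
  show ?case by (simp only: split_sum.simps split_sum_add Cons.IH add.assoc)
qed simp

lemma split_sum_closed:
  assumes "\<And>x y. x \<in> K \<Longrightarrow> y \<in> K \<Longrightarrow> x + y \<in> K"
    and "\<And>p q. set p \<subseteq> set w \<Longrightarrow> set q \<subseteq> set w \<Longrightarrow> F p q \<in> K"
  shows "split_sum F w \<in> K"
  using assms(2)
proof (induction w arbitrary: F)
  case (Cons x w)
  have "split_sum (\<lambda>p q. F (x # p) q) w \<in> K" "split_sum (\<lambda>p q. F p (x # q)) w \<in> K"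
    by (rule Cons.IH, rule Cons.prems, auto)+
  then show ?case using assms(1) by simp
qed simp

text \<open>The maps of interest, such as the action of a letter or multiplication in the smash
  product, are additive only on a carrier. Hence closure of the partial sums in \<open>K\<close>
  accompanies the induction.\<close>

lemma split_sum_hom:
  assumes "\<And>x y. x \<in> K \<Longrightarrow> y \<in> K \<Longrightarrow> x + y \<in> K"
    and "\<And>x y. x \<in> K \<Longrightarrow> y \<in> K \<Longrightarrow> h (x + y) = h x + h y"
    and "\<And>p q. set p \<subseteq> set w \<Longrightarrow> set q \<subseteq> set w \<Longrightarrow> F p q \<in> K"
  shows "h (split_sum F w) = split_sum (\<lambda>p q. h (F p q)) w"
  using assms(3)
proof (induction w arbitrary: F)
  case (Cons x w)
  have closed: "split_sum (\<lambda>p q. F (x # p) q) w \<in> K" "split_sum (\<lambda>p q. F p (x # q)) w \<in> K"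
    by (rule split_sum_closed[OF assms(1)], assumption+, rule Cons.prems, auto)+
  have "h (split_sum (\<lambda>p q. F (x # p) q) w) = split_sum (\<lambda>p q. h (F (x # p) q)) w"
    "h (split_sum (\<lambda>p q. F p (x # q)) w) = split_sum (\<lambda>p q. h (F p (x # q))) w"
    by (rule Cons.IH, rule Cons.prems, auto)+
  then show ?case
    using assms(2)[OF closed] by simp
qed simp

lemma split_sum_hom_UNIV:
  "(\<And>x y. h (x + y) = h x + h y) \<Longrightarrow> h (split_sum F w) = split_sum (\<lambda>p q. h (F p q)) w"
  by (rule split_sum_hom[where K = UNIV]) auto

text \<open>The value of a defining relator of U(g) under the linear extension of \<Phi>. The scalar
  multiplication is a parameter, so that the same expression serves for coefficients, for elements
  of A and for elements of T(g) \<otimes> A.\<close>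

definition word_rel :: "nat \<Rightarrow> (nat \<Rightarrow> nat \<Rightarrow> nat \<Rightarrow> 'k::field) \<Rightarrow> ('k \<Rightarrow> 'b \<Rightarrow> 'b) \<Rightarrow>
    (nat list \<Rightarrow> 'b::ab_group_add) \<Rightarrow> nat \<Rightarrow> nat \<Rightarrow> 'b" where
  "word_rel n C scale \<Phi> i j = \<Phi> [i, j] - \<Phi> [j, i] - (\<Sum>s<n. scale (C s i j) (\<Phi> [s]))"

text \<open>Replaces the positional description of u r v by indicator functions of words, in which
  the linear dependence on the relator r is visible.\<close>

lemma nc_sandwich_ug_rel:
  "nc_sandwich u (ug_rel n C i j) v w =
    word_rel n C (*) (\<lambda>m. if w = u @ m @ v then 1 else 0) i j"
proof (cases "\<exists>m. w = u @ m @ v")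
  case True
  then obtain m where m: "w = u @ m @ v" by blast
  have "ug_rel n C i j m = word_rel n C (*) (\<lambda>x. if m = x then 1 else 0) i j"
  proof (cases "\<exists>t<n. m = [t]")
    case True
    then show ?thesis by (auto simp: ug_rel_def word_rel_def if_distrib[of "(*) _"] cong: if_cong)
  next
    case False
    then have "(if length m = 1 \<and> hd m < n then C (hd m) i j else 0) = 0" by (cases m) auto
    moreover have "(\<Sum>s<n. C s i j * (if m = [s] then 1 else 0)) = 0"
      using False by (intro sum.neutral) auto
    ultimately show ?thesis by (simp only: ug_rel_def word_rel_def)
  qed
  then show ?thesis by (simp add: nc_sandwich_def m)
next
  case False
  have "w = u @ take (length w - length u - length v) (drop (length u) w) @ v"
    if "length u + length v \<le> length w" "take (length u) w = u" "drop (length w - length v) w = v"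
  proof -
    have "drop (length u) w = take (length w - length u - length v) (drop (length u) w) @
        drop (length w - length u - length v) (drop (length u) w)"
      by (rule append_take_drop_id[symmetric])
    also have "drop (length w - length u - length v) (drop (length u) w) = v"
      using that by (simp add: add.commute)
    finally show ?thesis
      using that(2) append_take_drop_id[of "length u" w] by metis
  qed
  then have "nc_sandwich u (ug_rel n C i j) v w = 0"
    using False by (auto simp: nc_sandwich_def)
  then show ?thesis using False by (simp add: word_rel_def)
qed

text \<open>\<open>ug_act_lin\<close> sums over a support, which is meaningful only when the support
  is finite. Each step adds at most n + 2 words.\<close>

lemma ug_ideal_finite:
  "h \<in> ug_ideal n C \<Longrightarrow> finite {w. h w \<noteq> 0} \<and> (\<forall>w. h w \<noteq> 0 \<longrightarrow> set w \<subseteq> {..<n})"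
proof (induction rule: ug_ideal.induct)
  case (step h i j u v c)
  let ?g = "nc_sandwich u (ug_rel n C i j) v"
  let ?G = "insert (u @ [i, j] @ v) (insert (u @ [j, i] @ v) ((\<lambda>s. u @ [s] @ v) ` {..<n}))"
  have "{w. ?g w \<noteq> 0} \<subseteq> ?G"
  proof
    fix w assume "w \<in> {w. ?g w \<noteq> 0}"
    moreover have "word_rel n C (*) (\<lambda>m. if w = u @ m @ v then 1 else 0) i j = 0" if "w \<notin> ?G"
    proof -
      have "w \<noteq> u @ [s] @ v" if "s < n" for s using \<open>w \<notin> ?G\<close> that by blast
      then show ?thesis using \<open>w \<notin> ?G\<close> by (auto simp: word_rel_def intro!: sum.neutral)
    qed
    ultimately show "w \<in> ?G" unfolding nc_sandwich_ug_rel by blast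
  qed
  then have sub: "{w. h w + c * ?g w \<noteq> 0} \<subseteq> {w. h w \<noteq> 0} \<union> ?G" by auto
  have "finite ({w. h w \<noteq> 0} \<union> ?G)" using step.IH by simp
  moreover have "set w \<subseteq> {..<n}" if "w \<in> {w. h w \<noteq> 0} \<union> ?G" for w
    using that step.IH step.hyps by auto
  ultimately show ?case
    using finite_subset[OF sub] sub by blast
qed simp

section \<open>Pure tensors and finitely supported elements of T(g) \<otimes> A\<close>

lemma sm_single_apply: "sm_single w a v = (if v = w then a else 0)"
  by (simp add: sm_single_def)

lemma sm_single_add: "sm_single w (a + b) = sm_single w a + sm_single w b"
  by (rule ext) (simp add: sm_single_apply pointwise(1))

lemma sm_single_zero [simp]: "sm_single w 0 = 0"
  by (rule ext) (simp add: sm_single_apply pointwise(2))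

definition sm_smul :: "'k::field \<Rightarrow> 'k sm \<Rightarrow> 'k sm" where
  "sm_smul c X = (\<lambda>v. ext_smul c (X v))"

lemma sm_smul_add: "sm_smul c (X + Y) = sm_smul c X + sm_smul c Y"
  by (simp add: sm_smul_def ext_smul_add fun_eq_iff pointwise(1))

lemma sm_smul_single: "sm_smul c (sm_single w a) = sm_single w (ext_smul c a)"
  by (auto simp: sm_smul_def sm_single_apply)

lemma sm_carrierI:
  "finite A \<Longrightarrow> (\<And>w. w \<notin> A \<Longrightarrow> X w = 0) \<Longrightarrow> (\<And>w. X w \<in> ext_carrier n) \<Longrightarrow>
    (\<And>w. w \<in> A \<Longrightarrow> set w \<subseteq> {..<n}) \<Longrightarrow> X \<in> sm_carrier n"
  unfolding sm_carrier_def ext_ops mem_Collect_eq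
  by (metis (mono_tags, lifting) finite_subset mem_Collect_eq subsetI)

lemma sm_carrierD:
  assumes "X \<in> sm_carrier n"
  shows "finite {w. X w \<noteq> 0}" "X w \<in> ext_carrier n" "X w \<noteq> 0 \<Longrightarrow> set w \<subseteq> {..<n}"
  using assms by (auto simp: sm_carrier_def)

lemma sm_carrier_single [simp]: "set w \<subseteq> {..<n} \<Longrightarrow> a \<in> ext_carrier n \<Longrightarrow> sm_single w a \<in> sm_carrier n"
  by (rule sm_carrierI[of "{w}"]) (auto simp: sm_single_apply)

lemma sm_carrier_zero [simp]: "0 \<in> sm_carrier n"
  by (rule sm_carrierI[of "{}"]) (auto simp: pointwise(2))

lemma sm_carrier_add [simp]:
  assumes "X \<in> sm_carrier n" "Y \<in> sm_carrier n"
  shows "X + Y \<in> sm_carrier n"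
  by (rule sm_carrierI[of "{w. X w \<noteq> 0} \<union> {w. Y w \<noteq> 0}"])
     (use sm_carrierD[OF assms(1)] sm_carrierD[OF assms(2)] in \<open>force simp: pointwise(1)\<close>)+

lemma sm_carrier_smul [simp]:
  assumes "X \<in> sm_carrier n"
  shows "sm_smul c X \<in> sm_carrier n"
  by (rule sm_carrierI[of "{w. X w \<noteq> 0}"])
     (use sm_carrierD[OF assms(1)] in \<open>auto simp: sm_smul_def\<close>)

lemma sm_smul_minus_one: "sm_smul (- 1) X = - X"
  by (simp add: sm_smul_def ext_smul_minus_one fun_eq_iff pointwise(4))

lemma sm_carrier_neg [simp]: "X \<in> sm_carrier n \<Longrightarrow> - X \<in> sm_carrier n"
  using sm_carrier_smul[of X n "- 1"] by (simp only: sm_smul_minus_one)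

lemma sm_carrier_diff [simp]: "X \<in> sm_carrier n \<Longrightarrow> Y \<in> sm_carrier n \<Longrightarrow> X - Y \<in> sm_carrier n"
  using sm_carrier_add[of X n "- Y"] by simp

lemma sm_carrier_sum: "(\<And>i. i \<in> A \<Longrightarrow> f i \<in> sm_carrier n) \<Longrightarrow> sum f A \<in> sm_carrier n"
  by (induction A rule: infinite_finite_induct) auto

lemma sm_carrier_split_sum:
  "(\<And>p q. set p \<subseteq> set w \<Longrightarrow> set q \<subseteq> set w \<Longrightarrow> F p q \<in> sm_carrier n) \<Longrightarrow> split_sum F w \<in> sm_carrier n"
  by (rule split_sum_closed) auto

text \<open>Additive identities in the smash product are thereby reduced to pure tensors.\<close>

lemma sm_carrier_induct [consumes 1, case_names single add]:
  assumes X: "X \<in> sm_carrier n"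
    and single: "\<And>w a. set w \<subseteq> {..<n} \<Longrightarrow> a \<in> ext_carrier n \<Longrightarrow> P (sm_single w a)"
    and add: "\<And>X Y. X \<in> sm_carrier n \<Longrightarrow> Y \<in> sm_carrier n \<Longrightarrow> P X \<Longrightarrow> P Y \<Longrightarrow> P (X + Y)"
  shows "P X"
proof -
  have "P (\<Sum>w\<in>A. sm_single w (X w)) \<and> (\<Sum>w\<in>A. sm_single w (X w)) \<in> sm_carrier n"
    if "finite A" "A \<subseteq> {w. X w \<noteq> 0}" for A
    using that
  proof (induction A rule: finite_induct)
    case empty
    show ?case using single[of "[]" 0] by simp
  next
    case (insert w A)
    have w: "set w \<subseteq> {..<n}" "X w \<in> ext_carrier n"
      using insert.prems sm_carrierD[OF X] by auto
    have "(\<Sum>w\<in>insert w A. sm_single w (X w)) = sm_single w (X w) + (\<Sum>w\<in>A. sm_single w (X w))"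
      using insert.hyps by (rule sum.insert)
    then show ?case
      using insert.prems insert.IH single[OF w] sm_carrier_single[OF w]
      by (simp add: add)
  qed
  then have "P (\<Sum>w\<in>{w. X w \<noteq> 0}. sm_single w (X w))"
    using sm_carrierD(1)[OF X] by blast
  also have "(\<Sum>w\<in>{w. X w \<noteq> 0}. sm_single w (X w)) = X"
  proof
    fix v
    have "(\<Sum>w\<in>{w. X w \<noteq> 0}. sm_single w (X w)) v = (\<Sum>w\<in>{w. X w \<noteq> 0}. if w = v then X v else 0)"
      by (subst sum_fun_apply, rule sum.cong) (auto simp: sm_single_apply)
    also have "\<dots> = X v"
      using sm_carrierD(1)[OF X] by (subst sum.delta) auto
    finally show "(\<Sum>w\<in>{w. X w \<noteq> 0}. sm_single w (X w)) v = X v" .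
  qed
  finally show ?thesis .
qed

text \<open>\<open>L\<close> will be multiplication by a fixed element from one side. It is
  controlled only on the carrier, so negation, subtraction and finite sums are first recovered from
  additivity and scaling by -1.\<close>

lemma word_rel_hom:
  fixes L :: "'k::field sm \<Rightarrow> 'k sm"
  assumes add: "\<And>X Y. X \<in> sm_carrier n \<Longrightarrow> Y \<in> sm_carrier n \<Longrightarrow> L (X + Y) = L X + L Y"
    and smul: "\<And>c X. X \<in> sm_carrier n \<Longrightarrow> L (sm_smul c X) = sm_smul c (L X)"
    and \<Phi>: "\<And>m. set m \<subseteq> {..<n} \<Longrightarrow> \<Phi> m \<in> sm_carrier n"
    and ij: "i < n" "j < n"
  shows "L (word_rel n C sm_smul \<Phi> i j) = word_rel n C sm_smul (\<lambda>m. L (\<Phi> m)) i j"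
proof -
  have neg: "L (- X) = - L X" if "X \<in> sm_carrier n" for X
    using smul[OF that, of "- 1"] by (simp only: sm_smul_minus_one)
  have diff: "L (X - Y) = L X - L Y" if "X \<in> sm_carrier n" "Y \<in> sm_carrier n" for X Y
    using add[OF that(1) sm_carrier_neg[OF that(2)]] by (simp add: neg[OF that(2)])
  have zero: "L 0 = 0" using diff[of 0 0] by simp
  have sum: "L (\<Sum>s\<in>A. f s) = (\<Sum>s\<in>A. L (f s))" if "\<And>s. s \<in> A \<Longrightarrow> f s \<in> sm_carrier n" for f and A :: "nat set"
    using that by (induction A rule: infinite_finite_induct) (auto simp: zero add sm_carrier_sum)
  have "L (\<Sum>s<n. sm_smul (C s i j) (\<Phi> [s])) = (\<Sum>s<n. sm_smul (C s i j) (L (\<Phi> [s])))"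
    by (subst sum) (auto simp: smul \<Phi>)
  moreover have c: "\<Phi> [i, j] \<in> sm_carrier n" "\<Phi> [j, i] \<in> sm_carrier n"
    "(\<Sum>s<n. sm_smul (C s i j) (\<Phi> [s])) \<in> sm_carrier n"
    using ij by (auto intro!: sm_carrier_sum sm_carrier_smul \<Phi>)
  ultimately show ?thesis
    by (simp only: word_rel_def diff[OF sm_carrier_diff[OF c(1,2)] c(3)] diff[OF c(1,2)])
qed

lemma word_rel_split_sum:
  "word_rel n C sm_smul (\<lambda>m. split_sum (F m) w) i j =
    split_sum (\<lambda>p q. word_rel n C sm_smul (\<lambda>m. F m p q) i j) w"
proof -
  have "split_sum (F [i, j]) w = split_sum (\<lambda>p q. word_rel n C sm_smul (\<lambda>m. F m p q) i j) w +
      split_sum (F [j, i]) w + (\<Sum>s<n. split_sum (\<lambda>p q. sm_smul (C s i j) (F [s] p q)) w)"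
  proof -
    have sum: "(\<Sum>s\<in>A. split_sum (G s) w) = split_sum (\<lambda>p q. \<Sum>s\<in>A. G s p q) w" for A :: "nat set" and G :: "nat \<Rightarrow> nat list \<Rightarrow> nat list \<Rightarrow> 'a sm"
      by (induction A rule: infinite_finite_induct) (simp_all add: split_sum_zero split_sum_add)
    show ?thesis
      unfolding sum split_sum_add[symmetric] by (simp add: word_rel_def)
  qed
  then show ?thesis
    by (simp add: word_rel_def split_sum_hom_UNIV[of "sm_smul _", OF sm_smul_add])
qed

abbreviation sm_rel :: "nat \<Rightarrow> (nat \<Rightarrow> nat \<Rightarrow> nat \<Rightarrow> 'k::field) \<Rightarrow> nat list \<Rightarrow> nat \<Rightarrow> nat \<Rightarrow> nat list \<Rightarrow> 'k ext \<Rightarrow> 'k sm" where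
  "sm_rel n C u i j v a \<equiv> word_rel n C sm_smul (\<lambda>m. sm_single (u @ m @ v) a) i j"

lemma sm_rel_eq: "sm_rel n C u i j v a = (\<lambda>w. ext_smul (nc_sandwich u (ug_rel n C i j) v w) a)"
proof (rule ext, rule ext, rule ext)
  fix w S \<alpha>
  have "sm_single x b w S \<alpha> = (if w = x then 1 else 0) * b S \<alpha>" for x and b :: "'a ext"
    by (simp add: sm_single_apply pointwise(2))
  then show "sm_rel n C u i j v a w S \<alpha> = ext_smul (nc_sandwich u (ug_rel n C i j) v w) a S \<alpha>"
    unfolding nc_sandwich_ug_rel word_rel_def pointwise sm_smul_def
    by (simp only: left_diff_distrib sum_distrib_right mult.assoc)
qed

lemma sm_rel_carrier:
  "i < n \<Longrightarrow> j < n \<Longrightarrow> set u \<subseteq> {..<n} \<Longrightarrow> set v \<subseteq> {..<n} \<Longrightarrow> a \<in> ext_carrier n \<Longrightarrow>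
    sm_rel n C u i j v a \<in> sm_carrier n"
  unfolding word_rel_def by (intro sm_carrier_diff sm_carrier_sum sm_carrier_smul sm_carrier_single) auto

lemma sm_ideal_stepI:
  assumes "X \<in> sm_ideal n C" "h \<in> ug_ideal n C" "a \<in> ext_carrier n"
  shows "X + (\<lambda>v. ext_smul (h v) a) \<in> sm_ideal n C"
proof -
  have "X + (\<lambda>v. ext_smul (h v) a) = (\<lambda>v. ext_add (X v) (ext_smul (h v) a))"
    by (simp add: fun_eq_iff pointwise)
  then show ?thesis using sm_ideal.step[OF assms] by simp
qed

lemma sm_ideal_zero: "0 \<in> sm_ideal n C"
  using sm_ideal.zero[of n C] by (simp add: zero_fun_def)

lemma sm_ideal_rel:
  assumes "i < n" "j < n" "set u \<subseteq> {..<n}" "set v \<subseteq> {..<n}" "a \<in> ext_carrier n"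
  shows "sm_rel n C u i j v a \<in> sm_ideal n C"
  using sm_ideal_stepI[OF sm_ideal_zero
    ug_ideal.step[where C = C and c = 1, OF ug_ideal.zero assms(1-4)] assms(5)]
  by (simp add: sm_rel_eq)

text \<open>Flattens the two nested inductive definitions: an element h \<otimes> a with h in I is
  built from one sandwiched relator at a time. Carrier membership is supplied so that additivity of
  the product applies in each step.\<close>

lemma sm_ideal_induct [consumes 1, case_names zero rel]:
  assumes "X \<in> sm_ideal n C"
    and zero: "P 0"
    and rel: "\<And>X i j u v a. X \<in> sm_carrier n \<Longrightarrow> P X \<Longrightarrow> i < n \<Longrightarrow> j < n \<Longrightarrow> set u \<subseteq> {..<n} \<Longrightarrow>
      set v \<subseteq> {..<n} \<Longrightarrow> a \<in> ext_carrier n \<Longrightarrow> P (X + sm_rel n C u i j v a)"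
  shows "P X"
proof -
  have "X \<in> sm_carrier n \<and> P X"
    using assms(1)
  proof (induction rule: sm_ideal.induct)
    case zero
    show ?case using \<open>P 0\<close> sm_carrier_zero[of n] by (simp add: zero_fun_def)
  next
    case (step X h a)
    have "X + (\<lambda>v. ext_smul (h v) a) \<in> sm_carrier n \<and> P (X + (\<lambda>v. ext_smul (h v) a))"
      using step.hyps(2)
    proof (induction rule: ug_ideal.induct)
      case zero
      have "(\<lambda>v. ext_smul 0 a) = (0 :: 'a sm)" by (simp add: zero_fun_def)
      then show ?case using step.IH by simp
    next
      case (step h i j u v c)
      let ?Y = "X + (\<lambda>v. ext_smul (h v) a)"
      \<comment> \<open>The coefficient c of the relator is absorbed into the factor from A.\<close>
      have "(\<lambda>w. ext_smul (h w + c * nc_sandwich u (ug_rel n C i j) v w) a) =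
          (\<lambda>v. ext_smul (h v) a) + sm_rel n C u i j v (ext_smul c a)"
        by (simp add: sm_rel_eq fun_eq_iff pointwise algebra_simps)
      then have eq: "X + (\<lambda>w. ext_smul (h w + c * nc_sandwich u (ug_rel n C i j) v w) a) =
          ?Y + sm_rel n C u i j v (ext_smul c a)"
        by (simp only: add.assoc)
      have a: "ext_smul c a \<in> ext_carrier n" using \<open>a \<in> ext_carrier n\<close> by simp
      note Y = conjunct1[OF step.IH] conjunct2[OF step.IH]
      have "?Y + sm_rel n C u i j v (ext_smul c a) \<in> sm_carrier n"
        by (rule sm_carrier_add[OF Y(1) sm_rel_carrier[OF step.hyps(2-5) a]])
      moreover have "P (?Y + sm_rel n C u i j v (ext_smul c a))"
        by (rule rel[OF Y step.hyps(2-5) a])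
      ultimately show ?case by (simp only: eq)
    qed
    moreover have "(\<lambda>v. ext_add (X v) (ext_smul (h v) a)) = X + (\<lambda>v. ext_smul (h v) a)"
      by (simp add: fun_eq_iff pointwise)
    ultimately show ?case by simp
  qed
  then show ?thesis by simp
qed

lemma sm_ideal_carrier: "X \<in> sm_ideal n C \<Longrightarrow> X \<in> sm_carrier n"
  by (induction rule: sm_ideal_induct) (simp_all add: sm_rel_carrier)

lemma sm_ideal_add: "X \<in> sm_ideal n C \<Longrightarrow> Y \<in> sm_ideal n C \<Longrightarrow> X + Y \<in> sm_ideal n C"
proof (induction rule: sm_ideal.induct)
  case zero
  have "(\<lambda>_. ext_zero) = (0 :: 'a sm)" by (simp add: zero_fun_def)
  then show ?case using zero by simp
next
  case (step X h a)
  have eq: "(\<lambda>v. ext_add (X v) (ext_smul (h v) a)) + Y = (X + Y) + (\<lambda>v. ext_smul (h v) a)"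
    by (simp add: fun_eq_iff pointwise)
  show ?case unfolding eq by (rule sm_ideal_stepI[OF step.IH[OF step.prems] step.hyps(2,3)])
qed

section \<open>The action of the enveloping algebra\<close>

lemma word_rel_cong:
  assumes "\<And>m. set m \<subseteq> {..<n} \<Longrightarrow> \<Phi> m = \<Psi> m" "i < n" "j < n"
  shows "word_rel n C scale \<Phi> i j = word_rel n C scale \<Psi> i j"
proof -
  have "(\<Sum>s<n. scale (C s i j) (\<Phi> [s])) = (\<Sum>s<n. scale (C s i j) (\<Psi> [s]))"
    using assms(1) by (intro sum.cong) auto
  then show ?thesis using assms by (simp add: word_rel_def)
qed

locale lie_ext_action =
  fixes n :: nat and C :: "nat \<Rightarrow> nat \<Rightarrow> nat \<Rightarrow> 'k::field" and psi :: "nat \<Rightarrow> 'k ext \<Rightarrow> 'k ext"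
  assumes hom: "lie_hom_ext n C psi"
begin

lemma psi_der: "i < n \<Longrightarrow> ext_der n (psi i)"
  using hom by (simp add: lie_hom_ext_def)

lemma psi_commutator:
  assumes "i < n" "j < n" "a \<in> ext_carrier n"
  shows "psi i (psi j a) - psi j (psi i a) = (\<Sum>s<n. ext_smul (C s i j) (psi s a))"
  using hom assms by (simp add: lie_hom_ext_def fun_eq_iff pointwise)

lemma ug_act_simps [simp]:
  "ug_act psi [] a = a" "ug_act psi (i # w) a = psi i (ug_act psi w a)"
  by (simp_all add: ug_act_def)

lemma ug_act_append: "ug_act psi (u @ v) a = ug_act psi u (ug_act psi v a)"
  by (induction u) simp_all

lemma ug_act_carrier [simp]:
  "set w \<subseteq> {..<n} \<Longrightarrow> a \<in> ext_carrier n \<Longrightarrow> ug_act psi w a \<in> ext_carrier n"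
  by (induction w) (auto simp: ext_derD(1)[OF psi_der])

lemma ug_act_add:
  "set w \<subseteq> {..<n} \<Longrightarrow> a \<in> ext_carrier n \<Longrightarrow> b \<in> ext_carrier n \<Longrightarrow>
    ug_act psi w (a + b) = ug_act psi w a + ug_act psi w b"
  by (induction w) (simp_all add: ext_derD(2)[OF psi_der])

lemma ug_act_smul:
  "set w \<subseteq> {..<n} \<Longrightarrow> a \<in> ext_carrier n \<Longrightarrow> ug_act psi w (ext_smul c a) = ext_smul c (ug_act psi w a)"
  by (induction w) (simp_all add: ext_derD(3)[OF psi_der])

text \<open>Every letter acts as a derivation, and applying the Leibniz rule letter by letter
  reproduces the recursion of \<open>split_sum\<close>.\<close>

lemma ug_act_mul:
  assumes "set w \<subseteq> {..<n}" "a \<in> ext_carrier n" "b \<in> ext_carrier n"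
  shows "ug_act psi w (ext_mul a b) = split_sum (\<lambda>p q. ext_mul (ug_act psi p a) (ug_act psi q b)) w"
  using assms(1)
proof (induction w)
  case (Cons x w)
  then have x: "x < n" and w: "set w \<subseteq> {..<n}" by auto
  have "ug_act psi (x # w) (ext_mul a b) =
      psi x (split_sum (\<lambda>p q. ext_mul (ug_act psi p a) (ug_act psi q b)) w)"
    using Cons.IH[OF w] by simp
  also have "\<dots> = split_sum (\<lambda>p q. psi x (ext_mul (ug_act psi p a) (ug_act psi q b))) w"
    by (rule split_sum_hom[where K = "ext_carrier n"])
       (use assms(2,3) w in \<open>auto simp: ext_derD(2)[OF psi_der[OF x]] intro!: ext_carrier_mul ug_act_carrier\<close>)
  also have "\<dots> = split_sum (\<lambda>p q. ext_mul (ug_act psi (x # p) a) (ug_act psi q b) +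
      ext_mul (ug_act psi p a) (ug_act psi (x # q) b)) w"
    by (rule split_sum_cong)
       (use w assms(2,3) in \<open>simp add: ext_derD(4)[OF psi_der[OF x]]\<close>)
  finally show ?case
    by (simp only: split_sum_add split_sum.simps)
qed simp

text \<open>The rightmost letter acts first and already kills the unit, hence the induction from the
  end of the word.\<close>

lemma ug_act_one: "set w \<subseteq> {..<n} \<Longrightarrow> w \<noteq> [] \<Longrightarrow> ug_act psi w ext_one = 0"
  by (induction w rule: rev_induct)
     (auto simp: ug_act_append ext_der_one[OF psi_der] ext_der_zero[OF psi_der] dest: ug_act_smul[of _ 0 0])

lemma ug_act_zero: "set w \<subseteq> {..<n} \<Longrightarrow> ug_act psi w 0 = 0"
  using ug_act_smul[of w 0 0] by simp

lemma ug_act_lin_eq: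
  assumes "finite A" "\<And>w. h w \<noteq> 0 \<Longrightarrow> w \<in> A"
  shows "ug_act_lin psi h a = (\<Sum>w\<in>A. ext_smul (h w) (ug_act psi w a))"
proof -
  have "ug_act_lin psi h a = (\<Sum>w\<in>{w. h w \<noteq> 0}. ext_smul (h w) (ug_act psi w a))"
    by (simp add: ug_act_lin_def fun_eq_iff pointwise)
  also have "\<dots> = (\<Sum>w\<in>A. ext_smul (h w) (ug_act psi w a))"
    using assms by (intro sum.mono_neutral_left) auto
  finally show ?thesis .
qed

text \<open>The word v acts first and merely replaces a by another element of the carrier. The
  commutator relation applies to that element, and u acts linearly on the outcome.\<close>

lemma ug_act_rel:
  assumes "i < n" "j < n" "set u \<subseteq> {..<n}" "set v \<subseteq> {..<n}" "a \<in> ext_carrier n"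
  shows "word_rel n C ext_smul (\<lambda>m. ug_act psi (u @ m @ v) a) i j = 0"
proof -
  define c where "c = ug_act psi v a"
  have c: "c \<in> ext_carrier n" using assms by (simp add: c_def)
  have K: "psi i c \<in> ext_carrier n" if "i < n" for i
    using ext_derD(1)[OF psi_der] that c by blast
  have sum: "ug_act psi u (\<Sum>s<n. ext_smul (C s i j) (psi s c)) = (\<Sum>s<n. ext_smul (C s i j) (ug_act psi u (psi s c)))"
  proof -
    have "ug_act psi u (\<Sum>s\<in>A. ext_smul (C s i j) (psi s c)) = (\<Sum>s\<in>A. ext_smul (C s i j) (ug_act psi u (psi s c))) \<and>
        (\<Sum>s\<in>A. ext_smul (C s i j) (psi s c)) \<in> ext_carrier n"
      if "A \<subseteq> {..<n}" "finite A" for A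
      using that(2,1)
    proof (induction A rule: finite_induct)
      case (insert s A)
      then show ?case using K[of s] assms(3) by (simp add: ug_act_add ug_act_smul)
    qed (simp add: ug_act_zero[OF assms(3)])
    then show ?thesis by simp
  qed
  have "ug_act psi u (psi i (psi j c)) = ug_act psi u (psi j (psi i c) + (\<Sum>s<n. ext_smul (C s i j) (psi s c)))"
    using psi_commutator[OF assms(1,2) c] by (simp add: algebra_simps)
  also have "\<dots> = ug_act psi u (psi j (psi i c)) + (\<Sum>s<n. ext_smul (C s i j) (ug_act psi u (psi s c)))"
    unfolding sum[symmetric]
    using K assms ext_derD(1)[OF psi_der] by (intro ug_act_add ext_carrier_sum) auto
  finally show ?thesis
    by (simp add: word_rel_def ug_act_append c_def)
qed

lemma ug_act_lin_ideal:
  assumes "h \<in> ug_ideal n C" and a: "a \<in> ext_carrier n"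
  shows "ug_act_lin psi h a = 0"
  using assms(1)
proof (induction rule: ug_ideal.induct)
  case zero
  show ?case using ug_act_lin_eq[of "{}" "\<lambda>_. 0" a] by simp
next
  case (step h i j u v c)
  define g where "g = nc_sandwich u (ug_rel n C i j) v"
  let ?G = "insert (u @ [i, j] @ v) (insert (u @ [j, i] @ v) ((\<lambda>s. u @ [s] @ v) ` {..<n}))"
  \<comment> \<open>One finite set of words carries all the sums; after cancellation the supports of
    \<open>h\<close> and of the new element need not be comparable.\<close>
  define A where "A = {w. h w \<noteq> 0} \<union> {w. h w + c * g w \<noteq> 0} \<union> ?G"
  have "(\<lambda>w. h w + c * g w) \<in> ug_ideal n C"
    unfolding g_def using step by (intro ug_ideal.step) auto
  then have fin: "finite A"
    using ug_ideal_finite step.hyps(1) unfolding A_def by blast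
  have delta: "(\<Sum>w\<in>A. ext_smul (if w = x then 1 else 0) (ug_act psi w a)) = ug_act psi x a" if "x \<in> A" for x
  proof -
    have "(\<Sum>w\<in>A. ext_smul (if w = x then 1 else 0) (ug_act psi w a)) =
        (\<Sum>w\<in>A. if w = x then ug_act psi x a else 0)"
      by (rule sum.cong) auto
    also have "\<dots> = ug_act psi x a"
      using fin that by (subst sum.delta) auto
    finally show ?thesis .
  qed
  have "(\<Sum>w\<in>A. ext_smul (g w) (ug_act psi w a)) = word_rel n C ext_smul (\<lambda>m. ug_act psi (u @ m @ v) a) i j"
  proof -
    have lin: "ext_smul (x - y - (\<Sum>s<n. C s i j * z s)) b =
      ext_smul x b - ext_smul y b - (\<Sum>s<n. ext_smul (C s i j) (ext_smul (z s) b))" for x y z and b :: "'k ext"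
      by (simp add: fun_eq_iff pointwise left_diff_distrib sum_distrib_right mult.assoc)
    have "(\<Sum>w\<in>A. ext_smul (g w) (ug_act psi w a)) =
        (\<Sum>w\<in>A. ext_smul (if w = u @ [i, j] @ v then 1 else 0) (ug_act psi w a)) -
        (\<Sum>w\<in>A. ext_smul (if w = u @ [j, i] @ v then 1 else 0) (ug_act psi w a)) -
        (\<Sum>s<n. ext_smul (C s i j) (\<Sum>w\<in>A. ext_smul (if w = u @ [s] @ v then 1 else 0) (ug_act psi w a)))"
      unfolding g_def nc_sandwich_ug_rel word_rel_def lin sum_subtractf ext_smul_sum
      by (subst sum.swap) (rule refl)
    also have "\<dots> = word_rel n C ext_smul (\<lambda>m. ug_act psi (u @ m @ v) a) i j"
      unfolding word_rel_def
      by (intro arg_cong2[where f = "(-)"] sum.cong arg_cong[where f = "ext_smul _"] delta refl)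
         (auto simp: A_def)
    finally show ?thesis .
  qed
  also have "\<dots> = 0"
    using step.hyps a by (intro ug_act_rel) auto
  finally have g0: "(\<Sum>w\<in>A. ext_smul (g w) (ug_act psi w a)) = 0" .
  have h0: "(\<Sum>w\<in>A. ext_smul (h w) (ug_act psi w a)) = 0"
    using step.IH ug_act_lin_eq[OF fin, of h a] by (auto simp: A_def)
  have "ug_act_lin psi (\<lambda>w. h w + c * g w) a = (\<Sum>w\<in>A. ext_smul (h w + c * g w) (ug_act psi w a))"
    by (rule ug_act_lin_eq[OF fin]) (simp add: A_def)
  also have "\<dots> = (\<Sum>w\<in>A. ext_smul (h w) (ug_act psi w a)) + ext_smul c (\<Sum>w\<in>A. ext_smul (g w) (ug_act psi w a))"
    by (simp add: ext_smul_add_scalar sum.distrib ext_smul_sum)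
  also have "\<dots> = 0" by (simp add: g0 h0)
  finally show ?case by (simp only: g_def)
qed

lemma hopf_action_psi: "hopf_action n C psi"
  unfolding hopf_action_def
proof (intro conjI ballI allI impI)
  show "ug_act_lin psi h a = ext_zero" if "h \<in> ug_ideal n C" "a \<in> ext_carrier n" for h a
    using ug_act_lin_ideal[OF that] by simp
next
  fix w assume w: "set w \<subseteq> {..<n}"
  show "ug_act psi w a \<in> ext_carrier n" if "a \<in> ext_carrier n" for a
    using w that by simp
  show "ug_act psi w (ext_smul c a) = ext_smul c (ug_act psi w a)" if "a \<in> ext_carrier n" for c a
    using w that by (rule ug_act_smul)
  show "ug_act psi w ext_one = (if w = [] then ext_one else ext_zero)"
    using ug_act_one[OF w] by simp
  fix a b :: "'k ext" assume ab: "a \<in> ext_carrier n" "b \<in> ext_carrier n"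
  show "ug_act psi w (ext_add a b) = ext_add (ug_act psi w a) (ug_act psi w b)"
    using ug_act_add[OF w ab] by simp
  show "ug_act psi w (ext_mul a b) = (\<lambda>S \<alpha>. \<Sum>T\<in>Pow {..<length w}.
      ext_mul (ug_act psi (nths w T) a) (ug_act psi (nths w ({..<length w} - T)) b) S \<alpha>)"
    unfolding ug_act_mul[OF w ab] split_sum_eq_sum_Pow[symmetric]
    by (simp add: fun_eq_iff pointwise)
qed

section \<open>The right action through the antipode\<close>

lemma ract_Nil [simp]: "ract psi a [] = a"
  by (simp add: ract_def)

text \<open>The antipode reverses a word and negates its letters, so in the right action the first
  letter acts first, as minus its derivation.\<close>

lemma ract_Cons:
  assumes "x < n" "set u \<subseteq> {..<n}" "a \<in> ext_carrier n"
  shows "ract psi a (x # u) = ract psi (- psi x a) u"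
  using assms ug_act_smul[of "rev u" "psi x a" "- 1"] ext_derD(1)[OF psi_der]
  by (simp add: ract_def ug_act_append ext_smul_minus_one[symmetric])

lemma ract_carrier [simp]: "set u \<subseteq> {..<n} \<Longrightarrow> a \<in> ext_carrier n \<Longrightarrow> ract psi a u \<in> ext_carrier n"
  by (simp add: ract_def)

lemma ract_add:
  "set u \<subseteq> {..<n} \<Longrightarrow> a \<in> ext_carrier n \<Longrightarrow> b \<in> ext_carrier n \<Longrightarrow>
    ract psi (a + b) u = ract psi a u + ract psi b u"
  by (simp add: ract_def ug_act_add ext_smul_add)

lemma ract_smul:
  "set u \<subseteq> {..<n} \<Longrightarrow> a \<in> ext_carrier n \<Longrightarrow> ract psi (ext_smul c a) u = ext_smul c (ract psi a u)"
  by (simp add: ract_def ug_act_smul mult.commute)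

lemma ract_append:
  assumes "set u \<subseteq> {..<n}" "set v \<subseteq> {..<n}" "a \<in> ext_carrier n"
  shows "ract psi a (u @ v) = ract psi (ract psi a u) v"
  using assms by (simp add: ract_def ug_act_append ug_act_smul power_add mult.commute)

text \<open>Minus a derivation is again a derivation, so the recursion of \<open>ract_Cons\<close>
  works directly. A detour through \<open>ug_act_mul\<close> would bring in the coproduct of a
  reversed word.\<close>

lemma ract_mul:
  assumes "set w \<subseteq> {..<n}" "a \<in> ext_carrier n" "b \<in> ext_carrier n"
  shows "ract psi (ext_mul a b) w = split_sum (\<lambda>p q. ext_mul (ract psi a p) (ract psi b q)) w"
  using assms
proof (induction w arbitrary: a b)
  case (Cons x w)
  then have x: "x < n" and w: "set w \<subseteq> {..<n}" by auto
  have c: "- psi x a \<in> ext_carrier n" "- psi x b \<in> ext_carrier n"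
    using ext_derD(1)[OF psi_der[OF x]] Cons.prems by auto
  have "ract psi (ext_mul a b) (x # w) = ract psi (ext_mul (- psi x a) b + ext_mul a (- psi x b)) w"
    using Cons.prems x w
    by (simp add: ract_Cons ext_derD(4)[OF psi_der[OF x]] ext_mul_neg_left ext_mul_neg_right)
  also have "\<dots> = ract psi (ext_mul (- psi x a) b) w + ract psi (ext_mul a (- psi x b)) w"
    using Cons.prems c w by (simp add: ract_add)
  also have "\<dots> = split_sum (\<lambda>p q. ext_mul (ract psi (- psi x a) p) (ract psi b q)) w +
      split_sum (\<lambda>p q. ext_mul (ract psi a p) (ract psi (- psi x b) q)) w"
    by (simp only: Cons.IH[OF w c(1) Cons.prems(3)] Cons.IH[OF w Cons.prems(2) c(2)])
  also have "\<dots> = split_sum (\<lambda>p q. ext_mul (ract psi a (x # p)) (ract psi b q)) w +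
      split_sum (\<lambda>p q. ext_mul (ract psi a p) (ract psi b (x # q))) w"
    by (intro arg_cong2[where f = "(+)"] split_sum_cong)
       (use w Cons.prems in \<open>simp_all add: ract_Cons[OF x]\<close>)
  finally show ?case by (simp only: split_sum.simps)
qed simp

text \<open>The antipode maps a relator to its negative. Together with the sign of the surrounding
  letters, this brings the claim back to the left action.\<close>

lemma ract_rel:
  assumes "i < n" "j < n" "set u \<subseteq> {..<n}" "set v \<subseteq> {..<n}" "a \<in> ext_carrier n"
  shows "word_rel n C ext_smul (\<lambda>m. ract psi a (u @ m @ v)) i j = 0"
proof -
  let ?x = "(- 1) ^ (length u + length v) :: 'k"
  have "word_rel n C ext_smul (\<lambda>m. ract psi a (u @ m @ v)) i j =
      - ext_smul ?x (word_rel n C ext_smul (\<lambda>m. ug_act psi (rev v @ m @ rev u) a) i j)"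
    by (simp add: word_rel_def ract_def fun_eq_iff pointwise algebra_simps sum_distrib_left power_add sum_negf)
  also have "word_rel n C ext_smul (\<lambda>m. ug_act psi (rev v @ m @ rev u) a) i j = 0"
    using assms by (intro ug_act_rel) auto
  finally show ?thesis by simp
qed

text \<open>The product of the pure tensors w \<otimes> a and w' \<otimes> b: part of w' joins the
  word, and the complementary letters act on a.\<close>

definition single_mul :: "nat list \<Rightarrow> 'k ext \<Rightarrow> nat list \<Rightarrow> 'k ext \<Rightarrow> 'k sm" where
  "single_mul w a w' b = split_sum (\<lambda>p q. sm_single (w @ p) (ext_mul (ract psi a q) b)) w'"

lemma sm_mul_eq_single_mul:
  "sm_mul psi X Y = (\<Sum>w\<in>{w. X w \<noteq> 0}. \<Sum>w'\<in>{w'. Y w' \<noteq> 0}. single_mul w (X w) w' (Y w'))"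
proof (rule ext, rule ext, rule ext)
  fix v S \<alpha>
  have "(\<Sum>T\<in>{T. T \<subseteq> {..<length w'} \<and> w @ nths w' T = v}.
      ext_mul (ract psi a (nths w' ({..<length w'} - T))) b S \<alpha>) = single_mul w a w' b v S \<alpha>" for w w' a b
  proof -
    have "single_mul w a w' b v S \<alpha> = (\<Sum>T\<in>Pow {..<length w'}.
        if w @ nths w' T = v then ext_mul (ract psi a (nths w' ({..<length w'} - T))) b S \<alpha> else 0)"
      unfolding single_mul_def split_sum_eq_sum_Pow[symmetric] pointwise
      by (intro sum.cong) (auto simp: sm_single_apply pointwise)
    also have "\<dots> = (\<Sum>T\<in>{T. T \<subseteq> {..<length w'} \<and> w @ nths w' T = v}.
        ext_mul (ract psi a (nths w' ({..<length w'} - T))) b S \<alpha>)"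
      by (simp add: sum.If_cases Int_def)
    finally show ?thesis by simp
  qed
  then show "sm_mul psi X Y v S \<alpha> =
      (\<Sum>w\<in>{w. X w \<noteq> 0}. \<Sum>w'\<in>{w'. Y w' \<noteq> 0}. single_mul w (X w) w' (Y w')) v S \<alpha>"
    by (simp add: sm_mul_def pointwise)
qed

lemma single_mul_carrier:
  assumes "set w \<subseteq> {..<n}" "set w' \<subseteq> {..<n}" "a \<in> ext_carrier n" "b \<in> ext_carrier n"
  shows "single_mul w a w' b \<in> sm_carrier n"
  unfolding single_mul_def
proof (rule sm_carrier_split_sum)
  fix p q assume "set p \<subseteq> set w'" "set q \<subseteq> set w'"
  then show "sm_single (w @ p) (ext_mul (ract psi a q) b) \<in> sm_carrier n"
    using assms by (intro sm_carrier_single ext_carrier_mul ract_carrier) auto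
qed

lemma single_mul_add_left:
  assumes "set w' \<subseteq> {..<n}" "a \<in> ext_carrier n" "a' \<in> ext_carrier n"
  shows "single_mul w (a + a') w' b = single_mul w a w' b + single_mul w a' w' b"
  unfolding single_mul_def split_sum_add[symmetric]
  by (rule split_sum_cong) (use assms in \<open>simp add: ract_add ext_mul_add_left sm_single_add\<close>)

lemma single_mul_add_right: "single_mul w a w' (b + b') = single_mul w a w' b + single_mul w a w' b'"
  by (simp add: single_mul_def ext_mul_add_right sm_single_add split_sum_add)

lemma single_mul_smul_left:
  assumes "set w' \<subseteq> {..<n}" "a \<in> ext_carrier n"
  shows "single_mul w (ext_smul c a) w' b = sm_smul c (single_mul w a w' b)"
  unfolding single_mul_def split_sum_hom_UNIV[of "sm_smul c", OF sm_smul_add]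
  by (rule split_sum_cong) (use assms in \<open>simp add: ract_smul ext_mul_smul_left sm_smul_single\<close>)

lemma single_mul_smul_right: "single_mul w a w' (ext_smul c b) = sm_smul c (single_mul w a w' b)"
  by (simp add: single_mul_def split_sum_hom_UNIV[of "sm_smul c", OF sm_smul_add]
      ext_mul_smul_right sm_smul_single)

lemma single_mul_zero: "single_mul w a w' 0 = 0" "set w' \<subseteq> {..<n} \<Longrightarrow> single_mul w 0 w' b = 0"
  using single_mul_add_right[of w a w' 0 0] single_mul_add_left[of w' 0 0 w b] by simp_all

text \<open>Enlarging the supports lets products of different elements be compared over common index
  sets. The condition on letters in \<open>B\<close> is there because a zero left factor yields zero
  only when the word acting on it has indices below n.\<close>

lemma sm_mul_expand:
  assumes "finite A" "finite B" "\<And>w. X w \<noteq> 0 \<Longrightarrow> w \<in> A" "\<And>w. Y w \<noteq> 0 \<Longrightarrow> w \<in> B"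
    and "\<And>w. w \<in> B \<Longrightarrow> set w \<subseteq> {..<n}"
  shows "sm_mul psi X Y = (\<Sum>w\<in>A. \<Sum>w'\<in>B. single_mul w (X w) w' (Y w'))"
proof -
  have "(\<Sum>w'\<in>{w'. Y w' \<noteq> 0}. single_mul w (X w) w' (Y w')) = (\<Sum>w'\<in>B. single_mul w (X w) w' (Y w'))" for w
    using assms(2,4) by (intro sum.mono_neutral_left) (auto simp: single_mul_zero)
  then have "sm_mul psi X Y = (\<Sum>w\<in>{w. X w \<noteq> 0}. \<Sum>w'\<in>B. single_mul w (X w) w' (Y w'))"
    by (simp only: sm_mul_eq_single_mul)
  also have "\<dots> = (\<Sum>w\<in>A. \<Sum>w'\<in>B. single_mul w (X w) w' (Y w'))"
    using assms(1,3,5) by (intro sum.mono_neutral_left) (auto simp: single_mul_zero intro!: sum.neutral)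
  finally show ?thesis .
qed

lemma sm_mul_add_left:
  assumes "X \<in> sm_carrier n" "X' \<in> sm_carrier n" "Y \<in> sm_carrier n"
  shows "sm_mul psi (X + X') Y = sm_mul psi X Y + sm_mul psi X' Y"
proof -
  let ?A = "{w. X w \<noteq> 0} \<union> {w. X' w \<noteq> 0}" and ?B = "{w. Y w \<noteq> 0}"
  note X = sm_carrierD[OF assms(1)] and X' = sm_carrierD[OF assms(2)] and Y = sm_carrierD[OF assms(3)]
  have expand: "sm_mul psi Z Y = (\<Sum>w\<in>?A. \<Sum>w'\<in>?B. single_mul w (Z w) w' (Y w'))"
    if "\<And>w. Z w \<noteq> 0 \<Longrightarrow> w \<in> ?A" for Z
    using X(1) X'(1) Y(1,3) that by (intro sm_mul_expand) auto
  have "sm_mul psi X Y = (\<Sum>w\<in>?A. \<Sum>w'\<in>?B. single_mul w (X w) w' (Y w'))"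
    "sm_mul psi X' Y = (\<Sum>w\<in>?A. \<Sum>w'\<in>?B. single_mul w (X' w) w' (Y w'))"
    "sm_mul psi (X + X') Y = (\<Sum>w\<in>?A. \<Sum>w'\<in>?B. single_mul w ((X + X') w) w' (Y w'))"
    by (rule expand, force simp: pointwise(1))+
  moreover have "single_mul w ((X + X') w) w' (Y w') = single_mul w (X w) w' (Y w') + single_mul w (X' w) w' (Y w')"
    if "w' \<in> ?B" for w w'
    unfolding plus_fun_apply[of X X' w] using Y(3) that by (intro single_mul_add_left X(2) X'(2)) auto
  ultimately show ?thesis by (simp add: sum.distrib)
qed

lemma sm_mul_add_right:
  assumes "X \<in> sm_carrier n" "Y \<in> sm_carrier n" "Y' \<in> sm_carrier n"
  shows "sm_mul psi X (Y + Y') = sm_mul psi X Y + sm_mul psi X Y'"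
proof -
  let ?A = "{w. X w \<noteq> 0}" and ?B = "{w. Y w \<noteq> 0} \<union> {w. Y' w \<noteq> 0}"
  note X = sm_carrierD[OF assms(1)] and Y = sm_carrierD[OF assms(2)] and Y' = sm_carrierD[OF assms(3)]
  have B: "set w \<subseteq> {..<n}" if "w \<in> ?B" for w
    using that Y(3) Y'(3) by blast
  have expand: "sm_mul psi X Z = (\<Sum>w\<in>?A. \<Sum>w'\<in>?B. single_mul w (X w) w' (Z w'))"
    if "\<And>w. Z w \<noteq> 0 \<Longrightarrow> w \<in> ?B" for Z
    using X(1) Y(1) Y'(1) that B by (intro sm_mul_expand) auto
  have "sm_mul psi X Y = (\<Sum>w\<in>?A. \<Sum>w'\<in>?B. single_mul w (X w) w' (Y w'))"
    "sm_mul psi X Y' = (\<Sum>w\<in>?A. \<Sum>w'\<in>?B. single_mul w (X w) w' (Y' w'))"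
    "sm_mul psi X (Y + Y') = (\<Sum>w\<in>?A. \<Sum>w'\<in>?B. single_mul w (X w) w' ((Y + Y') w'))"
    by (rule expand, force simp: pointwise(1))+
  then show ?thesis by (simp add: sum.distrib single_mul_add_right plus_fun_apply[of Y Y'])
qed

lemma sm_mul_single:
  assumes "set w' \<subseteq> {..<n}"
  shows "sm_mul psi (sm_single w a) (sm_single w' b) = single_mul w a w' b"
proof -
  have "sm_mul psi (sm_single w a) (sm_single w' b) =
      (\<Sum>x\<in>{w}. \<Sum>y\<in>{w'}. single_mul x (sm_single w a x) y (sm_single w' b y))"
    using assms by (intro sm_mul_expand) (auto simp: sm_single_apply split: if_splits)
  then show ?thesis by (simp add: sm_single_apply)
qed

lemma sm_mul_carrier:
  assumes "X \<in> sm_carrier n" "Y \<in> sm_carrier n"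
  shows "sm_mul psi X Y \<in> sm_carrier n"
  unfolding sm_mul_eq_single_mul
proof (intro sm_carrier_sum single_mul_carrier)
  fix w w' assume "w \<in> {w. X w \<noteq> 0}" "w' \<in> {w'. Y w' \<noteq> 0}"
  then show "set w \<subseteq> {..<n}" "set w' \<subseteq> {..<n}" "X w \<in> ext_carrier n" "Y w' \<in> ext_carrier n"
    using sm_carrierD[OF assms(1)] sm_carrierD[OF assms(2)] by auto
qed

lemma sm_mul_smul_left:
  assumes X: "X \<in> sm_carrier n" and Y: "Y \<in> sm_carrier n"
  shows "sm_mul psi (sm_smul c X) Y = sm_smul c (sm_mul psi X Y)"
  using X
proof (induction X rule: sm_carrier_induct)
  case (single w a)
  show ?case using Y
  proof (induction Y rule: sm_carrier_induct)
    case (single w' b)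
    then show ?case
      using \<open>a \<in> ext_carrier n\<close> by (simp add: sm_smul_single sm_mul_single single_mul_smul_left)
  next
    case (add Y Y')
    then show ?case
      using single by (simp add: sm_mul_add_right sm_smul_add)
  qed
next
  case (add X X')
  then show ?case
    using Y by (simp add: sm_smul_add sm_mul_add_left)
qed

lemma sm_mul_smul_right:
  assumes X: "X \<in> sm_carrier n" and Y: "Y \<in> sm_carrier n"
  shows "sm_mul psi X (sm_smul c Y) = sm_smul c (sm_mul psi X Y)"
  using X
proof (induction X rule: sm_carrier_induct)
  case (single w a)
  show ?case using Y
  proof (induction Y rule: sm_carrier_induct)
    case (single w' b)
    then show ?case
      using \<open>a \<in> ext_carrier n\<close> by (simp add: sm_smul_single sm_mul_single single_mul_smul_right)
  next
    case (add Y Y')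
    then show ?case
      using single by (simp add: sm_mul_add_right sm_smul_add)
  qed
next
  case (add X X')
  then show ?case
    using Y by (simp add: sm_smul_add sm_mul_add_left)
qed

lemma sm_mul_split_sum_left:
  assumes "\<And>p q. set p \<subseteq> set w \<Longrightarrow> set q \<subseteq> set w \<Longrightarrow> F p q \<in> sm_carrier n" "Y \<in> sm_carrier n"
  shows "sm_mul psi (split_sum F w) Y = split_sum (\<lambda>p q. sm_mul psi (F p q) Y) w"
  by (rule split_sum_hom[where K = "sm_carrier n"]) (use assms in \<open>auto simp: sm_mul_add_left\<close>)

lemma sm_mul_split_sum_right:
  assumes "\<And>p q. set p \<subseteq> set w \<Longrightarrow> set q \<subseteq> set w \<Longrightarrow> F p q \<in> sm_carrier n" "X \<in> sm_carrier n"
  shows "sm_mul psi X (split_sum F w) = split_sum (\<lambda>p q. sm_mul psi X (F p q)) w"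
  by (rule split_sum_hom[where K = "sm_carrier n"]) (use assms in \<open>auto simp: sm_mul_add_right\<close>)

text \<open>Both bracketings expand over the same data: a splitting of \<open>w'\<close> in two and, by
  coassociativity, of \<open>w''\<close> in three.\<close>

lemma sm_mul_assoc_single:
  assumes w: "set w \<subseteq> {..<n}" "set w' \<subseteq> {..<n}" "set w'' \<subseteq> {..<n}"
    and a: "a \<in> ext_carrier n" and b: "b \<in> ext_carrier n" and c: "c \<in> ext_carrier n"
  shows "sm_mul psi (sm_mul psi (sm_single w a) (sm_single w' b)) (sm_single w'' c) =
    sm_mul psi (sm_single w a) (sm_mul psi (sm_single w' b) (sm_single w'' c))"
proof -
  define F where "F p q r t u = sm_single (w @ p @ r) (ext_mul (ract psi a (q @ t)) (ext_mul (ract psi b u) c))"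
    for p q r t u
  have "sm_mul psi (sm_mul psi (sm_single w a) (sm_single w' b)) (sm_single w'' c) =
      split_sum (\<lambda>p q. single_mul (w @ p) (ext_mul (ract psi a q) b) w'' c) w'"
    unfolding sm_mul_single[OF w(2)] unfolding single_mul_def[of w]
    by (subst sm_mul_split_sum_left)
       (use w a b c in \<open>auto intro!: sm_carrier_single ext_carrier_mul ract_carrier simp: sm_mul_single\<close>)
  also have "\<dots> = split_sum (\<lambda>p q. split_sum (\<lambda>r s. split_sum (\<lambda>t u. F p q r t u) s) w'') w'"
  proof (intro split_sum_cong)
    fix p q assume pq: "set p \<subseteq> set w'" "set q \<subseteq> set w'"
    show "single_mul (w @ p) (ext_mul (ract psi a q) b) w'' c =
        split_sum (\<lambda>r s. split_sum (\<lambda>t u. F p q r t u) s) w''"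
      unfolding single_mul_def
    proof (intro split_sum_cong)
      fix r s assume rs: "set r \<subseteq> set w''" "set s \<subseteq> set w''"
      have q: "set q \<subseteq> {..<n}" and s: "set s \<subseteq> {..<n}" using pq rs w by auto
      have "ract psi (ext_mul (ract psi a q) b) s =
          split_sum (\<lambda>t u. ext_mul (ract psi (ract psi a q) t) (ract psi b u)) s"
        using q s a b by (intro ract_mul) auto
      also have "\<dots> = split_sum (\<lambda>t u. ext_mul (ract psi a (q @ t)) (ract psi b u)) s"
        by (rule split_sum_cong) (use q s a in \<open>auto simp: ract_append\<close>)
      finally have "sm_single ((w @ p) @ r) (ext_mul (ract psi (ext_mul (ract psi a q) b) s) c) =
          sm_single ((w @ p) @ r) (ext_mul (split_sum (\<lambda>t u. ext_mul (ract psi a (q @ t)) (ract psi b u)) s) c)"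
        by simp
      also have "\<dots> = split_sum (\<lambda>t u. F p q r t u) s"
        unfolding F_def
        by (subst split_sum_hom_UNIV[of "\<lambda>x. sm_single ((w @ p) @ r) (ext_mul x c)"])
           (simp_all add: ext_mul_add_left sm_single_add ext_mul_assoc)
      finally show "sm_single ((w @ p) @ r) (ext_mul (ract psi (ext_mul (ract psi a q) b) s) c) =
          split_sum (\<lambda>t u. F p q r t u) s" .
    qed
  qed
  \<comment> \<open>Coassociativity brings r and t together. These are the letters of w'' that reach
    w \<otimes> a, r by joining the word and t by acting on a, whereas u acts on b.\<close>
  also have "\<dots> = split_sum (\<lambda>p q. split_sum (\<lambda>s u. split_sum (\<lambda>r t. F p q r t u) s) w'') w'"
    by (simp only: split_sum_coassoc)
  also have "\<dots> = split_sum (\<lambda>s u. split_sum (\<lambda>p q. split_sum (\<lambda>r t. F p q r t u) s) w') w''"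
    by (rule split_sum_swap)
  also have "\<dots> = split_sum (\<lambda>s u. single_mul w a (w' @ s) (ext_mul (ract psi b u) c)) w''"
    by (simp only: single_mul_def split_sum_append F_def)
  also have "\<dots> = sm_mul psi (sm_single w a) (sm_mul psi (sm_single w' b) (sm_single w'' c))"
    unfolding sm_mul_single[OF w(3)] unfolding single_mul_def[of w']
  proof (subst sm_mul_split_sum_right)
    show "sm_single (w' @ p) (ext_mul (ract psi b q) c) \<in> sm_carrier n"
      if "set p \<subseteq> set w''" "set q \<subseteq> set w''" for p q
      using that w b c by (intro sm_carrier_single ext_carrier_mul ract_carrier) auto
    show "split_sum (\<lambda>s u. single_mul w a (w' @ s) (ext_mul (ract psi b u) c)) w'' =
        split_sum (\<lambda>p q. sm_mul psi (sm_single w a) (sm_single (w' @ p) (ext_mul (ract psi b q) c))) w''"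
      by (rule split_sum_cong) (use w in \<open>auto simp: sm_mul_single\<close>)
  qed (use w a in simp)
  finally show ?thesis .
qed

lemma sm_mul_assoc:
  assumes X: "X \<in> sm_carrier n" and Y: "Y \<in> sm_carrier n" and Z: "Z \<in> sm_carrier n"
  shows "sm_mul psi (sm_mul psi X Y) Z = sm_mul psi X (sm_mul psi Y Z)"
  using X
proof (induction X rule: sm_carrier_induct)
  case wa: (single w a)
  show ?case using Y
  proof (induction Y rule: sm_carrier_induct)
    case wb: (single w' b)
    show ?case using Z
    proof (induction Z rule: sm_carrier_induct)
      case (single w'' c)
      then show ?case using wa wb by (intro sm_mul_assoc_single)
    next
      case (add Z Z')
      then show ?case using wa wb by (simp add: sm_mul_add_right sm_mul_carrier)
    qed
  next
    case (add Y Y')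
    then show ?case using wa Z by (simp add: sm_mul_add_right sm_mul_add_left sm_mul_carrier)
  qed
next
  case (add X X')
  then show ?case using Y Z by (simp add: sm_mul_add_left sm_mul_carrier)
qed

section \<open>Two-sidedness of the ideal\<close>

lemma sm_ideal_split_sum:
  "(\<And>p q. set p \<subseteq> set w \<Longrightarrow> set q \<subseteq> set w \<Longrightarrow> F p q \<in> sm_ideal n C) \<Longrightarrow> split_sum F w \<in> sm_ideal n C"
  by (rule split_sum_closed) (auto intro: sm_ideal_add)

text \<open>Multiplication by a pure tensor on the right only appends letters after v and changes
  the factor from A; the relator inside the word stays intact.\<close>

lemma sm_rel_mul_single:
  assumes ij: "i < n" "j < n" and u: "set u \<subseteq> {..<n}" and v: "set v \<subseteq> {..<n}" and a: "a \<in> ext_carrier n"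
    and w: "set w \<subseteq> {..<n}" and b: "b \<in> ext_carrier n"
  shows "sm_mul psi (sm_rel n C u i j v a) (sm_single w b) \<in> sm_ideal n C"
proof -
  have "sm_mul psi (sm_rel n C u i j v a) (sm_single w b) =
      word_rel n C sm_smul (\<lambda>m. sm_mul psi (sm_single (u @ m @ v) a) (sm_single w b)) i j"
    by (rule word_rel_hom[where L = "\<lambda>X. sm_mul psi X (sm_single w b)"])
       (use assms in \<open>auto simp: sm_mul_add_left sm_mul_smul_left intro!: sm_carrier_single\<close>)
  also have "\<dots> = split_sum (\<lambda>p q. sm_rel n C u i j (v @ p) (ext_mul (ract psi a q) b)) w"
    unfolding sm_mul_single[OF w] single_mul_def append_assoc by (rule word_rel_split_sum)
  also have "\<dots> \<in> sm_ideal n C"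
    by (rule sm_ideal_split_sum, rule sm_ideal_rel) (use assms in \<open>auto intro!: ext_carrier_mul ract_carrier\<close>)
  finally show ?thesis .
qed

text \<open>The relators are primitive: in the coproduct of \<open>[i, j] - [j, i] - \<Sum>\<^sub>s C\<^sub>s [s]\<close> the mixed
  terms cancel, leaving one term with the relator on the left, which lies in the ideal, and one with
  the relator on the right, which acts by zero.\<close>

lemma sm_single_mul_rel:
  assumes ij: "i < n" "j < n" and u: "set u \<subseteq> {..<n}" and v: "set v \<subseteq> {..<n}" and a: "a \<in> ext_carrier n"
    and w: "set w \<subseteq> {..<n}" and b: "b \<in> ext_carrier n"
  shows "sm_mul psi (sm_single w b) (sm_rel n C u i j v a) \<in> sm_ideal n C"
proof -
  \<comment> \<open>Here p, q split u, then r, s split the word put in place of the relator, and p',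
    q' split v; the first of each pair enters the word and the second acts on b.\<close>
  define E where "E p q p' q' r s = sm_single ((w @ p) @ r @ p') (ext_mul (ract psi b (q @ s @ q')) a)"
    for p q p' q' r s
  have "sm_mul psi (sm_single w b) (sm_rel n C u i j v a) =
      word_rel n C sm_smul (\<lambda>m. sm_mul psi (sm_single w b) (sm_single (u @ m @ v) a)) i j"
    by (rule word_rel_hom)
       (use assms in \<open>auto simp: sm_mul_add_right sm_mul_smul_right intro!: sm_carrier_single\<close>)
  also have "\<dots> = word_rel n C sm_smul (\<lambda>m. split_sum (\<lambda>p q. split_sum (\<lambda>p' q'. split_sum (E p q p' q') m) v) u) i j"
  proof -
    have "sm_mul psi (sm_single w b) (sm_single (u @ m @ v) a) =
        split_sum (\<lambda>p q. split_sum (\<lambda>p' q'. split_sum (E p q p' q') m) v) u" if "set m \<subseteq> {..<n}" for m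
    proof -
      have "sm_mul psi (sm_single w b) (sm_single (u @ m @ v) a) = single_mul w b (u @ m @ v) a"
        using that u v by (intro sm_mul_single) auto
      also have "\<dots> = split_sum (\<lambda>p q. split_sum (\<lambda>r s. split_sum (\<lambda>p' q'. E p q p' q' r s) v) m) u"
        by (simp only: single_mul_def split_sum_append E_def append_assoc)
      \<comment> \<open>The splitting of m is moved innermost, so that the relator can be formed for
        fixed splittings of u and v.\<close>
      also have "\<dots> = split_sum (\<lambda>p q. split_sum (\<lambda>p' q'. split_sum (E p q p' q') m) v) u"
        by (subst split_sum_swap) (rule refl)
      finally show ?thesis .
    qed
    then show ?thesis using ij by (intro word_rel_cong)
  qed
  also have "\<dots> = split_sum (\<lambda>p q. split_sum (\<lambda>p' q'. word_rel n C sm_smul (split_sum (E p q p' q')) i j) v) u"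
    by (simp only: word_rel_split_sum)
  also have "\<dots> \<in> sm_ideal n C"
  proof (intro sm_ideal_split_sum)
    fix p q p' q' assume "set p \<subseteq> set u" "set q \<subseteq> set u" "set p' \<subseteq> set v" "set q' \<subseteq> set v"
    then have pq: "set p \<subseteq> {..<n}" "set q \<subseteq> {..<n}" "set p' \<subseteq> {..<n}" "set q' \<subseteq> {..<n}"
      using u v by auto
    let ?E = "E p q p' q'"
    have "(\<Sum>s<n. sm_smul (C s i j) (?E [s] [] + ?E [] [s])) =
        (\<Sum>s<n. sm_smul (C s i j) (?E [s] [])) + (\<Sum>s<n. sm_smul (C s i j) (?E [] [s]))"
      by (simp add: sm_smul_add sum.distrib)
    then have "word_rel n C sm_smul (split_sum ?E) i j =
        word_rel n C sm_smul (\<lambda>m. ?E m []) i j + word_rel n C sm_smul (\<lambda>m. ?E [] m) i j"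
      by (simp add: word_rel_def algebra_simps)
    also have "word_rel n C sm_smul (\<lambda>m. ?E [] m) i j =
        sm_single ((w @ p) @ p') (ext_mul (word_rel n C ext_smul (\<lambda>m. ract psi b (q @ m @ q')) i j) a)"
    proof -
      have sum: "sm_single x (sum f {..<n}) = (\<Sum>s<n. sm_single x (f s))" for x and f :: "nat \<Rightarrow> 'k ext"
        using sum_comp_morphism[of "sm_single x" f "{..<n}"] by (simp add: sm_single_add o_def)
      have neg: "sm_single x (- c) = - sm_single x c" for x and c :: "'k ext"
        using sm_single_add[of x c "- c"] by (simp add: eq_neg_iff_add_eq_0 add.commute)
      have diff: "sm_single x (c - d) = sm_single x c - sm_single x d" for x and c d :: "'k ext"
        using sm_single_add[of x c "- d"] by (simp add: neg)
      show ?thesis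
        by (simp add: word_rel_def E_def ext_mul_diff_left ext_mul_sum_left ext_mul_smul_left
            diff sum sm_smul_single)
    qed
    also have "\<dots> = 0"
      using ij pq b by (simp add: ract_rel)
    also have "word_rel n C sm_smul (\<lambda>m. ?E m []) i j + 0 =
        sm_rel n C (w @ p) i j p' (ext_mul (ract psi b (q @ q')) a)"
      by (simp only: E_def append_Nil add_0_right)
    also have "\<dots> \<in> sm_ideal n C"
      by (rule sm_ideal_rel) (use ij pq w a b in \<open>auto intro!: ext_carrier_mul ract_carrier\<close>)
    finally show "word_rel n C sm_smul (split_sum ?E) i j \<in> sm_ideal n C" .
  qed
  finally show ?thesis .
qed

lemma sm_mul_zero:
  assumes "Y \<in> sm_carrier n"
  shows "sm_mul psi 0 Y = 0" "sm_mul psi Y 0 = 0"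
  using sm_mul_add_left[of 0 0 Y] sm_mul_add_right[of Y 0 0] assms by simp_all

lemma sm_ideal_mul_right:
  assumes X: "X \<in> sm_ideal n C" and Y: "Y \<in> sm_carrier n"
  shows "sm_mul psi X Y \<in> sm_ideal n C"
  using Y
proof (induction Y rule: sm_carrier_induct)
  case (single w b)
  from X show ?case
  proof (induction X rule: sm_ideal_induct)
    case zero
    then show ?case using single by (simp add: sm_mul_zero sm_ideal_zero)
  next
    case (rel X i j u v a)
    then show ?case
      using single by (simp add: sm_mul_add_left sm_rel_carrier sm_ideal_add sm_rel_mul_single)
  qed
next
  case (add Y Y')
  then show ?case using sm_ideal_carrier[OF X] by (simp add: sm_mul_add_right sm_ideal_add)
qed

lemma sm_ideal_mul_left:
  assumes X: "X \<in> sm_ideal n C" and Y: "Y \<in> sm_carrier n"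
  shows "sm_mul psi Y X \<in> sm_ideal n C"
  using Y
proof (induction Y rule: sm_carrier_induct)
  case (single w b)
  from X show ?case
  proof (induction X rule: sm_ideal_induct)
    case zero
    then show ?case using single by (simp add: sm_mul_zero sm_ideal_zero)
  next
    case (rel X i j u v a)
    then show ?case
      using single by (simp add: sm_mul_add_right sm_rel_carrier sm_ideal_add sm_single_mul_rel)
  qed
next
  case (add Y Y')
  then show ?case using sm_ideal_carrier[OF X] by (simp add: sm_mul_add_left sm_ideal_add)
qed

lemma smash_well_defined_psi: "smash_well_defined n C psi"
  unfolding smash_well_defined_def
  using sm_mul_assoc sm_ideal_mul_right sm_ideal_mul_left by blast

text \<open>The product of \<omega> with x_i has two terms, x_i \<otimes> \<omega> and \<omega>
  acted on by x_i from the right; the product in the other order consists of the first term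
  alone.\<close>

lemma sm_bracket_generator:
  assumes "i < n" "\<omega> \<in> ext_carrier n"
  shows "sm_bracket psi (sm_single [] \<omega>) (sm_single [i] ext_one) = sm_single [] (ract psi \<omega> [i])"
  using assms ext_one_mul(2)[OF assms(2)] ext_one_mul(1)[OF assms(2)]
    ext_one_mul(2)[OF ract_carrier[OF _ assms(2), of "[i]"]]
  by (simp add: sm_bracket_def sm_mul_single single_mul_def)

text \<open>Every bracket returns an element over the empty word, so the one-letter computation can
  be iterated. Brackets are taken from left to right, which is also the order in which the right
  action reads a word.\<close>

lemma sm_iter_br_eq:
  assumes "set is \<subseteq> {..<n}" "\<omega> \<in> ext_carrier n"
  shows "sm_iter_br psi (sm_single [] \<omega>) is = sm_single [] (ract psi \<omega> is)"
  using assms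
proof (induction "is" arbitrary: \<omega>)
  case (Cons i "is")
  then have i: "i < n" and "is": "set is \<subseteq> {..<n}" by auto
  have "sm_iter_br psi (sm_single [] \<omega>) (i # is) = sm_iter_br psi (sm_single [] (ract psi \<omega> [i])) is"
    by (simp add: sm_bracket_generator[OF i Cons.prems(2)])
  also have "\<dots> = sm_single [] (ract psi (ract psi \<omega> [i]) is)"
    using Cons.prems i by (intro Cons.IH) auto
  also have "ract psi (ract psi \<omega> [i]) is = ract psi \<omega> (i # is)"
    using ract_append[of "[i]" "is" \<omega>] Cons.prems by simp
  finally show ?case .
qed simp

end

theorem theorem2p1:
  fixes n :: nat
    and C :: "nat \<Rightarrow> nat \<Rightarrow> nat \<Rightarrow> 'k::field_char_0"
    and phi :: "nat \<Rightarrow> 'k ser \<Rightarrow> 'k ser"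
  assumes "is_lie_alg n C"
    and "lie_hom_ser n C phi"
    and "close_to_id n (phimat phi)"
  shows "\<exists>phit.
     tilde_ok n C phi phit \<and>
     (\<forall>phit'. tilde_ok n C phi phit' \<longrightarrow> (\<forall>i<n. \<forall>a\<in>ext_carrier n. phit' i a = phit i a)) \<and>
     hopf_action n C phit \<and>
     smash_well_defined n C phit \<and>
     (\<forall>\<omega>\<in>ext_carrier n. \<forall>is. set is \<subseteq> {..<n} \<longrightarrow>
        sm_sub (sm_iter_br phit (sm_single [] \<omega>) is) (sm_single [] (ract phit \<omega> is))
          \<in> sm_ideal n C)"
proof -
  interpret series: lie_series_action n C phi
    by standard (fact assms(2,3))+
  interpret action: lie_ext_action n C series.ext_phi
    by standard (rule series.lie_hom_ext_phi)
  show ?thesis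
  proof (intro exI[of _ series.ext_phi] conjI allI impI ballI)
    show "tilde_ok n C phi series.ext_phi"
      by (rule series.tilde_ok_ext_phi)
    show "phit' i a = series.ext_phi i a"
      if "tilde_ok n C phi phit'" "i < n" "a \<in> ext_carrier n" for phit' i a
      using that by (rule series.tilde_ok_unique)
    show "hopf_action n C series.ext_phi"
      by (rule action.hopf_action_psi)
    show "smash_well_defined n C series.ext_phi"
      by (rule action.smash_well_defined_psi)
    show "sm_sub (sm_iter_br series.ext_phi (sm_single [] \<omega>) is) (sm_single [] (ract series.ext_phi \<omega> is))
        \<in> sm_ideal n C" if "\<omega> \<in> ext_carrier n" "set is \<subseteq> {..<n}" for \<omega> "is"
      by (simp add: action.sm_iter_br_eq[OF that(2,1)] sm_ideal_zero)
  qed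
qed

end
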